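(* Let $X$ be a one-dimensional stable process with index $\alpha\in(1,2)$ and positivity parameter $\rho$, with $\alpha\rho,\alpha\hat\rho\in(0,1)$ where $\hat\rho=1-\rho$, and let $\tau^{\{0\}}=\inf\{t>0:X_t=0\}$. Then for $x\in\mathbb{R}\setminus\{0\}$ the potential measure $U^{\{0\}}(x,dy)=\int_0^\infty\mathbb{P}_x(X_t\in dy,\,t<\tau^{\{0\}})dt$ is absolutely continuous with density satisfying, for $x,y\in\mathbb{R}\setminus\{0\}$, \[ u^{\{0\}}(x,y)=-\frac1\pi\Gamma(1-\alpha)\Big(|y|^{\alpha-1}s(y)-|y-x|^{\alpha-1}s(y-x)+|x|^{\alpha-1}s(-x)\Big), \] where $s(z)=\sin(\pi\alpha\rho)\mathbf{1}_{(z\ge0)}+\sin(\pi\alpha\hat\rho)\mathbf{1}_{(z<0)}$.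
   Context: A one-dimensional (strictly) stable process with index $\alpha$ and positivity parameter $\rho=\mathbb{P}(X_1\ge0)$ is the Lévy process with $\mathbb{E}[e^{i\theta X_t}]=e^{-t\Psi(\theta)}$, $\Psi(\theta)=|\theta|^\alpha\big(e^{\pi i\alpha(\frac12-\rho)}\mathbf{1}_{(\theta>0)}+e^{-\pi i\alpha(\frac12-\rho)}\mathbf{1}_{(\theta<0)}\big)$; $\mathbb{P}_x$ is its law issued from $x$. *)

theory Defs
  imports "HOL-Probability.Probability"
begin

definition stable_exponent :: "real \<Rightarrow> real \<Rightarrow> real \<Rightarrow> complex" where
  "stable_exponent \<alpha> \<rho> \<theta> =
     complex_of_real (\<bar>\<theta>\<bar> powr \<alpha>) *
     (if \<theta> > 0 then exp (\<i> * complex_of_real (pi * \<alpha> * (1/2 - \<rho>)))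
      else if \<theta> < 0 then exp (- \<i> * complex_of_real (pi * \<alpha> * (1/2 - \<rho>)))
      else 0)"

definition stable_process ::
  "'w measure \<Rightarrow> (real \<Rightarrow> 'w \<Rightarrow> real) \<Rightarrow> real \<Rightarrow> real \<Rightarrow> bool" where
  "stable_process M X \<alpha> \<rho> \<longleftrightarrow>
     prob_space M \<and>
     (\<forall>t. X t \<in> borel_measurable M) \<and>
     (\<forall>\<omega>\<in>space M. X 0 \<omega> = 0) \<and>
     (\<forall>\<omega>\<in>space M. \<forall>t\<ge>0. continuous (at_right t) (\<lambda>s. X s \<omega>) \<and>
          (t > 0 \<longrightarrow> (\<exists>l. ((\<lambda>s. X s \<omega>) \<longlongrightarrow> l) (at_left t)))) \<and>
     (\<forall>(n::nat) (t::nat \<Rightarrow> real). 0 \<le> t 0 \<and> (\<forall>i<n. t i < t (Suc i)) \<longrightarrow>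
          prob_space.indep_vars M (\<lambda>_. borel) (\<lambda>i \<omega>. X (t (Suc i)) \<omega> - X (t i) \<omega>) {..<n}) \<and>
     (\<forall>s t \<theta>. 0 \<le> s \<and> s \<le> t \<longrightarrow>
          char (distr M borel (\<lambda>\<omega>. X t \<omega> - X s \<omega>)) \<theta>
            = exp (- complex_of_real (t - s) * stable_exponent \<alpha> \<rho> \<theta>)) \<and>
     \<rho> = measure M {\<omega>\<in>space M. X 1 \<omega> \<ge> 0}"

definition hit_zero :: "(real \<Rightarrow> 'w \<Rightarrow> real) \<Rightarrow> real \<Rightarrow> 'w \<Rightarrow> ereal" where
  "hit_zero X x \<omega> = Inf (ereal ` {t. t > 0 \<and> x + X t \<omega> = 0})"

text \<open>Potential measure of the process killed at 0, issued from x: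
U(x,A) = int_0^infty P_x(X_t in A, t < tau) dt.  Probabilities are taken in the
completion of M (the event {t < tau} is universally measurable).\<close>
definition killed_potential ::
  "'w measure \<Rightarrow> (real \<Rightarrow> 'w \<Rightarrow> real) \<Rightarrow> real \<Rightarrow> real set \<Rightarrow> ennreal" where
  "killed_potential M X x A =
     (\<integral>\<^sup>+ t\<in>{0..}. emeasure (completion M)
        {\<omega>\<in>space M. ereal t < hit_zero X x \<omega> \<and> x + X t \<omega> \<in> A} \<partial>lborel)"

definition stable_s :: "real \<Rightarrow> real \<Rightarrow> real \<Rightarrow> real" where
  "stable_s \<alpha> \<rho> z = (if z \<ge> 0 then sin (pi * \<alpha> * \<rho>) else sin (pi * \<alpha> * (1 - \<rho>)))"

definition killed_density :: "real \<Rightarrow> real \<Rightarrow> real \<Rightarrow> real \<Rightarrow> real" where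
  "killed_density \<alpha> \<rho> x y =
     - (1 / pi) * Gamma (1 - \<alpha>) *
       (\<bar>y\<bar> powr (\<alpha> - 1) * stable_s \<alpha> \<rho> y
        - \<bar>y - x\<bar> powr (\<alpha> - 1) * stable_s \<alpha> \<rho> (y - x)
        + \<bar>x\<bar> powr (\<alpha> - 1) * stable_s \<alpha> \<rho> (- x))"

end

theory Submission
  imports Defs
begin

text \<open>
The resolvent of the process has the bounded continuous density
\<open>u\<^sub>q(z) = (2 pi)^(-1) \<integral> exp(-i\<theta>z) / (q + \<Psi>(\<theta>)) d\<theta>\<close>, since \<open>\<alpha> > 1\<close> makes the integrand integrable.
If \<open>\<sigma>\<close> is the hitting time of zero, the strong Markov property yields the killed resolvent density
\<open>u\<^sub>q(y - x) - E[exp(-q\<sigma>)] u\<^sub>q(y)\<close>, and \<open>E[exp(-q\<sigma>)] = u\<^sub>q(-x) / u\<^sub>q(0)\<close>. With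
\<open>h\<^sub>q(z) = u\<^sub>q(0) - u\<^sub>q(z)\<close> this density equals
\<open>h\<^sub>q(y) + h\<^sub>q(-x) - h\<^sub>q(y - x) - h\<^sub>q(-x) h\<^sub>q(y) / u\<^sub>q(0)\<close>. As \<open>q \<rightarrow> 0\<close>, \<open>u\<^sub>q(0)\<close> tends to infinity and
\<open>h\<^sub>q(z)\<close> to \<open>(2 pi)^(-1) \<integral> (1 - exp(-i\<theta>z)) / \<Psi>(\<theta>) d\<theta>\<close>, a Gamma integral.

The time \<open>\<sigma>\<close> is replaced by the limit of the hitting times of shrinking intervals around zero, themselves
limits of hitting times along dyadic grids. The strong Markov property is needed on grids only, where it
follows from independence of finitely many increments. A limiting resolvent identity shows that the process
is at zero at that limit time, so that it agrees almost surely with the (a priori not measurable) hitting time.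
\<close>

section \<open>Fractional moments of the exponential\<close>

text \<open>The obstacle is the passage to the limit along the hitting times. Dyadic times decrease
  to the entrance time of an interval, but the entrance times increase to their limit, and along
  increasing times a path with jumps converges only to its left limit. So X itself is not followed
  along these times. The strong Markov property is stated for the discounted integral of
  \<open>f\<close> along the path after time T, which is continuous in T for every path; both limits
  then follow by dominated convergence. This identity is used with two choices of \<open>f\<close>
  and of the rate \<open>r\<close> of that integral. With \<open>r = q\<close> and \<open>f\<close>
  the indicator of a narrow interval it yields the Laplace transform of the limit time. With
  \<open>r\<close> tending to infinity the integral concentrates at T and, by right continuity,
  gives back X at T. The signs of the densities cannot be read off from their formulas. They are
  obtained from the masses of intervals, by continuity.\<close>

lemma nn_integral_Gamma_scaled:
  fixes a R :: real
  assumes "a > 0" "R > 0"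
  shows "(\<integral>\<^sup>+t\<in>{0<..}. ennreal (t powr (a - 1) * exp (- R * t)) \<partial>lborel) = ennreal (Gamma a / R powr a)"
proof -
  let ?f = "\<lambda>t::real. ennreal (indicator {0..} t * t powr (a - 1) / exp t)"
  have "ennreal (Gamma a) = R * (\<integral>\<^sup>+t. ?f (0 + R * t) \<partial>lborel)"
    unfolding Gamma_conv_nn_integral_real[OF assms(1)]
    using assms by (subst nn_integral_real_affine[where c=R and t=0]) auto
  also have "(\<integral>\<^sup>+t. ?f (0 + R * t) \<partial>lborel)
      = (\<integral>\<^sup>+t. ennreal (R powr (a - 1)) * (ennreal (t powr (a - 1) * exp (- R * t)) * indicator {0<..} t) \<partial>lborel)"
    using assms
    by (intro nn_integral_cong)
       (auto simp: ennreal_mult[symmetric] powr_mult exp_minus field_simps zero_le_mult_iff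
         split: split_indicator)
  also have "\<dots> = ennreal (R powr (a - 1)) * (\<integral>\<^sup>+t\<in>{0<..}. ennreal (t powr (a - 1) * exp (- R * t)) \<partial>lborel)"
    by (rule nn_integral_cmult) auto
  finally have *: "ennreal (Gamma a) = ennreal (R powr a) * (\<integral>\<^sup>+t\<in>{0<..}. ennreal (t powr (a - 1) * exp (- R * t)) \<partial>lborel)"
    (is "_ = _ * ?I")
    using assms by (simp add: mult.assoc[symmetric] ennreal_mult[symmetric] powr_diff)
  have "ennreal (Gamma a / R powr a) = ennreal (inverse (R powr a)) * ennreal (Gamma a)"
    using assms by (simp add: ennreal_mult[symmetric] Gamma_real_pos divide_inverse mult.commute less_imp_le)
  also have "\<dots> = ennreal (inverse (R powr a) * R powr a) * ?I"
    unfolding * using assms by (simp add: mult.assoc[symmetric] ennreal_mult[symmetric])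
  finally show ?thesis using assms by simp
qed

lemma has_integral_Gamma_scaled:
  fixes a R :: real
  assumes "a > 0" "R > 0"
  shows "has_bochner_integral lborel (\<lambda>t. indicator {0<..} t * (t powr (a - 1) * exp (- R * t))) (Gamma a / R powr a)"
proof (rule has_bochner_integral_nn_integral)
  show "(\<integral>\<^sup>+ t. ennreal (indicator {0<..} t * (t powr (a - 1) * exp (- R * t))) \<partial>lborel) = ennreal (Gamma a / R powr a)"
    unfolding nn_integral_Gamma_scaled[OF assms, symmetric]
    by (intro nn_integral_cong) (auto split: split_indicator)
qed (use assms in \<open>auto simp: Gamma_real_pos less_imp_le\<close>)

lemma one_minus_notin_nonpos_Ints:
  fixes \<alpha> :: real
  assumes "1 < \<alpha>" "\<alpha> < 2"
  shows "1 - \<alpha> \<notin> \<int>\<^sub>\<le>\<^sub>0"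
proof
  assume "1 - \<alpha> \<in> \<int>\<^sub>\<le>\<^sub>0"
  then obtain n :: nat where "1 - \<alpha> = - of_nat n" by (auto elim: nonpos_Ints_cases')
  then have "0 < real n" "real n < 1" using assms by auto
  then show False by simp
qed

text \<open>Write \<open>1 - exp (- R * t)\<close> as the integral of
  \<open>t * exp (- t * u)\<close> over u in [0, R] and exchange the integrals: the inner one is a
  Gamma integral, the outer one a power. Everything is nonnegative, so Tonelli gives integrability
  as well. The sign comes from
  \<open>Gamma (2 - \<alpha>) = (1 - \<alpha>) * Gamma (1 - \<alpha>)\<close>, which makes
  \<open>Gamma (1 - \<alpha>)\<close> negative.\<close>

lemma has_integral_one_minus_exp:
  fixes \<alpha> R :: real
  assumes \<alpha>: "1 < \<alpha>" "\<alpha> < 2" and R: "R > 0"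
  shows "has_bochner_integral lborel (\<lambda>t. indicator {0<..} t * ((1 - exp (- R * t)) * t powr - \<alpha>))
           (- Gamma (1 - \<alpha>) * R powr (\<alpha> - 1))"
proof (rule has_bochner_integral_nn_integral)
  let ?f = "\<lambda>t u. ennreal (t powr (1 - \<alpha>) * exp (- t * u)) * indicator {0..R} u * indicator {0<..} t"
  have G: "Gamma (2 - \<alpha>) = (1 - \<alpha>) * Gamma (1 - \<alpha>)"
  proof -
    show ?thesis using Gamma_plus1[of "1 - \<alpha>"] one_minus_notin_nonpos_Ints[OF \<alpha>] by simp
  qed
  have e: "ennreal (1 - exp (- R * t)) = (\<integral>\<^sup>+u\<in>{0..R}. ennreal (t * exp (- t * u)) \<partial>lborel)" if "t > 0" for t
  proof -
    have "(\<integral>\<^sup>+u\<in>{0..R}. ennreal (t * exp (- t * u)) \<partial>lborel) = ennreal (- exp (- t * R) - - exp (- t * 0))"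
      using that R by (intro nn_integral_FTC_Icc) (auto intro!: derivative_eq_intros simp del: mult_minus_left)
    then show ?thesis by (simp add: mult.commute)
  qed
  have "(\<integral>\<^sup>+t. ennreal (indicator {0<..} t * ((1 - exp (- R * t)) * t powr - \<alpha>)) \<partial>lborel)
      = (\<integral>\<^sup>+t. (\<integral>\<^sup>+u. ?f t u \<partial>lborel) \<partial>lborel)"
  proof (rule nn_integral_cong)
    fix t :: real
    show "ennreal (indicator {0<..} t * ((1 - exp (- R * t)) * t powr - \<alpha>))
      = (\<integral>\<^sup>+u. ?f t u \<partial>lborel)"
    proof (cases "t > 0")
      case True
      have "ennreal (indicator {0<..} t * ((1 - exp (- R * t)) * t powr - \<alpha>))
          = ennreal (t powr - \<alpha>) * ennreal (1 - exp (- R * t))"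
        using True R by (simp add: ennreal_mult[symmetric] mult.commute)
      also have "\<dots> = (\<integral>\<^sup>+u. ennreal (t powr - \<alpha>) * (ennreal (t * exp (- t * u)) * indicator {0..R} u) \<partial>lborel)"
        unfolding e[OF True] by (rule nn_integral_cmult[symmetric]) auto
      also have "\<dots> = (\<integral>\<^sup>+u. ?f t u \<partial>lborel)"
        using True
        by (intro nn_integral_cong)
           (auto simp: ennreal_mult[symmetric] powr_diff powr_minus field_simps split: split_indicator)
      finally show ?thesis .
    qed auto
  qed
  also have "\<dots> = (\<integral>\<^sup>+u. (\<integral>\<^sup>+t. ?f t u \<partial>lborel) \<partial>lborel)"
    by (rule lborel_pair.Fubini') auto
  also have "\<dots> = (\<integral>\<^sup>+u. ennreal (Gamma (2 - \<alpha>)) * (ennreal (u powr (\<alpha> - 2)) * indicator {0..R} u) \<partial>lborel)"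
  proof (rule nn_integral_cong_AE)
    \<comment> \<open>At u = 0 the inner integral diverges, whereas
      \<open>0 powr (\<alpha> - 2)\<close> is 0 by convention.\<close>
    have "AE u in lborel. u \<noteq> (0::real)" by (rule AE_lborel_singleton)
    then show "AE u in lborel. (\<integral>\<^sup>+t. ?f t u \<partial>lborel)
       = ennreal (Gamma (2 - \<alpha>)) * (ennreal (u powr (\<alpha> - 2)) * indicator {0..R} u)"
    proof eventually_elim
      fix u :: real assume "u \<noteq> 0"
      show "(\<integral>\<^sup>+t. ?f t u \<partial>lborel)
       = ennreal (Gamma (2 - \<alpha>)) * (ennreal (u powr (\<alpha> - 2)) * indicator {0..R} u)"
      proof (cases "u \<in> {0..R}")
        case True
        then have u: "u > 0" using \<open>u \<noteq> 0\<close> by auto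
        have "(\<integral>\<^sup>+t. ?f t u \<partial>lborel)
           = (\<integral>\<^sup>+t\<in>{0<..}. ennreal (t powr ((2 - \<alpha>) - 1) * exp (- u * t)) \<partial>lborel)"
          using True by (intro nn_integral_cong) (auto simp: mult.commute split: split_indicator)
        also have "\<dots> = ennreal (Gamma (2 - \<alpha>) / u powr (2 - \<alpha>))"
          using \<alpha> u by (intro nn_integral_Gamma_scaled) auto
        also have "\<dots> = ennreal (Gamma (2 - \<alpha>)) * ennreal (u powr (\<alpha> - 2))"
          using \<alpha> u by (simp add: ennreal_mult[symmetric] Gamma_real_pos less_imp_le powr_diff)
        finally show ?thesis using True by simp
      qed auto
    qed
  qed
  also have "\<dots> = ennreal (Gamma (2 - \<alpha>)) * (\<integral>\<^sup>+u\<in>{0..R}. ennreal (u powr (\<alpha> - 2)) \<partial>lborel)"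
    by (rule nn_integral_cmult) auto
  also have "(\<integral>\<^sup>+u\<in>{0..R}. ennreal (u powr (\<alpha> - 2)) \<partial>lborel) = ennreal (R powr (\<alpha> - 1) / (\<alpha> - 1))"
  proof -
    have "(\<integral>\<^sup>+u. ennreal (if u \<in> {0..R} then u powr (\<alpha> - 2) else 0) \<partial>lborel) = ennreal (R powr (\<alpha> - 2 + 1) / (\<alpha> - 2 + 1))"
    proof (rule nn_integral_has_integral_lborel)
      show "((\<lambda>u. if u \<in> {0..R} then u powr (\<alpha> - 2) else 0) has_integral R powr (\<alpha> - 2 + 1) / (\<alpha> - 2 + 1)) UNIV"
        unfolding has_integral_restrict_UNIV using \<alpha> R by (intro has_integral_powr_from_0) auto
    qed auto
    moreover have "(\<integral>\<^sup>+u\<in>{0..R}. ennreal (u powr (\<alpha> - 2)) \<partial>lborel) = (\<integral>\<^sup>+u. ennreal (if u \<in> {0..R} then u powr (\<alpha> - 2) else 0) \<partial>lborel)"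
      by (intro nn_integral_cong) auto
    ultimately show ?thesis by simp
  qed
  also have "ennreal (Gamma (2 - \<alpha>)) * ennreal (R powr (\<alpha> - 1) / (\<alpha> - 1)) = ennreal (- Gamma (1 - \<alpha>) * R powr (\<alpha> - 1))"
  proof (subst ennreal_mult[symmetric])
    show "0 \<le> Gamma (2 - \<alpha>)" "0 \<le> R powr (\<alpha> - 1) / (\<alpha> - 1)"
      using \<alpha> by (auto simp: Gamma_real_pos less_imp_le)
    have "Gamma (2 - \<alpha>) * (R powr (\<alpha> - 1) / (\<alpha> - 1)) = - Gamma (1 - \<alpha>) * R powr (\<alpha> - 1)"
      using \<alpha> unfolding G by (simp add: field_simps)
    then show "ennreal (Gamma (2 - \<alpha>) * (R powr (\<alpha> - 1) / (\<alpha> - 1))) = ennreal (- Gamma (1 - \<alpha>) * R powr (\<alpha> - 1))"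
      by simp
  qed
  finally show "(\<integral>\<^sup>+t. ennreal (indicator {0<..} t * ((1 - exp (- R * t)) * t powr - \<alpha>)) \<partial>lborel)
     = ennreal (- Gamma (1 - \<alpha>) * R powr (\<alpha> - 1))" .
  have "Gamma (2 - \<alpha>) > 0" using \<alpha> by (simp add: Gamma_real_pos)
  then have "Gamma (1 - \<alpha>) < 0" using \<alpha> unfolding G by (auto simp: zero_less_mult_iff)
  then show "0 \<le> - Gamma (1 - \<alpha>) * R powr (\<alpha> - 1)" by (simp add: mult_nonpos_nonneg)
  show "AE t in lborel. 0 \<le> indicator {0<..} t * ((1 - exp (- R * t)) * t powr - \<alpha>)"
    using R by (auto intro!: AE_I2 mult_nonneg_nonneg split: split_indicator)
qed auto

text \<open>By the binomial series around \<open>R\<close>. Since \<open>R\<close> is arbitrary, the discs \<open>norm (s - R) < R\<close> cover the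
whole half plane \<open>Re s > 0\<close>, so that no analytic continuation is needed.\<close>
lemma integral_one_minus_exp_near_real:
  fixes \<alpha> R :: real and w :: complex
  assumes \<alpha>: "1 < \<alpha>" "\<alpha> < 2" and R: "R > 0" and w: "norm w < 1"
  shows "(LBINT t. indicator {0<..} t *\<^sub>R ((1 - exp (- (of_real R * (1 + w) * of_real t))) * of_real (t powr - \<alpha>)))
     = - of_real (Gamma (1 - \<alpha>)) * (of_real R * (1 + w)) powr of_real (\<alpha> - 1)"
proof -
  let ?G = "\<lambda>n. Gamma (real n + 1 - \<alpha>) / R powr (real n + 1 - \<alpha>)"
  let ?H = "\<lambda>t. indicator {0<..} t *\<^sub>R ((1 - exp (- (of_real R * (1 + w) * of_real t))) * of_real (t powr - \<alpha>))"
  let ?E = "\<lambda>t. of_real (indicator {0<..} t * (exp (- R * t) * t powr - \<alpha>)) :: complex"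
  \<comment> \<open>The terms of the expansion of \<open>exp (- R * w * t)\<close>, with the
    constant 1 of the integrand absorbed into term 0: alone,
    \<open>exp (- R * t) * t powr - \<alpha>\<close> is not integrable at 0.\<close>
  define F :: "nat \<Rightarrow> real \<Rightarrow> complex" where "F = (\<lambda>n t. if n = 0
      then of_real (indicator {0<..} t * ((1 - exp (- R * t)) * t powr - \<alpha>))
      else - ((- of_real R * w) ^ n / fact n * of_real (indicator {0<..} t * (t powr (real n + 1 - \<alpha> - 1) * exp (- R * t)))))"
  define c :: real where "c = - Gamma (1 - \<alpha>) * R powr (\<alpha> - 1)"
  note nonint = one_minus_notin_nonpos_Ints[OF \<alpha>]
  have Gn: "Gamma (real n + 1 - \<alpha>) = Gamma (1 - \<alpha>) * pochhammer (1 - \<alpha>) n" for n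
    using pochhammer_Gamma[OF nonint, of n] Gamma_eq_zero_iff[of "1 - \<alpha>"] nonint by (simp add: algebra_simps)
  have gbin: "((\<alpha> - 1) gchoose n) = (-1) ^ n * pochhammer (1 - \<alpha>) n / fact n" for n
    by (simp add: gbinomial_pochhammer)
  have gbinc: "(of_real (\<alpha> - 1) gchoose n :: complex) = of_real ((\<alpha> - 1) gchoose n)" for n
    by (simp add: gbinomial_prod_rev)
  have Rn: "R ^ n / R powr (real n + 1 - \<alpha>) = R powr (\<alpha> - 1)" for n
    using R by (simp add: powr_realpow[symmetric] powr_diff[symmetric])
  \<comment> \<open>The quotients \<open>Gamma (n + 1 - \<alpha>) / Gamma (1 - \<alpha>)\<close> are
    Pochhammer symbols. With sign and factorial they become the coefficients of the binomial series
    of \<open>(1 + w) powr (\<alpha> - 1)\<close>.\<close>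
  have hasF: "has_bochner_integral lborel (F n) (of_real (c * ((\<alpha> - 1) gchoose n)) * w ^ n)" for n
  proof (cases "n = 0")
    case True
    have "has_bochner_integral lborel (F n) (of_real c)"
      unfolding F_def c_def if_P[OF True]
      by (rule has_bochner_integral_of_real, rule has_integral_one_minus_exp) (use \<alpha> R in auto)
    then show ?thesis using True by simp
  next
    case False
    then have n1: "real n \<ge> 1" by simp
    have "has_bochner_integral lborel (F n) (- ((- of_real R * w) ^ n / fact n * of_real (?G n)))"
      unfolding F_def if_not_P[OF False]
      by (intro has_bochner_integral_minus has_bochner_integral_mult_right has_bochner_integral_of_real
          has_integral_Gamma_scaled) (use \<alpha> R n1 in auto)
    also have "- ((- of_real R * w) ^ n / fact n * of_real (?G n))
       = of_real (- (Gamma (1 - \<alpha>) * ((-1) ^ n * pochhammer (1 - \<alpha>) n / fact n) * (R ^ n / R powr (real n + 1 - \<alpha>)))) * w ^ n"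
      unfolding Gn by (simp add: power_mult_distrib power_minus[of "of_real R * w"])
    also have "\<dots> = of_real (c * ((\<alpha> - 1) gchoose n)) * w ^ n"
      unfolding gbin[symmetric] Rn c_def by simp
    finally show ?thesis .
  qed
  have normF: "has_bochner_integral lborel (\<lambda>t. norm (F n t)) (norm (of_real (c * ((\<alpha> - 1) gchoose n)) * w ^ n))" if "n \<noteq> 0" for n
  proof -
    have n1: "real n \<ge> 1" using that by simp
    have "has_bochner_integral lborel (\<lambda>t. (R * norm w) ^ n / fact n * (indicator {0<..} t * (t powr (real n + 1 - \<alpha> - 1) * exp (- R * t))))
        ((R * norm w) ^ n / fact n * ?G n)"
      by (intro has_bochner_integral_mult_right has_integral_Gamma_scaled) (use \<alpha> R n1 in auto)
    moreover have "(\<lambda>t. (R * norm w) ^ n / fact n * (indicator {0<..} t * (t powr (real n + 1 - \<alpha> - 1) * exp (- R * t)))) = (\<lambda>t. norm (F n t))"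
      using that R by (auto simp: F_def norm_mult norm_power norm_divide fun_eq_iff split: split_indicator)
    moreover have "(R * norm w) ^ n / fact n * ?G n = norm (of_real (c * ((\<alpha> - 1) gchoose n)) * w ^ n :: complex)"
    proof -
      have "Gamma (real n + 1 - \<alpha>) > 0" using n1 \<alpha> by (simp add: Gamma_real_pos)
      then have "Gamma (real n + 1 - \<alpha>) = \<bar>Gamma (1 - \<alpha>) * pochhammer (1 - \<alpha>) n\<bar>" unfolding Gn by simp
      then have "(R * norm w) ^ n / fact n * ?G n 
          = \<bar>Gamma (1 - \<alpha>) * pochhammer (1 - \<alpha>) n\<bar> / fact n * (R ^ n / R powr (real n + 1 - \<alpha>)) * norm w ^ n"
        by (simp add: power_mult_distrib)
      also have "\<dots> = norm (of_real (c * ((\<alpha> - 1) gchoose n)) * w ^ n :: complex)"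
        unfolding Rn gbin c_def by (simp add: norm_mult norm_power norm_divide abs_mult)
      finally show ?thesis .
    qed
    ultimately show ?thesis by simp
  qed
  have summ: "summable (\<lambda>n. norm (of_real (c * ((\<alpha> - 1) gchoose n)) * w ^ n))"
  proof -
    have "summable (\<lambda>n. norm ((of_real (\<alpha> - 1) gchoose n) * w ^ n))"
    proof (rule abs_summable_in_conv_radius)
      show "ereal (norm w) < conv_radius (\<lambda>n. (of_real (\<alpha> - 1) gchoose n) :: complex)"
        using w by (auto simp: conv_radius_gchoose)
    qed
    then have "summable (\<lambda>n. \<bar>c\<bar> * norm ((of_real (\<alpha> - 1) gchoose n) * w ^ n))" by (rule summable_mult)
    then show ?thesis unfolding gbinc by (simp add: norm_mult abs_mult mult.assoc)
  qed
  have Fsums: "(\<lambda>n. F n t) sums ?H t"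
    and Fabs: "summable (\<lambda>n. norm (F n t))" for t
  proof -
    define G where "G = (\<lambda>n. if n = 0 then F 0 t + ?E t else F n t)"
    define z where "z = - of_real R * w * of_real t"
    have Geq: "G n = (if n = 0 then of_real (indicator {0<..} t * t powr - \<alpha>) + ?E t else 0)
        - ?E t * (z ^ n /\<^sub>R fact n)" for n
    proof -
      have zn: "z ^ n = (- of_real R * w) ^ n * of_real t ^ n"
        unfolding z_def by (rule power_mult_distrib)
      show ?thesis
        by (auto simp: G_def F_def zn scaleR_conv_of_real powr_diff powr_add powr_realpow powr_minus field_simps split: split_indicator)
    qed
    have "G sums ((of_real (indicator {0<..} t * t powr - \<alpha>) + ?E t)
        - ?E t * exp z)"
      unfolding Geq by (intro sums_diff sums_mult exp_converges sums_single)
    moreover have "(\<lambda>n. if n = 0 then ?E t else 0) sums (?E t :: complex)"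
      by (rule sums_single)
    ultimately have "(\<lambda>n. G n - (if n = 0 then ?E t else 0)) sums
       (of_real (indicator {0<..} t * t powr - \<alpha>) - ?E t * exp z)"
      by (drule_tac sums_diff) auto
    moreover have "(\<lambda>n. G n - (if n = 0 then ?E t else 0)) = (\<lambda>n. F n t)"
      by (auto simp: G_def)
    moreover have "(of_real (indicator {0<..} t * t powr - \<alpha>) - ?E t * exp z)
       = ?H t"
      by (auto simp: z_def scaleR_conv_of_real exp_of_real[symmetric] exp_add[symmetric] algebra_simps split: split_indicator)
    ultimately show "(\<lambda>n. F n t) sums ?H t"
      by simp
    have "summable (\<lambda>n. norm (?E t * (z ^ n /\<^sub>R fact n)))"
      unfolding norm_mult by (intro summable_mult summable_norm_exp)
    moreover have "\<forall>\<^sub>F n in sequentially. norm (?E t * (z ^ n /\<^sub>R fact n)) = norm (F n t)"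
      using eventually_gt_at_top[of 0]
    proof eventually_elim
      case (elim n)
      then have "F n t = - (?E t * (z ^ n /\<^sub>R fact n))"
        using Geq[of n] by (simp add: G_def)
      then show ?case by (simp only: norm_minus_cancel)
    qed
    ultimately show "summable (\<lambda>n. norm (F n t))" by (subst (asm) summable_cong)
  qed
  have "(\<lambda>n. integral\<^sup>L lborel (F n)) sums (LBINT t. (\<Sum>n. F n t))"
  proof (rule sums_integral)
    show "integrable lborel (F n)" for n using hasF by (auto simp: has_bochner_integral_iff)
    show "AE t in lborel. summable (\<lambda>n. norm (F n t))" using Fabs by simp
    have "\<forall>\<^sub>F n in sequentially. (LBINT t. norm (F n t)) = norm (of_real (c * ((\<alpha> - 1) gchoose n)) * w ^ n)"
      using eventually_gt_at_top[of 0] by eventually_elim (use normF in \<open>auto simp: has_bochner_integral_iff\<close>)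
    then show "summable (\<lambda>n. \<integral>t. norm (F n t) \<partial>lborel)" using summ by (subst summable_cong)
  qed
  also have "(\<lambda>n. integral\<^sup>L lborel (F n)) = (\<lambda>n. of_real c * ((of_real (\<alpha> - 1) gchoose n) * w ^ n))"
    unfolding gbinc using hasF by (simp add: has_bochner_integral_iff fun_eq_iff mult.assoc del: of_real_diff)
  finally have "(\<lambda>n. of_real c * ((of_real (\<alpha> - 1) gchoose n) * w ^ n)) sums (LBINT t. (\<Sum>n. F n t))" .
  moreover have "(\<lambda>n. of_real c * ((of_real (\<alpha> - 1) gchoose n) * w ^ n)) sums (of_real c * (1 + w) powr of_real (\<alpha> - 1))"
    by (intro sums_mult gen_binomial_complex w)
  ultimately have "(LBINT t. (\<Sum>n. F n t)) = of_real c * (1 + w) powr of_real (\<alpha> - 1)"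
    by (rule sums_unique2)
  also have "(\<lambda>t. (\<Sum>n. F n t)) = (\<lambda>t. ?H t)"
    using Fsums by (auto simp: sums_iff fun_eq_iff)
  finally have "(LBINT t. ?H t)
     = of_real c * (1 + w) powr of_real (\<alpha> - 1)" .
  also have "\<dots> = - of_real (Gamma (1 - \<alpha>)) * (of_real R * (1 + w)) powr of_real (\<alpha> - 1)"
  proof -
    have "1 + w \<noteq> 0" using w by (metis add_eq_0_iff norm_minus_cancel norm_one order_less_irrefl)
    then have "(of_real R * (1 + w)) powr of_real (\<alpha> - 1) = of_real (R powr (\<alpha> - 1)) * (1 + w) powr of_real (\<alpha> - 1)"
    proof -
      have nz: "complex_of_real R * (1 + w) \<noteq> 0" using \<open>1 + w \<noteq> 0\<close> R by simp
      have "Ln (complex_of_real R * (1 + w)) = of_real (ln R) + Ln (1 + w)"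
        using \<open>1 + w \<noteq> 0\<close> R by (simp add: Ln_times_of_real Ln_of_real del: distrib_left distrib_left_numeral)
      then show ?thesis
        unfolding powr_def using nz \<open>1 + w \<noteq> 0\<close> R
        by (simp only: if_False distrib_left exp_add) (simp add: exp_of_real[symmetric])
    qed
    then show ?thesis by (simp add: c_def)
  qed
  finally show ?thesis .
qed

section \<open>Dominating functions and the limit on the imaginary axis\<close>

lemma norm_one_minus_exp_le:
  fixes z :: complex
  assumes "Re z \<ge> 0"
  shows "norm (1 - exp (- z)) \<le> norm z" "norm (1 - exp (- z)) \<le> 2"
proof -
  \<comment> \<open>Mean value inequality on the closed right half plane, which is convex and on
    which the derivative has norm at most 1.\<close>
  have "norm ((\<lambda>z. exp (- z)) 0 - (\<lambda>z. exp (- z)) z) \<le> 1 * norm (0 - z)"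
  proof (rule field_differentiable_bound[of "{z. Re z \<ge> 0}"])
    show "convex {z. Re z \<ge> 0}" by (rule convex_halfspace_Re_ge)
    show "((\<lambda>z. exp (- z)) has_field_derivative - exp (- z)) (at z within {z. Re z \<ge> 0})" for z :: complex
      by (auto intro!: derivative_eq_intros)
  qed (use assms in auto)
  then show "norm (1 - exp (- z)) \<le> norm z" by simp
  have "norm (1 - exp (- z)) \<le> norm (1::complex) + norm (exp (- z))" by (rule norm_triangle_ineq4)
  also have "\<dots> \<le> 2" using assms by simp
  finally show "norm (1 - exp (- z)) \<le> 2" .
qed

text \<open>Combines the Lipschitz bound for small \<open>t\<close> with boundedness for large
  \<open>t\<close>. All the dominating functions below for integrands with \<open>1 - exp\<close> in
  the numerator have this shape.\<close>

lemma norm_one_minus_exp_le_min: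
  fixes z :: complex and t C :: real
  assumes "Re z \<ge> 0" "norm z \<le> C * \<bar>t\<bar>" "C \<ge> 0"
  shows "norm (1 - exp (- z)) \<le> (2 + C) * min 1 \<bar>t\<bar>"
proof (cases "\<bar>t\<bar> \<le> 1")
  case True
  have "norm (1 - exp (- z)) \<le> C * \<bar>t\<bar>" using norm_one_minus_exp_le(1)[OF assms(1)] assms(2) by simp
  also have "\<dots> \<le> (2 + C) * \<bar>t\<bar>" by (simp add: mult_right_mono)
  finally show ?thesis using True by simp
next
  case False
  then show ?thesis using norm_one_minus_exp_le(2)[OF assms(1)] assms(3) by simp
qed

text \<open>The Gamma integrals live on the half line; this folds an integral over the whole line
  onto it.\<close>

lemma integrable_even_extension:
  fixes f :: "real \<Rightarrow> 'a::{banach, second_countable_topology}"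
  assumes f: "integrable lborel (\<lambda>t. indicator {0<..} t *\<^sub>R f t)" and g: "integrable lborel (\<lambda>t. indicator {0<..} t *\<^sub>R f (- t))"
    and [measurable]: "f \<in> borel_measurable borel"
  shows "integrable lborel f"
    and "integral\<^sup>L lborel f = (LBINT t. indicator {0<..} t *\<^sub>R (f t + f (- t)))"
proof -
  have g': "integrable lborel (\<lambda>t. indicator {..<0} t *\<^sub>R f t)"
    using lborel_integrable_real_affine[OF g, of "-1" 0] by (simp add: indicator_def cong: if_cong)
  have "integrable lborel (\<lambda>t. indicator {0<..} t *\<^sub>R f t + indicator {..<0} t *\<^sub>R f t)"
    by (intro Bochner_Integration.integrable_add f g')
  moreover have ae: "AE t in lborel. indicator {0<..} t *\<^sub>R f t + indicator {..<0} t *\<^sub>R f t = f t"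
    using AE_lborel_singleton[of 0] by eventually_elim (auto split: split_indicator)
  ultimately show "integrable lborel f" by (subst (asm) integrable_cong_AE[where g=f]) auto
  have "integral\<^sup>L lborel f = (LBINT t. indicator {0<..} t *\<^sub>R f t + indicator {..<0} t *\<^sub>R f t)"
    using ae by (intro integral_cong_AE) auto
  also have "\<dots> = (LBINT t. indicator {0<..} t *\<^sub>R f t) + (LBINT t. indicator {..<0} t *\<^sub>R f t)"
    by (intro Bochner_Integration.integral_add f g')
  also have "(LBINT t. indicator {..<0} t *\<^sub>R f t) = (LBINT t. indicator {0<..} t *\<^sub>R f (- t))"
    using lborel_integral_real_affine[of "-1" "\<lambda>t. indicator {..<0} t *\<^sub>R f t" 0]
    by (simp add: indicator_def cong: if_cong)
  also have "(LBINT t. indicator {0<..} t *\<^sub>R f t) + (LBINT t. indicator {0<..} t *\<^sub>R f (- t))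
     = (LBINT t. indicator {0<..} t *\<^sub>R (f t + f (- t)))"
    using f g by (simp add: scaleR_add_right)
  finally show "integral\<^sup>L lborel f = (LBINT t. indicator {0<..} t *\<^sub>R (f t + f (- t)))" .
qed

text \<open>\<open>min 1 t\<close> is at most a constant times \<open>1 - exp (- t)\<close>, so this
  reduces to the Gamma integral with R = 1. At zero the function is integrable because \<alpha> < 2,
  at infinity because \<alpha> > 1.\<close>

lemma integrable_min_powr:
  fixes \<alpha> :: real
  assumes \<alpha>: "1 < \<alpha>" "\<alpha> < 2"
  shows "integrable lborel (\<lambda>t. min 1 \<bar>t\<bar> * \<bar>t\<bar> powr - \<alpha>)"
proof -
  have "integrable lborel (\<lambda>t. indicator {0<..} t * ((1 - exp (- 1 * t)) * t powr - \<alpha>))"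
    using has_integral_one_minus_exp[OF \<alpha>, of 1] by (auto simp: has_bochner_integral_iff)
  then have "integrable lborel (\<lambda>t. 2 * (indicator {0<..} t * ((1 - exp (- 1 * t)) * t powr - \<alpha>)))"
    by (rule integrable_mult_right)
  then have *: "integrable lborel (\<lambda>t. indicator {0<..} t *\<^sub>R (min 1 \<bar>t\<bar> * \<bar>t\<bar> powr - \<alpha>))"
  proof (rule Bochner_Integration.integrable_bound)
    \<comment> \<open>Since \<open>exp (- t)\<close> is at most \<open>1 / (1 + t)\<close>, the
      difference \<open>1 - exp (- t)\<close> is at least \<open>t / (1 + t)\<close>. The factor 2
      comes from \<open>min 1 t * (1 + t) \<le> 2 * t\<close>.\<close>
    have "min 1 t \<le> 2 * (1 - exp (- t))" if "t > 0" for t :: real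
    proof -
      have e: "exp (- t) \<le> 1 / (1 + t)"
        using exp_ge_add_one_self[of t] that by (simp add: exp_minus field_simps)
      have "min 1 t * (1 + t) \<le> 2 * t" using that by (auto simp: min_def algebra_simps mult_le_one)
      then have "min 1 t \<le> 2 * (1 - 1 / (1 + t))" using that by (simp add: field_simps)
      with e show ?thesis by simp
    qed
    then show "AE t in lborel. norm (indicator {0<..} t *\<^sub>R (min 1 \<bar>t\<bar> * \<bar>t\<bar> powr - \<alpha>))
       \<le> norm (2 * (indicator {0<..} t * ((1 - exp (- 1 * t)) * t powr - \<alpha>)))"
      by (auto intro!: AE_I2 mult_right_mono simp: abs_mult mult.assoc[symmetric] split: split_indicator)
  qed auto
  then show ?thesis by (rule integrable_even_extension(1)) (auto simp: *[unfolded real_scaleR_def])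
qed

text \<open>The imaginary unit lies on the boundary of the half plane where the formula is known. It
  is approached by \<open>s n = e n + \<i>\<close>; both sides converge, the integrals by domination
  and the power because \<i> is off the branch cut.\<close>

lemma integral_one_minus_iexp:
  fixes \<alpha> :: real
  assumes \<alpha>: "1 < \<alpha>" "\<alpha> < 2"
  shows "has_bochner_integral lborel (\<lambda>t. indicator {0<..} t *\<^sub>R ((1 - exp (- (\<i> * of_real t))) * of_real (t powr - \<alpha>)))
    (- of_real (Gamma (1 - \<alpha>)) * exp (\<i> * of_real (pi * (\<alpha> - 1) / 2)))"
proof -
  define e :: "nat \<Rightarrow> real" where "e n = inverse (real (Suc n))" for n
  define s where "s n = of_real (e n) + \<i>" for n
  have e: "e n > 0" "e n \<le> 1" for n by (auto simp: e_def field_simps)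
  have elim: "e \<longlonglongrightarrow> 0" unfolding e_def by (rule LIMSEQ_inverse_real_of_nat)
  have slim: "s \<longlonglongrightarrow> \<i>" unfolding s_def using tendsto_add[OF tendsto_of_real[OF elim] tendsto_const[of \<i>]] by simp
  define f where "f z t = indicator {0<..} t *\<^sub>R ((1 - exp (- (z * of_real t))) * of_real (t powr - \<alpha>))" for z :: complex and t :: real
  have fs: "integral\<^sup>L lborel (f (s n)) = - of_real (Gamma (1 - \<alpha>)) * s n powr of_real (\<alpha> - 1)" for n
  proof -
    \<comment> \<open>A centre whose disc contains \<open>s n\<close>: the condition
      \<open>norm (s n - R) < R\<close> means \<open>2 * R * e n > 1 + (e n)^2\<close>. The choice
      is the squared norm of \<open>s n\<close> over its real part.\<close>
    define R where "R = (1 + (e n)\<^sup>2) / e n"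
    have R: "R > 0" using e[of n] by (auto simp: R_def intro!: divide_pos_pos add_pos_nonneg)
    define w where "w = (s n - of_real R) / of_real R"
    have "(norm (s n - of_real R))\<^sup>2 = (e n - R)\<^sup>2 + 1" by (simp add: cmod_def s_def)
    also have "\<dots> = R\<^sup>2 + ((e n)\<^sup>2 + 1 - 2 * (R * e n))" by (simp add: power2_eq_square algebra_simps)
    also have "R * e n = 1 + (e n)\<^sup>2" using e[of n] by (simp add: R_def)
    also have "R\<^sup>2 + ((e n)\<^sup>2 + 1 - 2 * (1 + (e n)\<^sup>2)) < R\<^sup>2" by (smt (verit) zero_le_power2)
    finally have "norm (s n - of_real R) < R" using R by (simp add: power_less_imp_less_base)
    then have w: "norm w < 1" using R by (simp add: w_def norm_divide)
    have "s n = of_real R * (1 + w)" using R by (simp add: w_def field_simps)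
    then show ?thesis unfolding f_def using integral_one_minus_exp_near_real[OF \<alpha> R w] by simp
  qed
  have bound: "norm (f z t) \<le> 4 * (min 1 \<bar>t\<bar> * \<bar>t\<bar> powr - \<alpha>)" if z: "Re z \<ge> 0" "norm z \<le> 2" for z t
  proof (cases "t > 0")
    case True
    have "norm (1 - exp (- (z * of_real t))) \<le> (2 + 2) * min 1 \<bar>t\<bar>"
      by (intro norm_one_minus_exp_le_min) (use z True in \<open>auto simp: norm_mult\<close>)
    then show ?thesis using True by (simp add: f_def norm_mult mult_right_mono mult.assoc[symmetric])
  qed (auto simp: f_def)
  have m: "integrable lborel (\<lambda>t. 4 * (min 1 \<bar>t\<bar> * \<bar>t\<bar> powr - \<alpha>))"
    by (intro integrable_mult_right integrable_min_powr \<alpha>)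
  have meas[measurable]: "f z \<in> borel_measurable lborel" for z unfolding f_def by measurable
  have norms: "norm (s n) \<le> 2" for n
  proof -
    have "norm (s n) \<le> norm (of_real (e n) :: complex) + norm \<i>" unfolding s_def by (rule norm_triangle_ineq)
    then show ?thesis using e[of n] by simp
  qed
  have lim: "(\<lambda>n. integral\<^sup>L lborel (f (s n))) \<longlonglongrightarrow> integral\<^sup>L lborel (f \<i>)"
  proof (rule integral_dominated_convergence[OF _ _ m])
    show "AE t in lborel. (\<lambda>n. f (s n) t) \<longlonglongrightarrow> f \<i> t"
      unfolding f_def by (intro AE_I2 tendsto_intros slim)
    show "AE t in lborel. norm (f (s n) t) \<le> 4 * (min 1 \<bar>t\<bar> * \<bar>t\<bar> powr - \<alpha>)" for n
      using bound[of "s n"] norms[of n] e[of n] by (auto simp: s_def)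
  qed auto
  have "(\<lambda>n. - of_real (Gamma (1 - \<alpha>)) * s n powr of_real (\<alpha> - 1)) \<longlonglongrightarrow> - of_real (Gamma (1 - \<alpha>)) * \<i> powr of_real (\<alpha> - 1)"
    by (intro tendsto_intros slim) auto
  then have "integral\<^sup>L lborel (f \<i>) = - of_real (Gamma (1 - \<alpha>)) * \<i> powr of_real (\<alpha> - 1)"
    using lim unfolding fs by (rule LIMSEQ_unique[rotated])
  also have "\<i> powr of_real (\<alpha> - 1) = exp (\<i> * of_real (pi * (\<alpha> - 1) / 2))"
    by (simp add: powr_def Ln_ii algebra_simps)
  finally have "integral\<^sup>L lborel (f \<i>) = - of_real (Gamma (1 - \<alpha>)) * exp (\<i> * of_real (pi * (\<alpha> - 1) / 2))" .
  moreover have "integrable lborel (f \<i>)"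
    by (rule Bochner_Integration.integrable_bound[OF m]) (use bound[of \<i>] in \<open>auto intro!: AE_I2 order_trans[OF _ abs_ge_self]\<close>)
  ultimately show ?thesis unfolding has_bochner_integral_iff f_def by simp
qed

section \<open>Fourier inversion\<close>

text \<open>Transfers the sign of a measure to its density. Neither a Fourier integral nor the final
  combination of powers and sines shows its sign.\<close>

lemma continuous_nonneg_if_integrals_nonneg:
  fixes u :: "real \<Rightarrow> real"
  assumes cont: "continuous_on UNIV u"
    and nn: "\<And>a b. a < b \<Longrightarrow> 0 \<le> (LBINT y:{a..b}. u y)"
  shows "0 \<le> u y"
proof (rule ccontr)
  assume "\<not> 0 \<le> u y"
  then have neg: "u y < 0" by simp
  have "isCont u y" using cont by (simp add: continuous_on_eq_continuous_at)
  then have "\<forall>\<^sub>F z in at y. u z < u y / 2"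
    using neg by (intro order_tendstoD(2)[of u "u y"]) (auto simp: isCont_def)
  then obtain d where d: "d > 0" "\<And>z. z \<noteq> y \<Longrightarrow> dist z y < d \<Longrightarrow> u z < u y / 2"
    unfolding eventually_at by auto
  define b where "b = y + d / 2"
  have b: "y < b" using d by (simp add: b_def)
  have le: "u z \<le> u y / 2" if "z \<in> {y..b}" for z
    using d(2)[of z] that d(1) neg by (cases "z = y") (auto simp: b_def dist_real_def less_imp_le)
  have int: "set_integrable lborel {y..b} u"
    using cont by (intro borel_integrable_atLeastAtMost') (auto intro: continuous_on_subset)
  have "(LBINT z:{y..b}. u z) \<le> (LBINT z:{y..b}. u y / 2)"
    by (intro set_integral_mono int borel_integrable_atLeastAtMost' continuous_intros) (use le in auto)
  also have "\<dots> = u y / 2 * (b - y)" using b by (simp add: set_lebesgue_integral_def)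
  also have "\<dots> < 0" using b neg by (simp add: mult_neg_pos)
  finally show False using nn[OF b] by simp
qed

lemma borel_measure_eqI_open_intervals:
  fixes M N :: "real measure"
  assumes sets: "sets M = sets borel" "sets N = sets borel"
    and eq: "\<And>a b. a < b \<Longrightarrow> emeasure M {a<..<b} = emeasure N {a<..<b}"
    and fin: "\<And>a b. a < b \<Longrightarrow> emeasure M {a<..<b} \<noteq> \<infinity>"
  shows "M = N"
proof (rule measure_eqI_generator_eq)
  let ?E = "range (\<lambda>(a, b). {a<..<b::real})"
  show "Int_stable ?E"
  proof (rule Int_stableI)
    fix A B assume "A \<in> ?E" "B \<in> ?E"
    then obtain a b c d where "A = {a<..<b}" "B = {c<..<d}" by auto
    then have "A \<inter> B = (\<lambda>(a, b). {a<..<b}) (max a c, min b d)" by auto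
    then show "A \<inter> B \<in> ?E" by blast
  qed
  show "?E \<subseteq> Pow UNIV" by simp
  have "emeasure M {a<..<b} = emeasure N {a<..<b}" for a b
    using eq[of a b] by (cases "a < b") auto
  then show "emeasure M X = emeasure N X" if "X \<in> ?E" for X using that by auto
  show "sets M = sigma_sets UNIV ?E" "sets N = sigma_sets UNIV ?E"
    by (simp_all add: sets borel_eq_box[where 'a=real] box_real)
  show "range (\<lambda>n::nat. {- (1 + real n)<..<1 + real n}) \<subseteq> ?E" by auto
  show "(\<Union>n::nat. {- (1 + real n)<..<1 + real n}) = UNIV"
  proof (intro set_eqI iffI UNIV_I)
    fix x :: real
    obtain n where "\<bar>x\<bar> < real n" using reals_Archimedean2 by blast
    then show "x \<in> (\<Union>n::nat. {- (1 + real n)<..<1 + real n})" by (intro UN_I[of n]) auto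
  qed
  show "emeasure M {- (1 + real n)<..<1 + real n} \<noteq> \<infinity>" for n by (rule fin) simp
qed

lemma lborel_integrable_indicator_Icc: "integrable lborel (indicator {a..b} :: real \<Rightarrow> real)"
  by (rule integrable_real_indicator) (auto simp: emeasure_lborel_Icc_eq)

lemma abs_Re_iexp_mult_le: "\<bar>Re (iexp x * w)\<bar> \<le> norm w"
proof -
  have "\<bar>Re (iexp x * w)\<bar> \<le> norm (iexp x * w)" by (rule abs_Re_le_cmod)
  also have "\<dots> = norm w" by (simp only: norm_mult norm_exp_i_times mult_1_left)
  finally show ?thesis .
qed

text \<open>Taking the real part makes the density real by construction. For a characteristic
  function the imaginary part of the integrand is odd and integrates to zero.\<close>

definition fourier_inv :: "(real \<Rightarrow> complex) \<Rightarrow> real \<Rightarrow> real" where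
  "fourier_inv \<phi> z = (LBINT t. Re (iexp (- (t * z)) * \<phi> t)) / (2 * pi)"

context
  fixes \<phi> :: "real \<Rightarrow> complex"
  assumes int: "integrable lborel \<phi>"
begin

lemma fourier_integrand_integrable: "integrable lborel (\<lambda>t. iexp (- (t * z)) * \<phi> t)"
  by (rule Bochner_Integration.integrable_bound[OF int])
     (use borel_measurable_integrable[OF int] in \<open>auto simp: norm_mult\<close>)

lemma fourier_integrand_Re_integrable: "integrable lborel (\<lambda>t. Re (iexp (- (t * z)) * \<phi> t))"
  using fourier_integrand_integrable by (rule integrable_Re)

lemma continuous_fourier_inv: "continuous_on UNIV (fourier_inv \<phi>)"
  unfolding continuous_on_eq_continuous_at[OF open_UNIV] continuous_at_sequentially
proof (intro ballI allI impI)
  fix z and s :: "nat \<Rightarrow> real" assume s: "s \<longlonglongrightarrow> z"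
  have [measurable]: "\<phi> \<in> borel_measurable borel" using borel_measurable_integrable[OF int] by simp
  have "(\<lambda>n. \<integral>t. Re (iexp (- (t * s n)) * \<phi> t) \<partial>lborel) \<longlonglongrightarrow> (LBINT t. Re (iexp (- (t * z)) * \<phi> t))"
  proof (rule integral_dominated_convergence[where w="\<lambda>t. norm (\<phi> t)"])
    show "integrable lborel (\<lambda>t. norm (\<phi> t))" using int by simp
    show "AE t in lborel. (\<lambda>n. Re (iexp (- (t * s n)) * \<phi> t)) \<longlonglongrightarrow> Re (iexp (- (t * z)) * \<phi> t)"
      by (intro AE_I2 tendsto_intros s)
    show "AE t in lborel. norm (Re (iexp (- (t * s n)) * \<phi> t)) \<le> norm (\<phi> t)" for n
      unfolding real_norm_def by (intro AE_I2 abs_Re_iexp_mult_le)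
  qed auto
  then show "(fourier_inv \<phi> \<circ> s) \<longlonglongrightarrow> fourier_inv \<phi> z"
    unfolding fourier_inv_def comp_def by (intro tendsto_intros) auto
qed

lemma fourier_inv_measurable[measurable]: "fourier_inv \<phi> \<in> borel_measurable borel"
  by (rule borel_measurable_continuous_onI[OF continuous_fourier_inv])

lemma fourier_inv_bound: "\<bar>fourier_inv \<phi> z\<bar> \<le> (LBINT t. norm (\<phi> t))"
proof -
  have "\<bar>\<integral>t. Re (iexp (- (t * z)) * \<phi> t) \<partial>lborel\<bar> \<le> (LBINT t. norm (\<phi> t))"
  proof (rule order_trans[OF integral_abs_bound], rule integral_mono)
    show "\<bar>Re (iexp (- (t * z)) * \<phi> t)\<bar> \<le> norm (\<phi> t)" for t
      by (rule abs_Re_iexp_mult_le)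
  qed (use int fourier_integrand_Re_integrable in auto)
  also have "\<dots> \<le> (LBINT t. norm (\<phi> t)) * (2 * pi)"
    using mult_left_mono[of 1 "2 * pi" "LBINT t. norm (\<phi> t)"] pi_gt3 by simp
  finally show ?thesis unfolding fourier_inv_def by (simp add: abs_divide divide_le_eq)
qed

text \<open>Fubini moves the integral over [a, b] inside, onto the exponential. This produces the
  kernel of Levy's inversion formula.\<close>

lemma fourier_inv_interval:
  assumes "a \<le> b"
  shows "(LBINT z:{a..b}. fourier_inv \<phi> z)
    = Re ((LBINT t. (LBINT z. indicator {a..b} z *\<^sub>R iexp (- (t * z))) * \<phi> t)) / (2 * pi)"
proof -
  have [measurable]: "\<phi> \<in> borel_measurable borel" using borel_measurable_integrable[OF int] by simp
  have ii: "integrable (lborel \<Otimes>\<^sub>M lborel) (\<lambda>(z, t). indicator {a..b} z *\<^sub>R (iexp (- (t * z)) * \<phi> t))"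
  proof (rule lborel_pair.Fubini_integrable)
    show "(\<lambda>(z, t). indicator {a..b} z *\<^sub>R (iexp (- (t * z)) * \<phi> t)) \<in> borel_measurable (lborel \<Otimes>\<^sub>M lborel)"
      by measurable
    show "AE z in lborel. integrable lborel (\<lambda>t. (case (z, t) of (z, t) \<Rightarrow> indicator {a..b} z *\<^sub>R (iexp (- (t * z)) * \<phi> t)))"
      unfolding split_conv by (intro AE_I2 integrable_scaleR_right fourier_integrand_integrable)
    have "(\<lambda>z. \<integral>t. norm (case (z, t) of (z, t) \<Rightarrow> indicator {a..b} z *\<^sub>R (iexp (- (t * z)) * \<phi> t)) \<partial>lborel)
      = (\<lambda>z. indicator {a..b} z *\<^sub>R (LBINT t. norm (\<phi> t)))"
      by (simp add: norm_mult fun_eq_iff)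
    then show "integrable lborel (\<lambda>z. \<integral>t. norm (case (z, t) of (z, t) \<Rightarrow> indicator {a..b} z *\<^sub>R (iexp (- (t * z)) * \<phi> t)) \<partial>lborel)"
      by (simp only: integrable_scaleR_left lborel_integrable_indicator_Icc)
  qed
  have "(LBINT t. (LBINT z. indicator {a..b} z *\<^sub>R iexp (- (t * z))) * \<phi> t)
      = (LBINT t. (LBINT z. indicator {a..b} z *\<^sub>R (iexp (- (t * z)) * \<phi> t)))"
    by (simp only: integral_mult_left_zero[symmetric] mult_scaleR_left)
  also have "\<dots> = (LBINT z. (LBINT t. indicator {a..b} z *\<^sub>R (iexp (- (t * z)) * \<phi> t)))"
    by (rule lborel_pair.Fubini_integral[OF ii])
  finally have eq: "(LBINT t. (LBINT z. indicator {a..b} z *\<^sub>R iexp (- (t * z))) * \<phi> t)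
     = (LBINT z. (LBINT t. indicator {a..b} z *\<^sub>R (iexp (- (t * z)) * \<phi> t)))" .
  have "Re (LBINT z. (LBINT t. indicator {a..b} z *\<^sub>R (iexp (- (t * z)) * \<phi> t)))
     = (LBINT z. Re (LBINT t. indicator {a..b} z *\<^sub>R (iexp (- (t * z)) * \<phi> t)))"
    using lborel_pair.integrable_fst'[OF ii] by (intro integral_Re[symmetric]) simp
  also have "\<dots> = (LBINT z. indicator {a..b} z * (fourier_inv \<phi> z * (2 * pi)))"
    using integral_Re[OF fourier_integrand_integrable]
    by (intro Bochner_Integration.integral_cong) (simp_all add: fourier_inv_def del: times_complex.sel)
  also have "\<dots> = (LBINT z:{a..b}. fourier_inv \<phi> z) * (2 * pi)"
    unfolding set_lebesgue_integral_def integral_mult_left_zero[symmetric] real_scaleR_def mult.assoc by (rule refl)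
  finally show ?thesis unfolding eq by (simp add: field_simps)
qed

end

section \<open>Laws with integrable characteristic function\<close>

context real_distribution
begin

context
  assumes int: "integrable lborel (char M)"
begin

text \<open>Levy's formula is a limit of integrals truncated to (-n, n). Its kernel is bounded by b
  - a, so an integrable characteristic function dominates and the truncation can be removed; Fubini
  then recognizes the integral of \<open>fourier_inv\<close>.\<close>

lemma Levy_inversion_integrable:
  assumes "a \<le> b" "measure M {a} = 0" "measure M {b} = 0"
  shows "measure M {a<..b} = (LBINT z:{a..b}. fourier_inv (char M) z)"
proof -
  \<comment> \<open>As an integral, \<open>K\<close> has the value b - a at 0, where the quotient in
    Levy's formula is a division by zero. The two differ only at that point.\<close>
  define K where "K t = (LBINT z. indicator {a..b} z *\<^sub>R iexp (- (t * z)))" for t :: real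
  have K: "K t = (iexp (-(t * a)) - iexp (-(t * b))) / (\<i> * t)" if "t \<noteq> 0" for t :: real
  proof -
    have deriv: "((\<lambda>z. \<i> / t * iexp (- (t * z))) has_vector_derivative iexp (- (t * z))) (at z within S)" for z S
    proof -
      have "((\<lambda>z. \<i> / t * exp (\<i> * (- (t * z)))) has_field_derivative exp (\<i> * (- (t * of_real z)))) (at (of_real z))"
        using that by (auto intro!: derivative_eq_intros)
      from has_vector_derivative_real_field[OF this] show ?thesis by simp
    qed
    have "(CLBINT z=a..b. iexp (- (t * z))) = (\<i> / t * iexp (- (t * b))) - (\<i> / t * iexp (- (t * a)))"
      by (rule interval_integral_FTC_finite[OF _ deriv]) (auto intro!: continuous_intros)
    then have "K t = (\<i> / t * iexp (- (t * b))) - (\<i> / t * iexp (- (t * a)))"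
      using assms(1) by (simp add: interval_integral_Icc set_lebesgue_integral_def K_def)
    also have "\<dots> = (iexp (-(t * a)) - iexp (-(t * b))) / (\<i> * t)"
      using that by (simp add: field_simps)
    finally show ?thesis .
  qed
  have normK: "norm (K t) \<le> b - a" for t
  proof -
    have "norm (K t) \<le> (LBINT z. norm (indicator {a..b} z *\<^sub>R iexp (- (t * z))))"
      unfolding K_def by (rule integral_norm_bound)
    also have "\<dots> = b - a" using assms(1) by simp
    finally show ?thesis .
  qed
  have [measurable]: "K \<in> borel_measurable borel" unfolding K_def by measurable
  have int': "integrable lborel (\<lambda>t. (b - a) * norm (char M t))" using int by simp
  have "(\<lambda>n. \<integral>t. indicator {- real n<..<real n} t *\<^sub>R (K t * char M t) \<partial>lborel) \<longlonglongrightarrow> (LBINT t. K t * char M t)"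
  proof (rule integral_dominated_convergence[OF _ _ int'])
    show "AE t in lborel. (\<lambda>n. indicator {- real n<..<real n} t *\<^sub>R (K t * char M t)) \<longlonglongrightarrow> K t * char M t"
    proof (rule AE_I2)
      fix t :: real
      obtain N where N: "\<bar>t\<bar> < real N" using reals_Archimedean2 by blast
      have "\<forall>\<^sub>F n in sequentially. indicator {- real n<..<real n} t *\<^sub>R (K t * char M t) = K t * char M t"
        using eventually_ge_at_top[of N]
      proof eventually_elim
        case (elim n)
        then have "real N \<le> real n" by simp
        then have "t \<in> {- real n<..<real n}" using N by auto
        then show ?case by simp
      qed
      then show "(\<lambda>n. indicator {- real n<..<real n} t *\<^sub>R (K t * char M t)) \<longlonglongrightarrow> K t * char M t"
        by (rule tendsto_eventually)
    qed
    show "AE t in lborel. norm (indicator {- real n<..<real n} t *\<^sub>R (K t * char M t)) \<le> (b - a) * norm (char M t)" for n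
      using normK assms(1) by (auto simp: norm_mult mult_right_mono split: split_indicator)
  qed auto
  then have "(\<lambda>n. 1 / (2 * pi) * (LBINT t. indicator {- real n<..<real n} t *\<^sub>R (K t * char M t)))
     \<longlonglongrightarrow> 1 / (2 * pi) * (LBINT t. K t * char M t)"
    by (intro tendsto_intros)
  moreover have "(LBINT t. indicator {- real n<..<real n} t *\<^sub>R (K t * char M t))
     = (CLBINT t=-real n..real n. (iexp (-(t * a)) - iexp (-(t * b))) / (\<i> * t) * char M t)" for n
  proof -
    have "(CLBINT t=-real n..real n. (iexp (-(t * a)) - iexp (-(t * b))) / (\<i> * t) * char M t)
       = (LBINT t. indicator {- real n<..<real n} t *\<^sub>R ((iexp (-(t * a)) - iexp (-(t * b))) / (\<i> * t) * char M t))"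
      by (simp add: interval_lebesgue_integral_def set_lebesgue_integral_def)
    also have "\<dots> = (LBINT t. indicator {- real n<..<real n} t *\<^sub>R (K t * char M t))"
      using AE_lborel_singleton[of 0] by (intro integral_cong_AE) (auto simp: K)
    finally show ?thesis by simp
  qed
  ultimately have "complex_of_real (measure M {a<..b}) = 1 / (2 * pi) * (LBINT t. K t * char M t)"
    using Levy_Inversion[OF assms] by (intro LIMSEQ_unique) auto
  then have "measure M {a<..b} = Re (1 / (2 * pi) * (LBINT t. K t * char M t))"
    by (metis Re_complex_of_real)
  then show ?thesis
    unfolding fourier_inv_interval[OF int assms(1)] K_def by simp
qed

text \<open>The inversion formula is available only between points without mass. The atoms are
  countable, so such points exist on both sides within any distance e of \<open>a\<close>, and the
  bounded density gives the interval between them mass of order e.\<close>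

lemma no_atoms_if_integrable_char: "measure M {a} = 0"
proof -
  define B where "B = (LBINT t. norm (char M t))"
  have B: "B \<ge> 0" by (simp add: B_def)
  have "measure M {a} \<le> 2 * B * e" if "e > 0" for e
  proof -
    have "uncountable ({a - e<..<a} - {x. measure M {x} > 0})" "uncountable ({a<..<a + e} - {x. measure M {x} > 0})"
      by (rule uncountable_minus_countable[OF _ countable_atoms], use that in \<open>simp add: uncountable_open_interval\<close>)+
    then have "{a - e<..<a} - {x. measure M {x} > 0} \<noteq> {}" "{a<..<a + e} - {x. measure M {x} > 0} \<noteq> {}"
      by (metis countable_empty)+
    then obtain c d where c: "a - e < c" "c < a" "measure M {c} = 0" and d: "a < d" "d < a + e" "measure M {d} = 0"
      by (auto simp: zero_less_measure_iff)
    have "measure M {a} \<le> measure M {c<..d}" using c d by (intro finite_measure_mono) auto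
    also have "\<dots> = (LBINT z:{c..d}. fourier_inv (char M) z)" using c d by (intro Levy_inversion_integrable) auto
    also have "\<dots> \<le> (LBINT z:{c..d}. B)"
      using fourier_inv_bound[OF int] abs_le_D1 unfolding B_def
      by (intro set_integral_mono borel_integrable_atLeastAtMost' continuous_intros
           continuous_on_subset[OF continuous_fourier_inv[OF int]]) auto
    also have "\<dots> = B * (d - c)" using c d by (simp add: set_lebesgue_integral_def)
    also have "\<dots> \<le> B * (2 * e)" using c d B by (intro mult_left_mono) auto
    finally show ?thesis by simp
  qed
  note * = this
  have "measure M {a} \<le> 0"
  proof (rule field_le_epsilon)
    fix e :: real assume "e > 0"
    then have "measure M {a} \<le> 2 * B * (e / (2 * B + 1))" using B by (intro *) auto
    also have "\<dots> \<le> e" using B \<open>e > 0\<close> by (simp add: field_simps)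
    finally show "measure M {a} \<le> 0 + e" by simp
  qed
  then show ?thesis by (simp add: measure_le_0_iff)
qed

lemma fourier_inv_char_nonneg: "0 \<le> fourier_inv (char M) z"
proof (rule continuous_nonneg_if_integrals_nonneg[OF continuous_fourier_inv[OF int]])
  fix a b :: real assume "a < b"
  then show "0 \<le> (LBINT y:{a..b}. fourier_inv (char M) y)"
    using Levy_inversion_integrable[of a b] no_atoms_if_integrable_char by (metis less_imp_le measure_nonneg)
qed

lemma eq_density_fourier_inv: "M = density lborel (\<lambda>z. ennreal (fourier_inv (char M) z))"
proof (rule borel_measure_eqI_open_intervals)
  note [measurable] = fourier_inv_measurable[OF int]
  fix a b :: real assume ab: "a < b"
  have int_ab: "set_integrable lborel {a..b} (fourier_inv (char M))"
    by (intro borel_integrable_atLeastAtMost' continuous_on_subset[OF continuous_fourier_inv[OF int]]) auto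
  have "emeasure M {a<..<b} = emeasure M {a<..b}"
  proof -
    have "measure M {a<..b} = measure M ({a<..<b} \<union> {b})" using ab by (intro arg_cong[where f="measure M"]) auto
    also have "\<dots> = measure M {a<..<b}" using no_atoms_if_integrable_char by (subst finite_measure_Union) auto
    finally show ?thesis by (simp add: emeasure_eq_measure)
  qed
  also have "\<dots> = ennreal (LBINT z:{a..b}. fourier_inv (char M) z)"
    using Levy_inversion_integrable[of a b] no_atoms_if_integrable_char ab by (simp add: emeasure_eq_measure)
  also have "\<dots> = (\<integral>\<^sup>+z. ennreal (indicator {a..b} z *\<^sub>R fourier_inv (char M) z) \<partial>lborel)"
    unfolding set_lebesgue_integral_def
    using int_ab fourier_inv_char_nonneg by (intro nn_integral_eq_integral[symmetric]) (auto simp: set_integrable_def)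
  also have "\<dots> = emeasure (density lborel (\<lambda>z. ennreal (fourier_inv (char M) z))) {a<..<b}"
  proof (subst emeasure_density)
    show "(\<integral>\<^sup>+z. ennreal (indicator {a..b} z *\<^sub>R fourier_inv (char M) z) \<partial>lborel)
       = (\<integral>\<^sup>+z. ennreal (fourier_inv (char M) z) * indicator {a<..<b} z \<partial>lborel)"
      using AE_lborel_singleton[of a] AE_lborel_singleton[of b]
      by (intro nn_integral_cong_AE, eventually_elim) (auto split: split_indicator)
  qed auto
  finally show "emeasure M {a<..<b} = emeasure (density lborel (\<lambda>z. ennreal (fourier_inv (char M) z))) {a<..<b}" .
qed (auto simp: emeasure_eq_measure)

end

end

section \<open>Resolvent densities of the stable exponent\<close>

locale stable_parameters =
  fixes \<alpha> \<rho> :: real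
  assumes alpha: "1 < \<alpha>" "\<alpha> < 2"
    and rho: "\<alpha> * \<rho> < 1" "\<alpha> * (1 - \<rho>) < 1"
begin

abbreviation \<Psi> :: "real \<Rightarrow> complex" where "\<Psi> \<equiv> stable_exponent \<alpha> \<rho>"

definition angle :: real where "angle = pi * \<alpha> * (1/2 - \<rho>)"

text \<open>Coercivity: it makes the real part of \<open>\<Psi> \<theta>\<close> a positive multiple
  of \<open>\<bar>\<theta>\<bar> powr \<alpha>\<close>, on which the bounds for the resolvent rest.
  Together with \<alpha> > 1, the bound on \<open>\<alpha> * \<rho>\<close> keeps the angle above
  -pi/2 and the bound on \<open>\<alpha> * (1 - \<rho>)\<close> keeps it below pi/2.\<close>

lemma cos_angle_pos: "cos angle > 0"
proof (rule cos_gt_zero_pi)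
  have "- (1/2) < \<alpha> * (1/2 - \<rho>)" "\<alpha> * (1/2 - \<rho>) < 1/2"
    using alpha rho by (auto simp: algebra_simps)
  then have "pi * (- (1/2)) < pi * (\<alpha> * (1/2 - \<rho>))" "pi * (\<alpha> * (1/2 - \<rho>)) < pi * (1/2)"
    by (intro mult_strict_left_mono; simp)+
  then show "- (pi / 2) < angle" "angle < pi / 2" by (auto simp: angle_def mult.assoc)
qed

lemma exponent_pos: "\<theta> > 0 \<Longrightarrow> \<Psi> \<theta> = of_real (\<theta> powr \<alpha>) * exp (\<i> * of_real angle)"
  by (simp add: stable_exponent_def angle_def)

lemma exponent_neg: "\<theta> < 0 \<Longrightarrow> \<Psi> \<theta> = of_real ((- \<theta>) powr \<alpha>) * exp (- (\<i> * of_real angle))"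
  by (simp add: stable_exponent_def angle_def)

lemma exponent_0 [simp]: "\<Psi> 0 = 0"
  by (simp add: stable_exponent_def)

lemma exponent_measurable [measurable]: "\<Psi> \<in> borel_measurable borel"
  unfolding stable_exponent_def by measurable

lemma Re_exponent: "Re (\<Psi> \<theta>) = cos angle * \<bar>\<theta>\<bar> powr \<alpha>"
  by (cases \<theta> "0::real" rule: linorder_cases) (auto simp: exponent_pos exponent_neg Re_exp)

lemma norm_exponent: "norm (\<Psi> \<theta>) = \<bar>\<theta>\<bar> powr \<alpha>"
  by (cases \<theta> "0::real" rule: linorder_cases) (auto simp: exponent_pos exponent_neg norm_mult)

lemma exponent_minus: "\<Psi> (- \<theta>) = cnj (\<Psi> \<theta>)"
  by (cases \<theta> "0::real" rule: linorder_cases) (auto simp: exponent_pos exponent_neg exp_cnj)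

lemma norm_resolvent_ge:
  shows "q \<le> norm (of_real q + \<Psi> \<theta>)" 
    and "q \<ge> 0 \<Longrightarrow> cos angle * \<bar>\<theta>\<bar> powr \<alpha> \<le> norm (of_real q + \<Psi> \<theta>)"
proof -
  have "q + cos angle * \<bar>\<theta>\<bar> powr \<alpha> \<le> norm (of_real q + \<Psi> \<theta>)"
    using complex_Re_le_cmod[of "of_real q + \<Psi> \<theta>"] by (simp add: Re_exponent)
  moreover have "cos angle * \<bar>\<theta>\<bar> powr \<alpha> \<ge> 0" using cos_angle_pos by simp
  ultimately show "q \<le> norm (of_real q + \<Psi> \<theta>)" 
    "q \<ge> 0 \<Longrightarrow> cos angle * \<bar>\<theta>\<bar> powr \<alpha> \<le> norm (of_real q + \<Psi> \<theta>)" by linarith+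
qed

definition majorant :: "real \<Rightarrow> real" where "majorant \<theta> = min 1 \<bar>\<theta>\<bar> * \<bar>\<theta>\<bar> powr - \<alpha>"

lemma integrable_majorant: "integrable lborel majorant"
  unfolding majorant_def by (rule integrable_min_powr[OF alpha])

text \<open>For small \<theta> the denominator is at least \<open>q\<close>, and
  \<open>majorant\<close> is at least 1 there. For large \<theta> the real part of the exponent
  takes over, and \<alpha> > 1 gives integrability.\<close>

lemma integrable_resolvent:
  assumes q: "q > 0"
  shows "integrable lborel (\<lambda>\<theta>. 1 / (of_real q + \<Psi> \<theta>))"
proof (rule Bochner_Integration.integrable_bound)
  show "integrable lborel (\<lambda>\<theta>. (1 / q + 1 / cos angle) * majorant \<theta>)"
    by (intro integrable_mult_right integrable_majorant)
  show "AE \<theta> in lborel. norm (1 / (of_real q + \<Psi> \<theta>)) \<le> norm ((1 / q + 1 / cos angle) * majorant \<theta>)"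
    using AE_lborel_singleton[of 0]
  proof eventually_elim
    case (elim \<theta>)
    have "1 / norm (of_real q + \<Psi> \<theta>) \<le> (1 / q + 1 / cos angle) * majorant \<theta>"
    proof (cases "\<bar>\<theta>\<bar> \<le> 1")
      case True
      have "1 = \<bar>\<theta>\<bar> powr (\<alpha> - 1) * \<bar>\<theta>\<bar> powr (1 - \<alpha>)" using elim by (simp add: powr_add[symmetric])
      also have "\<dots> \<le> 1 * \<bar>\<theta>\<bar> powr (1 - \<alpha>)"
        using True alpha by (intro mult_right_mono powr_le1) auto
      also have "\<dots> = majorant \<theta>" using True elim by (simp add: majorant_def powr_diff powr_minus_divide)
      finally have m: "1 \<le> majorant \<theta>" .
      have "1 / norm (of_real q + \<Psi> \<theta>) \<le> 1 / q" using norm_resolvent_ge(1)[of q \<theta>] q by (simp add: frac_le)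
      also have "\<dots> \<le> 1 / q + 1 / cos angle" using cos_angle_pos by simp
      also have "\<dots> \<le> (1 / q + 1 / cos angle) * majorant \<theta>"
        using m q cos_angle_pos mult_left_mono[of 1 "majorant \<theta>" "1 / q + 1 / cos angle"] by simp
      finally show ?thesis .
    next
      case False
      have "1 / norm (of_real q + \<Psi> \<theta>) \<le> 1 / (cos angle * \<bar>\<theta>\<bar> powr \<alpha>)"
        using norm_resolvent_ge(2)[of q \<theta>] q cos_angle_pos elim by (intro frac_le) auto
      also have "\<dots> = 1 / cos angle * majorant \<theta>"
        using False by (simp add: majorant_def powr_minus_divide)
      also have "\<dots> \<le> (1 / q + 1 / cos angle) * majorant \<theta>"
        using q by (intro mult_right_mono) (auto simp: majorant_def)
      finally show ?thesis .
    qed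
    then show ?case by (auto simp: norm_divide intro: order_trans[OF _ abs_ge_self])
  qed
qed auto

section \<open>Resolvent densities and their differences\<close>

definition res_density :: "real \<Rightarrow> real \<Rightarrow> real" where
  "res_density q = fourier_inv (\<lambda>\<theta>. 1 / (of_real q + \<Psi> \<theta>))"

text \<open>The function h of the overview, written as a single integral so that it also makes sense
  at \<open>q = 0\<close>. There \<open>1 / \<Psi>\<close> is not integrable near zero, and only the
  difference survives.\<close>

definition res_gap :: "real \<Rightarrow> real \<Rightarrow> real" where
  "res_gap q z = (LBINT \<theta>. Re ((1 - iexp (- (\<theta> * z))) / (of_real q + \<Psi> \<theta>))) / (2 * pi)"

text \<open>The bound is uniform in \<open>q\<close>, which is what the limit at
  \<open>q = 0\<close> requires.\<close>

lemma res_gap_integrand_bound: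
  assumes "q \<ge> 0" "\<theta> \<noteq> 0"
  shows "norm ((1 - iexp (- (\<theta> * z))) / (of_real q + \<Psi> \<theta>)) \<le> (2 + \<bar>z\<bar>) / cos angle * majorant \<theta>"
proof -
  have "norm (1 - iexp (- (\<theta> * z))) \<le> (2 + \<bar>z\<bar>) * min 1 \<bar>\<theta>\<bar>"
    using norm_one_minus_exp_le_min[of "\<i> * of_real (\<theta> * z)" "\<bar>z\<bar>" \<theta>] by (simp add: norm_mult abs_mult mult.commute)
  then have "norm ((1 - iexp (- (\<theta> * z))) / (of_real q + \<Psi> \<theta>)) \<le> ((2 + \<bar>z\<bar>) * min 1 \<bar>\<theta>\<bar>) / (cos angle * \<bar>\<theta>\<bar> powr \<alpha>)"
    unfolding norm_divide using norm_resolvent_ge(2)[of q \<theta>] assms cos_angle_pos by (intro frac_le) auto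
  then show ?thesis by (simp add: majorant_def powr_minus_divide)
qed

lemma integrable_res_gap:
  assumes "q \<ge> 0"
  shows "integrable lborel (\<lambda>\<theta>. (1 - iexp (- (\<theta> * z))) / (of_real q + \<Psi> \<theta>))"
proof (rule Bochner_Integration.integrable_bound)
  show "integrable lborel (\<lambda>\<theta>. (2 + \<bar>z\<bar>) / cos angle * majorant \<theta>)"
    by (intro integrable_mult_right integrable_majorant)
  show "AE \<theta> in lborel. norm ((1 - iexp (- (\<theta> * z))) / (of_real q + \<Psi> \<theta>)) \<le> norm ((2 + \<bar>z\<bar>) / cos angle * majorant \<theta>)"
    using AE_lborel_singleton[of 0]
    by eventually_elim (rule order_trans[OF res_gap_integrand_bound[OF assms]], assumption, simp only: real_norm_def abs_ge_self)
qed auto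

lemma res_gap_bound:
  assumes "q \<ge> 0"
  shows "\<bar>res_gap q z\<bar> \<le> (2 + \<bar>z\<bar>) * ((LBINT \<theta>. majorant \<theta>) / (cos angle * (2 * pi)))"
proof -
  let ?F = "\<lambda>\<theta>. Re ((1 - iexp (- (\<theta> * z))) / (of_real q + \<Psi> \<theta>))"
  have "\<bar>\<integral>\<theta>. ?F \<theta> \<partial>lborel\<bar> \<le> (LBINT \<theta>. (2 + \<bar>z\<bar>) / cos angle * majorant \<theta>)"
  proof (rule order_trans[OF integral_abs_bound], rule integral_mono_AE)
    show "integrable lborel (\<lambda>\<theta>. \<bar>?F \<theta>\<bar>)"
      by (intro integrable_abs integrable_Re integrable_res_gap assms)
    show "integrable lborel (\<lambda>\<theta>. (2 + \<bar>z\<bar>) / cos angle * majorant \<theta>)"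
      by (intro integrable_mult_right integrable_majorant)
    show "AE \<theta> in lborel. \<bar>?F \<theta>\<bar> \<le> (2 + \<bar>z\<bar>) / cos angle * majorant \<theta>"
      using AE_lborel_singleton[of 0]
      by eventually_elim (rule order_trans[OF abs_Re_le_cmod res_gap_integrand_bound[OF assms]])
  qed
  also have "\<dots> = (2 + \<bar>z\<bar>) / cos angle * (LBINT \<theta>. majorant \<theta>)" by simp
  finally have "\<bar>\<integral>\<theta>. ?F \<theta> \<partial>lborel\<bar> / (2 * pi)
      \<le> (2 + \<bar>z\<bar>) / cos angle * (LBINT \<theta>. majorant \<theta>) / (2 * pi)"
    by (rule divide_right_mono) simp
  then show ?thesis unfolding res_gap_def by (simp add: abs_divide mult_ac)
qed

lemma res_gap_eq:
  assumes q: "q > 0"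
  shows "res_gap q z = res_density q 0 - res_density q z"
proof -
  have "(LBINT \<theta>. Re ((1 - iexp (- (\<theta> * z))) / (of_real q + \<Psi> \<theta>)))
    = (LBINT \<theta>. Re (iexp (- (\<theta> * 0)) * (1 / (of_real q + \<Psi> \<theta>))) - Re (iexp (- (\<theta> * z)) * (1 / (of_real q + \<Psi> \<theta>))))"
    by (intro Bochner_Integration.integral_cong) (simp_all add: diff_divide_distrib del: times_complex.sel)
  also have "\<dots> = (LBINT \<theta>. Re (iexp (- (\<theta> * 0)) * (1 / (of_real q + \<Psi> \<theta>)))) - (LBINT \<theta>. Re (iexp (- (\<theta> * z)) * (1 / (of_real q + \<Psi> \<theta>))))"
    by (intro Bochner_Integration.integral_diff fourier_integrand_Re_integrable integrable_resolvent q)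
  finally show ?thesis unfolding res_gap_def res_density_def fourier_inv_def by (simp add: diff_divide_distrib)
qed

lemma res_gap_tendsto:
  fixes q :: "nat \<Rightarrow> real"
  assumes q: "\<And>n. q n > 0" "q \<longlonglongrightarrow> 0"
  shows "(\<lambda>n. res_gap (q n) z) \<longlonglongrightarrow> res_gap 0 z"
proof -
  have "(\<lambda>n. \<integral>\<theta>. Re ((1 - iexp (- (\<theta> * z))) / (of_real (q n) + \<Psi> \<theta>)) \<partial>lborel)
     \<longlonglongrightarrow> (LBINT \<theta>. Re ((1 - iexp (- (\<theta> * z))) / (of_real 0 + \<Psi> \<theta>)))"
  proof (rule integral_dominated_convergence[where w="\<lambda>\<theta>. (2 + \<bar>z\<bar>) / cos angle * majorant \<theta>"])
    show "integrable lborel (\<lambda>\<theta>. (2 + \<bar>z\<bar>) / cos angle * majorant \<theta>)"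
      by (intro integrable_mult_right integrable_majorant)
    show "AE \<theta> in lborel. norm (Re ((1 - iexp (- (\<theta> * z))) / (of_real (q n) + \<Psi> \<theta>))) \<le> (2 + \<bar>z\<bar>) / cos angle * majorant \<theta>" for n
      using AE_lborel_singleton[of 0] unfolding real_norm_def
      by eventually_elim (rule order_trans[OF abs_Re_le_cmod res_gap_integrand_bound[OF less_imp_le[OF q(1)]]])
    show "AE \<theta> in lborel. (\<lambda>n. Re ((1 - iexp (- (\<theta> * z))) / (of_real (q n) + \<Psi> \<theta>)))
      \<longlonglongrightarrow> Re ((1 - iexp (- (\<theta> * z))) / (of_real 0 + \<Psi> \<theta>))"
      using AE_lborel_singleton[of 0]
    proof eventually_elim
      case (elim \<theta>)
      have "\<Psi> \<theta> \<noteq> 0" using elim norm_exponent[of \<theta>] by auto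
      then show ?case by (intro tendsto_intros q) auto
    qed
  qed auto
  then show ?thesis unfolding res_gap_def by (intro tendsto_intros) auto
qed

text \<open>A quantitative form of the divergence of \<open>res_density q 0\<close>, that is, of
  recurrence. For \<theta> in [0, \<open>q powr (1 / \<alpha>)\<close>] the exponent has norm at
  most q, so the denominator w satisfies \<open>q \<le> Re w\<close> and
  \<open>norm w \<le> 2 * q\<close>, and \<open>Re (1 / w)\<close> is at least
  \<open>1 / (4 * q)\<close>. Elsewhere the real part is nonnegative. The prefactor
  \<open>1 / (2 * pi)\<close> turns 4 into \<open>8 * pi\<close>.\<close>

lemma res_density_0_pos_bound:
  assumes q: "q > 0"
  shows "res_density q 0 > 0" "1 / res_density q 0 \<le> 8 * pi * q powr (1 - 1 / \<alpha>)"
proof -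
  have Re_ge: "Re (1 / (of_real q + \<Psi> \<theta>)) \<ge> indicator {0..q powr (1 / \<alpha>)} \<theta> * (1 / (4 * q))" for \<theta>
  proof -
    let ?w = "of_real q + \<Psi> \<theta>"
    have Re: "Re ?w \<ge> q" using cos_angle_pos by (simp add: Re_exponent)
    have eq: "Re (1 / ?w) = Re ?w / (norm ?w)\<^sup>2" by (simp add: Re_divide cmod_power2)
    show ?thesis
    proof (cases "\<theta> \<in> {0..q powr (1 / \<alpha>)}")
      case True
      have "norm ?w \<le> q + norm (\<Psi> \<theta>)" using norm_triangle_ineq[of "of_real q" "\<Psi> \<theta>"] q by simp
      also have "norm (\<Psi> \<theta>) \<le> (q powr (1 / \<alpha>)) powr \<alpha>"
        using True alpha by (auto simp: norm_exponent intro!: powr_mono2)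
      also have "\<dots> = q" using alpha q by (simp add: powr_powr)
      finally have "norm ?w \<le> 2 * q" by simp
      then have "(norm ?w)\<^sup>2 \<le> (2 * q)\<^sup>2" by (intro power_mono) auto
      moreover have "0 < (norm ?w)\<^sup>2" using Re q complex_Re_le_cmod[of ?w] by (intro zero_less_power) linarith
      ultimately have "q / (2 * q)\<^sup>2 \<le> Re ?w / (norm ?w)\<^sup>2" using Re q by (intro frac_le) auto
      then show ?thesis unfolding eq using True q by (simp add: power2_eq_square)
    next
      case False
      then show ?thesis unfolding eq using Re q by simp
    qed
  qed
  have "q powr (1 / \<alpha>) * (1 / (4 * q)) = (LBINT \<theta>. indicator {0..q powr (1 / \<alpha>)} \<theta> * (1 / (4 * q)))"
    by simp
  also have "\<dots> \<le> (LBINT \<theta>. Re (1 / (of_real q + \<Psi> \<theta>)))"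
    by (intro integral_mono Re_ge integrable_Re integrable_resolvent q integrable_mult_left lborel_integrable_indicator_Icc)
  also have "\<dots> = res_density q 0 * (2 * pi)" unfolding res_density_def fourier_inv_def by simp
  finally have "q powr (1 / \<alpha>) * (1 / (4 * q)) / (2 * pi) \<le> res_density q 0 * (2 * pi) / (2 * pi)"
    by (rule divide_right_mono) simp
  then have le: "q powr (1 / \<alpha>) / (8 * pi * q) \<le> res_density q 0" by (simp add: mult_ac)
  have pos: "0 < q powr (1 / \<alpha>) / (8 * pi * q)" using q by simp
  show "res_density q 0 > 0" using le pos by linarith
  have "1 / res_density q 0 \<le> 1 / (q powr (1 / \<alpha>) / (8 * pi * q))"
    using le pos by (intro frac_le) auto
  also have "\<dots> = 8 * pi * q powr (1 - 1 / \<alpha>)" using q by (simp add: powr_diff)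
  finally show "1 / res_density q 0 \<le> 8 * pi * q powr (1 - 1 / \<alpha>)" .
qed

text \<open>The integrand is even in \<theta>, so the integral is folded onto the half line and
  rescaled by \<open>1 / \<bar>z\<bar>\<close>, which leaves the Gamma integral on the imaginary
  axis. The phase of the exponent and that of the Gamma integral add up to a right angle away from
  \<open>pi * \<alpha> * \<rho>\<close> or \<open>pi * \<alpha> * (1 - \<rho>)\<close>; this turns
  the cosine into the sine in \<open>stable_s\<close>.\<close>

lemma res_gap_0:
  "res_gap 0 z = - (1 / pi) * Gamma (1 - \<alpha>) * (\<bar>z\<bar> powr (\<alpha> - 1) * stable_s \<alpha> \<rho> z)"
proof (cases "z = 0")
  case True
  then show ?thesis by (simp add: res_gap_def)
next
  case False
  let ?E = "exp (- (\<i> * of_real angle))"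
  let ?w = "1 / \<bar>z\<bar>"
  define f where "f \<theta> = Re ((1 - iexp (- (\<theta> * z))) / \<Psi> \<theta>)" for \<theta>
  have [measurable]: "f \<in> borel_measurable borel" unfolding f_def by measurable
  have f_int: "integrable lborel f"
    using integrable_Re[OF integrable_res_gap[of 0 z]] by (simp add: f_def[abs_def])
  have even: "f (- \<theta>) = f \<theta>" for \<theta>
  proof -
    have "(1 - iexp (- (- \<theta> * z))) / \<Psi> (- \<theta>) = cnj ((1 - iexp (- (\<theta> * z))) / \<Psi> \<theta>)"
      by (simp add: exponent_minus exp_cnj)
    note eq = this
    show ?thesis unfolding f_def eq by (rule cnj.sel(1))
  qed
  define J where "J = - of_real (Gamma (1 - \<alpha>)) * exp (\<i> * of_real (pi * (\<alpha> - 1) / 2))"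
  define g where "g t = (indicator {0<..} t *\<^sub>R ((1 - exp (- (\<i> * of_real t))) * of_real (t powr - \<alpha>)) :: complex)" for t :: real
  have J: "has_bochner_integral lborel g J"
    unfolding g_def J_def by (rule integral_one_minus_iexp[OF alpha])
  have cJ: "has_bochner_integral lborel (\<lambda>t. cnj (g t)) (cnj J)"
    using J by (auto simp: has_bochner_integral_iff)
  \<comment> \<open>Folding always keeps the half \<theta> > 0. For negative z the exponential then
    has the opposite sign, which conjugates the Gamma integral but not the factor \<open>?E\<close>
    of the exponent.\<close>
  define K where "K = (if z > 0 then J else cnj J)"
  define G where "G t = (if z > 0 then g t else cnj (g t))" for t
  have K: "has_bochner_integral lborel G K"
    using J cJ unfolding K_def G_def by auto
  have "(LBINT \<theta>. f \<theta>) = (LBINT \<theta>. indicator {0<..} \<theta> *\<^sub>R (f \<theta> + f (- \<theta>)))"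
    by (rule integrable_even_extension(2)) (use f_int in \<open>auto simp: even integrable_real_mult_indicator mult.commute[of "indicator _ _"]\<close>)
  also have "\<dots> = (LBINT \<theta>. indicator {0<..} \<theta> * (2 * f \<theta>))" by (simp add: even)
  also have "\<dots> = \<bar>?w\<bar> *\<^sub>R (LBINT t. indicator {0<..} (0 + ?w * t) * (2 * f (0 + ?w * t)))"
    using False by (intro lborel_integral_real_affine) auto
  also have "(\<lambda>t. indicator {0<..} (0 + ?w * t) * (2 * f (0 + ?w * t)))
     = (\<lambda>t. 2 * \<bar>z\<bar> powr \<alpha> * Re (?E * G t))"
  proof
    fix t :: real
    show "indicator {0<..} (0 + ?w * t) * (2 * f (0 + ?w * t)) = 2 * \<bar>z\<bar> powr \<alpha> * Re (?E * G t)"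
    proof (cases "t > 0")
      case True
      have pos: "?w * t > 0" using True False by simp
      have "(1 - iexp (- (?w * t * z))) / \<Psi> (?w * t)
         = of_real (\<bar>z\<bar> powr \<alpha>) * (?E * ((1 - iexp (- (?w * t * z))) * of_real (t powr - \<alpha>)))"
        unfolding exponent_pos[OF pos] using True False
        by (simp add: powr_divide powr_minus exp_minus field_simps)
      moreover have "(1 - iexp (- (?w * t * z))) * of_real (t powr - \<alpha>) = G t"
        using True False by (cases "z > 0") (auto simp: G_def g_def exp_cnj)
      ultimately have "(1 - iexp (- (?w * t * z))) / \<Psi> (?w * t) = of_real (\<bar>z\<bar> powr \<alpha>) * (?E * G t)"
        by simp
      then have "f (?w * t) = \<bar>z\<bar> powr \<alpha> * Re (?E * G t)"
        unfolding f_def by (simp only: Re_complex_of_real Im_complex_of_real times_complex.sel)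
      then show ?thesis using pos by simp
    next
      case f: False
      then have "\<not> 0 < t / \<bar>z\<bar>" using False by (simp add: zero_less_divide_iff)
      then show ?thesis using f by (simp add: G_def g_def)
    qed
  qed
  also have "(LBINT t. 2 * \<bar>z\<bar> powr \<alpha> * Re (?E * G t)) = 2 * \<bar>z\<bar> powr \<alpha> * Re (?E * K)"
  proof -
    have "has_bochner_integral lborel (\<lambda>t. ?E * G t) (?E * K)"
      by (intro has_bochner_integral_mult_right K)
    then have "(LBINT t. Re (?E * G t)) = Re (?E * K)"
      using integral_Re has_bochner_integral_iff by metis
    then show ?thesis by (simp del: times_complex.sel)
  qed
  also have "Re (?E * K) = - Gamma (1 - \<alpha>) * stable_s \<alpha> \<rho> z"
  proof (cases "z > 0")
    case True
    \<comment> \<open>Phases: \<open>- angle + pi * (\<alpha> - 1) / 2 = pi * \<alpha> * \<rho> - pi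
      / 2\<close>.\<close>
    have "?E * K = - of_real (Gamma (1 - \<alpha>)) * exp (\<i> * of_real (pi * \<alpha> * \<rho> - pi / 2))"
      using True by (simp add: K_def J_def exp_add[symmetric] angle_def algebra_simps diff_divide_distrib)
    then have "Re (?E * K) = - Gamma (1 - \<alpha>) * cos (pi * \<alpha> * \<rho> - pi / 2)"
      by (simp only: Re_exp) (simp add: Re_exp)
    then show ?thesis using True by (simp add: stable_s_def cos_diff)
  next
    case neg: False
    have "?E * K = - of_real (Gamma (1 - \<alpha>)) * exp (\<i> * of_real (pi / 2 - pi * \<alpha> * (1 - \<rho>)))"
      using neg by (simp add: K_def J_def exp_cnj exp_add[symmetric] angle_def algebra_simps diff_divide_distrib)
    then have "Re (?E * K) = - Gamma (1 - \<alpha>) * cos (pi / 2 - pi * \<alpha> * (1 - \<rho>))"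
      by (simp only: Re_exp) (simp add: Re_exp)
    then show ?thesis using neg False by (simp add: stable_s_def cos_diff)
  qed
  finally have "(LBINT \<theta>. f \<theta>) = \<bar>?w\<bar> * (2 * \<bar>z\<bar> powr \<alpha> * (- Gamma (1 - \<alpha>) * stable_s \<alpha> \<rho> z))"
    by simp
  then show ?thesis
    unfolding res_gap_def f_def[symmetric] using False by (simp add: f_def powr_diff mult_ac)
qed

section \<open>The killed density as a limit of killed resolvent densities\<close>

lemma killed_density_eq:
  "killed_density \<alpha> \<rho> x y = res_gap 0 y + res_gap 0 (- x) - res_gap 0 (y - x)"
  unfolding killed_density_def res_gap_0 by (simp add: algebra_simps)

definition killed_res_density :: "real \<Rightarrow> real \<Rightarrow> real \<Rightarrow> real" where
  "killed_res_density q x y = res_density q (y - x) - res_density q (- x) / res_density q 0 * res_density q y"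

lemma killed_res_density_eq:
  assumes q: "q > 0"
  shows "killed_res_density q x y = res_gap q y + res_gap q (- x) - res_gap q (y - x) - res_gap q (- x) * res_gap q y * (1 / res_density q 0)"
  using res_density_0_pos_bound(1)[OF q]
  unfolding killed_res_density_def res_gap_eq[OF q] by (simp add: field_simps)

lemma continuous_res_density: "q > 0 \<Longrightarrow> continuous_on UNIV (res_density q)"
  unfolding res_density_def by (intro continuous_fourier_inv integrable_resolvent)

lemma continuous_res_gap: "continuous_on UNIV (res_gap 0)"
  unfolding continuous_on_eq_continuous_at[OF open_UNIV] continuous_at_sequentially
proof (intro ballI allI impI)
  fix z and s :: "nat \<Rightarrow> real" assume s: "s \<longlonglongrightarrow> z"
  then obtain B where B: "\<And>n. \<bar>s n\<bar> \<le> B"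
    using convergent_imp_Bseq[of s] by (auto simp: convergent_def Bseq_def)
  have "(\<lambda>n. \<integral>\<theta>. Re ((1 - iexp (- (\<theta> * s n))) / (of_real 0 + \<Psi> \<theta>)) \<partial>lborel)
     \<longlonglongrightarrow> (LBINT \<theta>. Re ((1 - iexp (- (\<theta> * z))) / (of_real 0 + \<Psi> \<theta>)))"
  proof (rule integral_dominated_convergence[where w="\<lambda>\<theta>. (2 + B) / cos angle * majorant \<theta>"])
    show "integrable lborel (\<lambda>\<theta>. (2 + B) / cos angle * majorant \<theta>)"
      by (intro integrable_mult_right integrable_majorant)
    show "AE \<theta> in lborel. norm (Re ((1 - iexp (- (\<theta> * s n))) / (of_real 0 + \<Psi> \<theta>))) \<le> (2 + B) / cos angle * majorant \<theta>" for n
      using AE_lborel_singleton[of 0] unfolding real_norm_def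
    proof eventually_elim
      case (elim \<theta>)
      have "\<bar>Re ((1 - iexp (- (\<theta> * s n))) / (of_real 0 + \<Psi> \<theta>))\<bar> \<le> (2 + \<bar>s n\<bar>) / cos angle * majorant \<theta>"
        by (rule order_trans[OF abs_Re_le_cmod res_gap_integrand_bound[OF order_refl elim]])
      also have "\<dots> \<le> (2 + B) / cos angle * majorant \<theta>"
        using B[of n] cos_angle_pos by (intro mult_right_mono divide_right_mono) (auto simp: majorant_def)
      finally show ?case .
    qed
    show "AE \<theta> in lborel. (\<lambda>n. Re ((1 - iexp (- (\<theta> * s n))) / (of_real 0 + \<Psi> \<theta>)))
      \<longlonglongrightarrow> Re ((1 - iexp (- (\<theta> * z))) / (of_real 0 + \<Psi> \<theta>))"
      using AE_lborel_singleton[of 0]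
    proof eventually_elim
      case (elim \<theta>)
      have "\<Psi> \<theta> \<noteq> 0" using elim norm_exponent[of \<theta>] by auto
      then show ?case by (intro tendsto_intros s) auto
    qed
  qed auto
  then show "(res_gap 0 \<circ> s) \<longlonglongrightarrow> res_gap 0 z"
    unfolding res_gap_def comp_def by (intro tendsto_intros) auto
qed

lemma continuous_killed_density: "continuous_on UNIV (killed_density \<alpha> \<rho> x)"
proof -
  have "continuous_on UNIV (\<lambda>y. res_gap 0 y + res_gap 0 (- x) - res_gap 0 (y - x))"
    by (intro continuous_intros continuous_on_compose2[OF continuous_res_gap]) auto
  then show ?thesis by (simp add: killed_density_eq[abs_def])
qed

text \<open>On a bounded interval the gaps are bounded uniformly in q, so dominated convergence
  applies. The product of two gaps carries the factor \<open>1 / res_density (q n) 0\<close> and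
  disappears in the limit.\<close>

lemma killed_res_density_integral_tendsto:
  fixes q :: "nat \<Rightarrow> real"
  assumes q: "\<And>n. q n > 0" "\<And>n. q n \<le> 1" "q \<longlonglongrightarrow> 0" and ab: "a < b"
  shows "(\<lambda>n. LBINT y:{a<..<b}. killed_res_density (q n) x y) \<longlonglongrightarrow> (LBINT y:{a<..<b}. killed_density \<alpha> \<rho> x y)"
proof -
  have U0: "(\<lambda>n. 1 / res_density (q n) 0) \<longlonglongrightarrow> 0"
  proof (rule tendsto_sandwich[OF _ _ tendsto_const])
    show "\<forall>\<^sub>F n in sequentially. 0 \<le> 1 / res_density (q n) 0"
      using res_density_0_pos_bound(1)[OF q(1)] by (auto simp: less_imp_le)
    show "\<forall>\<^sub>F n in sequentially. 1 / res_density (q n) 0 \<le> 8 * pi * q n powr (1 - 1 / \<alpha>)"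
      using res_density_0_pos_bound(2)[OF q(1)] by auto
    have "(\<lambda>n. q n powr (1 - 1 / \<alpha>)) \<longlonglongrightarrow> 0"
      using q alpha by (intro tendsto_zero_powrI[where b="1 - 1 / \<alpha>"]) (auto simp: less_imp_le)
    then have "(\<lambda>n. 8 * pi * q n powr (1 - 1 / \<alpha>)) \<longlonglongrightarrow> 8 * pi * 0" by (intro tendsto_intros)
    then show "(\<lambda>n. 8 * pi * q n powr (1 - 1 / \<alpha>)) \<longlonglongrightarrow> 0" by simp
  qed
  \<comment> \<open>Here \<open>q n \<le> 1\<close> enters: it makes the bound on the reciprocal
    uniform in n.\<close>
  have U1: "\<bar>1 / res_density (q n) 0\<bar> \<le> 8 * pi" for n
  proof -
    have "q n powr (1 - 1 / \<alpha>) \<le> 1" using q(1,2)[of n] alpha by (intro powr_le1) (auto simp: less_imp_le)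
    then have "8 * pi * q n powr (1 - 1 / \<alpha>) \<le> 8 * pi" by simp
    then have "1 / res_density (q n) 0 \<le> 8 * pi"
      by (rule order_trans[OF res_density_0_pos_bound(2)[OF q(1)]])
    then show ?thesis using res_density_0_pos_bound(1)[OF q(1)[of n]] by simp
  qed
  define C where "C = (LBINT \<theta>. majorant \<theta>) / (cos angle * (2 * pi))"
  have C: "C \<ge> 0" unfolding C_def using cos_angle_pos
    by (intro divide_nonneg_pos integral_nonneg) (auto simp: majorant_def)
  define N where "N = 2 + \<bar>a\<bar> + \<bar>b\<bar> + \<bar>x\<bar>"
  have gap: "\<bar>res_gap (q n) z\<bar> \<le> N * C" if "\<bar>z\<bar> \<le> \<bar>a\<bar> + \<bar>b\<bar> + \<bar>x\<bar>" for n z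
  proof -
    have "\<bar>res_gap (q n) z\<bar> \<le> (2 + \<bar>z\<bar>) * C" unfolding C_def using q(1)[of n] by (intro res_gap_bound) simp
    also have "\<dots> \<le> N * C" using that C by (intro mult_right_mono) (auto simp: N_def)
    finally show ?thesis .
  qed
  let ?W = "3 * (N * C) + (N * C) * (N * C) * (8 * pi)"
  have bound: "\<bar>killed_res_density (q n) x y\<bar> \<le> ?W" if "y \<in> {a<..<b}" for n y
  proof -
    have 1: "\<bar>res_gap (q n) y\<bar> \<le> N * C" "\<bar>res_gap (q n) (- x)\<bar> \<le> N * C" "\<bar>res_gap (q n) (y - x)\<bar> \<le> N * C"
      using that by (auto intro!: gap)
    have "\<bar>res_gap (q n) (- x) * res_gap (q n) y * (1 / res_density (q n) 0)\<bar> \<le> (N * C) * (N * C) * (8 * pi)"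
      unfolding abs_mult using 1 U1[of n] by (intro mult_mono) auto
    with 1 show ?thesis unfolding killed_res_density_eq[OF q(1)] by linarith
  qed
  have meas[measurable]: "killed_res_density (q n) x \<in> borel_measurable borel" for n
  proof -
    have "continuous_on UNIV (\<lambda>y. res_density (q n) (y - x) - res_density (q n) (- x) / res_density (q n) 0 * res_density (q n) y)"
      by (intro continuous_intros continuous_on_compose2[OF continuous_res_density[OF q(1)]]) auto
    then show ?thesis unfolding killed_res_density_def[abs_def] by (rule borel_measurable_continuous_onI)
  qed
  have [measurable]: "killed_density \<alpha> \<rho> x \<in> borel_measurable borel"
    by (rule borel_measurable_continuous_onI[OF continuous_killed_density])
  show ?thesis
    unfolding set_lebesgue_integral_def
  proof (rule integral_dominated_convergence[where w="\<lambda>y. indicator {a..b} y *\<^sub>R ?W"])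
    show "integrable lborel (\<lambda>y. indicator {a..b} y *\<^sub>R ?W)"
      by (simp only: integrable_scaleR_left lborel_integrable_indicator_Icc)
    show "AE y in lborel. norm (indicator {a<..<b} y *\<^sub>R killed_res_density (q n) x y) \<le> indicator {a..b} y *\<^sub>R ?W" for n
    proof (rule AE_I2)
      fix y
      have "0 \<le> ?W" using C by (auto simp: N_def)
      then show "norm (indicator {a<..<b} y *\<^sub>R killed_res_density (q n) x y) \<le> indicator {a..b} y *\<^sub>R ?W"
        using bound[of y n] by (auto split: split_indicator)
    qed
    show "AE y in lborel. (\<lambda>n. indicator {a<..<b} y *\<^sub>R killed_res_density (q n) x y) \<longlonglongrightarrow> indicator {a<..<b} y *\<^sub>R killed_density \<alpha> \<rho> x y"
    proof (rule AE_I2)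
      fix y
      have "(\<lambda>n. res_gap (q n) y + res_gap (q n) (- x) - res_gap (q n) (y - x) - res_gap (q n) (- x) * res_gap (q n) y * (1 / res_density (q n) 0))
        \<longlonglongrightarrow> res_gap 0 y + res_gap 0 (- x) - res_gap 0 (y - x) - res_gap 0 (- x) * res_gap 0 y * 0"
        by (intro tendsto_intros res_gap_tendsto q U0)
      then have "(\<lambda>n. killed_res_density (q n) x y) \<longlonglongrightarrow> killed_density \<alpha> \<rho> x y"
        unfolding killed_res_density_eq[OF q(1)] killed_density_eq by simp
      then show "(\<lambda>n. indicator {a<..<b} y *\<^sub>R killed_res_density (q n) x y) \<longlonglongrightarrow> indicator {a<..<b} y *\<^sub>R killed_density \<alpha> \<rho> x y"
        by (intro tendsto_intros)
    qed
  qed auto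
qed

end

section \<open>Markov property on a grid and resolvents\<close>

text \<open>Independence as a freezing rule: the second variable is replaced by an independent copy,
  integrated separately over the same space. It takes the place of conditional expectations.\<close>

lemma (in prob_space) nn_integral_indep_var:
  assumes ind: "indep_var S V T W" and [measurable]: "\<phi> \<in> borel_measurable (S \<Otimes>\<^sub>M T)"
  shows "(\<integral>\<^sup>+\<omega>. \<phi> (V \<omega>, W \<omega>) \<partial>M) = (\<integral>\<^sup>+\<omega>. (\<integral>\<^sup>+\<omega>'. \<phi> (V \<omega>, W \<omega>') \<partial>M) \<partial>M)"
proof -
  from ind have [measurable]: "V \<in> measurable M S" "W \<in> measurable M T"
    and eq: "distr M S V \<Otimes>\<^sub>M distr M T W = distr M (S \<Otimes>\<^sub>M T) (\<lambda>\<omega>. (V \<omega>, W \<omega>))"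
    unfolding indep_var_distribution_eq by auto
  interpret V: prob_space "distr M S V" by (rule prob_space_distr) simp
  interpret W: prob_space "distr M T W" by (rule prob_space_distr) simp
  have [measurable]: "\<phi> \<in> borel_measurable (distr M S V \<Otimes>\<^sub>M distr M T W)"
    by (simp cong: measurable_cong_sets)
  have "(\<integral>\<^sup>+\<omega>. \<phi> (V \<omega>, W \<omega>) \<partial>M) = (\<integral>\<^sup>+p. \<phi> p \<partial>distr M (S \<Otimes>\<^sub>M T) (\<lambda>\<omega>. (V \<omega>, W \<omega>)))"
    by (subst nn_integral_distr) auto
  also have "\<dots> = (\<integral>\<^sup>+v. (\<integral>\<^sup>+w. \<phi> (v, w) \<partial>distr M T W) \<partial>distr M S V)"
    unfolding eq[symmetric] by (rule W.nn_integral_fst[symmetric]) measurable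
  also have "\<dots> = (\<integral>\<^sup>+\<omega>. (\<integral>\<^sup>+w. \<phi> (V \<omega>, w) \<partial>distr M T W) \<partial>M)"
    by (subst nn_integral_distr) auto
  also have "\<dots> = (\<integral>\<^sup>+\<omega>. (\<integral>\<^sup>+\<omega>'. \<phi> (V \<omega>, W \<omega>') \<partial>M) \<partial>M)"
    by (intro nn_integral_cong nn_integral_distr) (auto simp: measurable_space[of V M S])
  finally show ?thesis .
qed

locale stable_motion = prob_space M + stable_parameters \<alpha> \<rho>
  for M :: "'w measure" and \<alpha> \<rho> :: real +
  fixes X :: "real \<Rightarrow> 'w \<Rightarrow> real"
  assumes process: "stable_process M X \<alpha> \<rho>"
begin

lemma X_measurable [measurable]: "X t \<in> borel_measurable M"
  using process unfolding stable_process_def by blast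

lemma X_0: "w \<in> space M \<Longrightarrow> X 0 w = 0"
  using process unfolding stable_process_def by blast

lemma X_right_continuous:
  assumes "w \<in> space M" "t \<ge> 0"
  shows "((\<lambda>s. X s w) \<longlongrightarrow> X t w) (at_right t)"
proof -
  have "continuous (at_right t) (\<lambda>s. X s w)"
    using process assms unfolding stable_process_def by blast
  then show ?thesis by (simp add: continuous_within)
qed

lemma X_increments_indep:
  assumes "0 \<le> t (0::nat)" "\<And>i. i < n \<Longrightarrow> t i < t (Suc i)"
  shows "indep_vars (\<lambda>_. borel) (\<lambda>i w. X (t (Suc i)) w - X (t i) w) {..<n}"
  using process assms unfolding stable_process_def by blast

lemma X_increment_char:
  assumes "0 \<le> s" "s \<le> t"
  shows "char (distr M borel (\<lambda>w. X t w - X s w)) \<theta> = exp (- complex_of_real (t - s) * \<Psi> \<theta>)"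
  using process assms unfolding stable_process_def by blast

lemma X_char:
  assumes "0 \<le> t"
  shows "char (distr M borel (X t)) \<theta> = exp (- complex_of_real t * \<Psi> \<theta>)"
proof -
  have "distr M borel (X t) = distr M borel (\<lambda>w. X t w - X 0 w)"
    by (intro distr_cong) (auto simp: X_0)
  then show ?thesis using X_increment_char[of 0 t] assms by simp
qed

lemma X_increment_distr:
  assumes "0 \<le> t" "0 \<le> h"
  shows "distr M borel (\<lambda>w. X (t + h) w - X t w) = distr M borel (X h)"
proof (rule Levy_uniqueness)
  show "real_distribution (distr M borel (\<lambda>w. X (t + h) w - X t w))" "real_distribution (distr M borel (X h))"
    by (auto intro!: real_distribution_distr)
  show "char (distr M borel (\<lambda>w. X (t + h) w - X t w)) = char (distr M borel (X h))"
    using X_increment_char[of t "t + h"] X_char[of h] assms by (auto simp: fun_eq_iff)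
qed

text \<open>By right continuity the process is a pointwise limit of processes that are constant in
  time on the cells of a grid. The \<open>max 0\<close> appears because the paths are regular only
  at nonnegative times.\<close>

lemma X_joint_measurable [measurable]: "(\<lambda>(t, w). X (max 0 t) w) \<in> borel_measurable (borel \<Otimes>\<^sub>M M)"
proof -
  \<comment> \<open>Rounding down and adding 1 gives a grid point strictly to the right of the time,
    as the filter \<open>at_right\<close> requires, at distance at most
    \<open>1 / Suc n\<close>.\<close>
  define g :: "nat \<Rightarrow> real \<Rightarrow> nat" where "g n t = nat \<lfloor>real (Suc n) * max 0 t\<rfloor>" for n t
  define A where "A n = (\<lambda>(t, w). X ((real (g n t) + 1) / real (Suc n)) w)" for n
  have "A n \<in> borel_measurable (borel \<Otimes>\<^sub>M M)" for n
  proof -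
    have "(\<lambda>p. (\<lambda>k p. X ((real k + 1) / real (Suc n)) (snd p)) (g n (fst p)) p) \<in> borel_measurable (borel \<Otimes>\<^sub>M M)"
    proof (rule measurable_compose_countable[where f="\<lambda>k p. X ((real k + 1) / real (Suc n)) (snd p)" and g="\<lambda>p. g n (fst p)"])
      show "(\<lambda>p. g n (fst p)) \<in> borel \<Otimes>\<^sub>M M \<rightarrow>\<^sub>M count_space UNIV" unfolding g_def by measurable
    qed measurable
    then show ?thesis by (simp add: A_def split_beta')
  qed
  moreover have "(\<lambda>n. A n p) \<longlonglongrightarrow> (case p of (t, w) \<Rightarrow> X (max 0 t) w)" if "p \<in> space (borel \<Otimes>\<^sub>M M)" for p
  proof -
    obtain t w where p: "p = (t, w)" by (cases p)
    then have w: "w \<in> space M" using that by (auto simp: space_pair_measure)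
    define s where "s = max 0 t"
    have s: "s \<ge> 0" by (simp add: s_def)
    define a where "a n = (real (g n t) + 1) / real (Suc n)" for n
    have fl: "real (g n t) \<le> real (Suc n) * s" "real (Suc n) * s < real (g n t) + 1" for n
    proof -
      have "0 \<le> \<lfloor>real (Suc n) * s\<rfloor>" using s by simp
      then have "real (g n t) = of_int \<lfloor>real (Suc n) * s\<rfloor>" by (simp add: g_def s_def)
      then show "real (g n t) \<le> real (Suc n) * s" "real (Suc n) * s < real (g n t) + 1" by linarith+
    qed
    have a: "s < a n" "a n \<le> s + inverse (real (Suc n))" for n
      using fl[of n] by (auto simp: a_def field_simps simp del: of_nat_Suc)
    have "a \<longlonglongrightarrow> s"
    proof (rule tendsto_sandwich[OF _ _ tendsto_const])
      show "(\<lambda>n. s + inverse (real (Suc n))) \<longlonglongrightarrow> s"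
        using tendsto_add[OF tendsto_const[of s] LIMSEQ_inverse_real_of_nat] by simp
    qed (use a in \<open>auto simp: less_imp_le\<close>)
    then have "filterlim a (at_right s) sequentially"
      using a by (auto simp: filterlim_at intro!: always_eventually)
    then have "(\<lambda>n. X (a n) w) \<longlonglongrightarrow> X s w"
      by (rule filterlim_compose[OF X_right_continuous[OF w s]])
    then show ?thesis by (simp add: p A_def a_def s_def)
  qed
  ultimately show ?thesis by (rule borel_measurable_LIMSEQ_metric)
qed

lemma X_joint_measurable' [measurable (raw)]:
  assumes [measurable]: "f \<in> borel_measurable N" "g \<in> measurable N M"
  shows "(\<lambda>p. X (max 0 (f p)) (g p)) \<in> borel_measurable N"
proof -
  have "(\<lambda>(t, w). X (max 0 t) w) \<circ> (\<lambda>p. (f p, g p)) \<in> borel_measurable N"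
    by (rule measurable_comp[OF _ X_joint_measurable]) measurable
  then show ?thesis by (simp add: comp_def)
qed

section \<open>Markov property at the first visit of a grid\<close>

definition first_at :: "real \<Rightarrow> real \<Rightarrow> real \<Rightarrow> nat \<Rightarrow> 'w set" where
  "first_at y d e k = {w \<in> space M. \<bar>y + X (real k * d) w\<bar> < e \<and> (\<forall>j<k. \<not> \<bar>y + X (real j * d) w\<bar> < e)}"

lemma first_at_sets [measurable]: "first_at y d e k \<in> sets M"
  unfolding first_at_def by measurable

text \<open>The event and \<open>X (k * d)\<close> only involve finitely many increments, so that no filtration is needed.\<close>
lemma markov_first_at:
  assumes d: "d > 0" and h: "h > 0" and [measurable]: "f \<in> borel_measurable borel"
  shows "(\<integral>\<^sup>+w. indicator (first_at y d e k) w * f (y + X (real k * d + h) w) \<partial>M)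
    = (\<integral>\<^sup>+w. indicator (first_at y d e k) w * (\<integral>\<^sup>+w'. f (y + X (real k * d) w + X h w') \<partial>M) \<partial>M)"
proof -
  let ?x = "\<lambda>w. X (real k * d) w"
  let ?I = "\<lambda>w. indicator (first_at y d e k) w :: ennreal"
  \<comment> \<open>The grid up to index k, followed by one step of length h. The first k increments
    determine the event and the position at time \<open>k * d\<close>; the last one is independent
    of them.\<close>
  define t where "t i = (if i \<le> k then real i * d else real k * d + h)" for i
  define D where "D i w = X (t (Suc i)) w - X (t i) w" for i w
  define S where "S j v = (\<Sum>i<j. v i)" for j and v :: "nat \<Rightarrow> real"
  define V where "V w = restrict (\<lambda>i. D i w) {..<k}" for w
  define W where "W w = restrict (\<lambda>i. D i w) {k}" for w
  have "indep_vars (\<lambda>_. borel) D {..<Suc k}"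
    unfolding D_def using d h by (intro X_increments_indep) (auto simp: t_def less_Suc_eq)
  then have ind: "indep_var (PiM {..<k} (\<lambda>_. borel)) V (PiM {k} (\<lambda>_. borel)) W"
    unfolding V_def W_def by (rule indep_var_restrict) auto
  have SV: "S j (V w) = X (real j * d) w" if "j \<le> k" "w \<in> space M" for j w
  proof -
    have "S j (V w) = (\<Sum>i<j. X (real (Suc i) * d) w - X (real i * d) w)"
      unfolding S_def V_def using that by (intro sum.cong) (auto simp: D_def t_def)
    also have "\<dots> = X (real j * d) w" by (subst sum_lessThan_telescope) (use that X_0 in simp)
    finally show ?thesis .
  qed
  have Wk: "W w k = X (real k * d + h) w - ?x w" for w
    by (simp add: W_def D_def t_def)
  \<comment> \<open>The \<open>min\<close> keeps the coordinates that are read inside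
    \<open>{..<k}\<close> for every \<open>j\<close>, so that this holds without a side condition on
    \<open>j\<close>.\<close>
  have [measurable]: "S (min j k) \<in> borel_measurable (PiM {..<k} (\<lambda>_. borel))" for j
    unfolding S_def by (intro borel_measurable_sum measurable_component_singleton) auto
  define E where "E = {v \<in> space (PiM {..<k} (\<lambda>_. borel)). \<bar>y + S (min k k) v\<bar> < e \<and> (\<forall>j\<in>{..<k}. \<not> \<bar>y + S (min j k) v\<bar> < e)}"
  have [measurable]: "E \<in> sets (PiM {..<k} (\<lambda>_. borel))"
    unfolding E_def by measurable
  have Vsp: "V w \<in> space (PiM {..<k} (\<lambda>_. borel))" for w by (auto simp: V_def space_PiM)
  have iE: "indicator E (V w) = ?I w" if "w \<in> space M" for w
    using Vsp that SV[OF _ that] by (auto simp: E_def first_at_def indicator_def)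
  define \<phi> where "\<phi> = (\<lambda>(v, w). indicator E v * f (y + S k v + w k) :: ennreal)"
  have Sk[measurable]: "S k \<in> borel_measurable (PiM {..<k} (\<lambda>_. borel))"
    unfolding S_def by (intro borel_measurable_sum measurable_component_singleton) auto
  have wk[measurable]: "(\<lambda>w. w k) \<in> borel_measurable (PiM {k} (\<lambda>_. borel))" by (rule measurable_component_singleton) simp
  have \<phi>[measurable]: "\<phi> \<in> borel_measurable (PiM {..<k} (\<lambda>_. borel) \<Otimes>\<^sub>M PiM {k} (\<lambda>_. borel))"
    unfolding \<phi>_def by measurable
  have "(\<integral>\<^sup>+w. ?I w * f (y + X (real k * d + h) w) \<partial>M) = (\<integral>\<^sup>+w. \<phi> (V w, W w) \<partial>M)"
    by (intro nn_integral_cong) (simp add: \<phi>_def iE Wk SV)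
  also have "\<dots> = (\<integral>\<^sup>+w. (\<integral>\<^sup>+w'. \<phi> (V w, W w') \<partial>M) \<partial>M)"
    by (rule nn_integral_indep_var[OF ind \<phi>])
  also have "\<dots> = (\<integral>\<^sup>+w. ?I w * (\<integral>\<^sup>+w'. f (y + ?x w + X h w') \<partial>M) \<partial>M)"
  proof (rule nn_integral_cong)
    fix w assume w: "w \<in> space M"
    have "(\<integral>\<^sup>+w'. \<phi> (V w, W w') \<partial>M) = (\<integral>\<^sup>+w'. ?I w * f (y + ?x w + (X (real k * d + h) w' - ?x w')) \<partial>M)"
      by (simp add: \<phi>_def iE Wk SV w)
    also have "\<dots> = ?I w * (\<integral>\<^sup>+w'. f (y + ?x w + (X (real k * d + h) w' - ?x w')) \<partial>M)"
      by (rule nn_integral_cmult) measurable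
    also have "(\<integral>\<^sup>+w'. f (y + ?x w + (X (real k * d + h) w' - ?x w')) \<partial>M)
       = (\<integral>\<^sup>+z. f (y + ?x w + z) \<partial>distr M borel (\<lambda>w'. X (real k * d + h) w' - ?x w'))"
      by (subst nn_integral_distr) auto
    also have "\<dots> = (\<integral>\<^sup>+z. f (y + ?x w + z) \<partial>distr M borel (X h))"
      using d h by (subst X_increment_distr) auto
    also have "\<dots> = (\<integral>\<^sup>+w'. f (y + ?x w + X h w') \<partial>M)"
      by (subst nn_integral_distr) auto
    finally show "(\<integral>\<^sup>+w'. \<phi> (V w, W w') \<partial>M) = ?I w * (\<integral>\<^sup>+w'. f (y + ?x w + X h w') \<partial>M)" .
  qed
  finally show ?thesis .
qed

end

section \<open>The resolvent through an independent exponential time\<close>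

lemma integral_exp_complex:
  fixes w :: complex
  assumes w: "Re w > 0"
  shows "has_bochner_integral lborel (\<lambda>t. indicator {0..} t *\<^sub>R exp (- (of_real t * w))) (1 / w)"
proof -
  have real_int: "has_bochner_integral lborel (\<lambda>t. indicator {0<..} t * (t powr (1 - 1) * exp (- Re w * t))) (Gamma 1 / Re w powr 1)"
    by (rule has_integral_Gamma_scaled) (use w in auto)
  then have dom: "integrable lborel (\<lambda>t. indicator {0<..} t * exp (- Re w * t))"
    unfolding has_bochner_integral_iff by (elim conjE, subst (asm) Bochner_Integration.integrable_cong[OF refl])
      (auto split: split_indicator)
  have int: "integrable lborel (\<lambda>t. indicator {0<..} t *\<^sub>R exp (- (of_real t * w)))"
    by (rule Bochner_Integration.integrable_bound[OF dom]) (auto intro!: AE_I2 split: split_indicator)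
  have w0: "w \<noteq> 0" using w by auto
  have "(LBINT t=0..\<infinity>. exp (- (of_real t * w))) = 0 - (- (1 / w))"
  proof (rule interval_integral_FTC_integrable[where F="\<lambda>t. - exp (- (of_real t * w)) / w"])
    show "((\<lambda>t. - exp (- (of_real t * w)) / w) has_vector_derivative exp (- (of_real t * w))) (at t)" for t
    proof -
      have "((\<lambda>z. - exp (- (z * w)) / w) has_field_derivative exp (- (of_real t * w))) (at (of_real t))"
        using w0 by (auto intro!: derivative_eq_intros)
      from has_vector_derivative_real_field[OF this] show ?thesis by simp
    qed
    show "isCont (\<lambda>t. exp (- (complex_of_real t * w))) t" for t by (intro continuous_intros)
    show "set_integrable lborel (einterval 0 \<infinity>) (\<lambda>t. exp (- (of_real t * w)))"
      using int by (simp add: set_integrable_def einterval_eq zero_ereal_def)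
    have "((\<lambda>t. - exp (- (of_real t * w)) / w) \<longlongrightarrow> - exp (- (of_real 0 * w)) / w) (at_right 0)"
      using w0 by (intro tendsto_intros) 
    then show "(((\<lambda>t. - exp (- (of_real t * w)) / w) \<circ> real_of_ereal) \<longlongrightarrow> - (1 / w)) (at_right 0)"
      by (simp add: zero_ereal_def ereal_tendsto_simps1)
    have "((\<lambda>t. norm (- exp (- (complex_of_real t * w)) / w)) \<longlongrightarrow> 0) at_top"
    proof -
      have "filterlim (\<lambda>t. Re w * t) at_top at_top"
        using w by (rule filterlim_tendsto_pos_mult_at_top[OF tendsto_const _ filterlim_ident])
      then have "((\<lambda>t. exp (- (Re w * t))) \<longlongrightarrow> 0) at_top"
        by (intro filterlim_compose[OF exp_at_bot] filterlim_uminus_at_bot_at_top[THEN filterlim_compose])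
      then have "((\<lambda>t. exp (- (Re w * t)) / norm w) \<longlongrightarrow> 0 / norm w) at_top"
        using w0 by (intro tendsto_intros) auto
      then show ?thesis by (simp add: norm_divide mult.commute)
    qed
    then have "((\<lambda>t. - exp (- (complex_of_real t * w)) / w) \<longlongrightarrow> 0) at_top"
      by (rule tendsto_norm_zero_cancel)
    then show "(((\<lambda>t. - exp (- (of_real t * w)) / w) \<circ> real_of_ereal) \<longlongrightarrow> 0) (at_left \<infinity>)"
      by (simp add: ereal_tendsto_simps1)
  qed simp
  then have val: "(LBINT t. indicator {0<..} t *\<^sub>R exp (- (of_real t * w))) = 1 / w"
    by (simp add: interval_lebesgue_integral_def set_lebesgue_integral_def einterval_eq zero_ereal_def)
  have "has_bochner_integral lborel (\<lambda>t. indicator {0<..} t *\<^sub>R exp (- (of_real t * w))) (1 / w)"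
    using int val by (simp add: has_bochner_integral_iff)
  then show ?thesis
    by (subst has_bochner_integral_cong_AE[where g="\<lambda>t. indicator {0<..} t *\<^sub>R exp (- (of_real t * w))"])
       (use AE_lborel_singleton[of 0] in \<open>auto split: split_indicator elim!: eventually_mono\<close>)
qed

lemma fourier_inv_cmult: "fourier_inv (\<lambda>t. of_real c * \<phi> t) z = c * fourier_inv \<phi> z"
proof -
  have "Re (iexp (- (t * z)) * (of_real c * \<phi> t)) = c * Re (iexp (- (t * z)) * \<phi> t)" for t
    by (simp add: algebra_simps)
  then show ?thesis unfolding fourier_inv_def by (simp del: times_complex.sel)
qed

context stable_motion
begin

text \<open>At an independent exponential time of rate r the process has a law with characteristic
  function \<open>r / (r + \<Psi>)\<close>. Thus r times the resolvent is a probability law, to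
  which Fourier inversion applies; its density is r times \<open>res_density r\<close>, which is
  therefore nonnegative.\<close>

definition exp_clock :: "real \<Rightarrow> real measure" where
  "exp_clock r = density lborel (exponential_density r)"

lemma prob_space_exp_clock: "r > 0 \<Longrightarrow> prob_space (exp_clock r)"
  unfolding exp_clock_def by (rule prob_space_exponential_density)

lemma sets_exp_clock [measurable_cong, simp]: "sets (exp_clock r) = sets borel"
  by (simp add: exp_clock_def)

definition clock_law :: "real \<Rightarrow> real measure" where
  "clock_law r = distr (exp_clock r \<Otimes>\<^sub>M M) borel (\<lambda>(t, w). X (max 0 t) w)"

lemma real_distribution_clock:
  assumes r: "r > 0" shows "real_distribution (clock_law r)"
proof -
  interpret E: prob_space "exp_clock r" by (rule prob_space_exp_clock[OF r])
  interpret P: pair_prob_space "exp_clock r" M ..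
  show ?thesis unfolding clock_law_def by (rule P.real_distribution_distr) measurable
qed

lemma char_clock:
  assumes r: "r > 0"
  shows "char (clock_law r) \<theta> = of_real r * (1 / (of_real r + \<Psi> \<theta>))"
proof -
  interpret E: prob_space "exp_clock r" by (rule prob_space_exp_clock[OF r])
  interpret P: pair_prob_space "exp_clock r" M ..
  have int: "integrable (exp_clock r \<Otimes>\<^sub>M M) (\<lambda>p. iexp (\<theta> * X (max 0 (fst p)) (snd p)))"
    by (rule P.integrable_const_bound[where B=1]) auto
  have "char (clock_law r) \<theta> = (\<integral>p. iexp (\<theta> * X (max 0 (fst p)) (snd p)) \<partial>(exp_clock r \<Otimes>\<^sub>M M))"
    unfolding char_def clock_law_def by (subst integral_distr) (auto simp: split_beta')
  also have "\<dots> = (\<integral>t. (\<integral>w. iexp (\<theta> * X (max 0 t) w) \<partial>M) \<partial>exp_clock r)"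
    using P.integral_fst'[OF int] by simp
  also have "\<dots> = (\<integral>t. char (distr M borel (X (max 0 t))) \<theta> \<partial>exp_clock r)"
    unfolding char_def by (subst integral_distr) auto
  also have "\<dots> = (\<integral>t. exp (- complex_of_real (max 0 t) * \<Psi> \<theta>) \<partial>exp_clock r)"
    by (subst X_char) auto
  also have "\<dots> = (LBINT t. exponential_density r t *\<^sub>R exp (- complex_of_real (max 0 t) * \<Psi> \<theta>))"
    unfolding exp_clock_def using r
    by (intro integral_density) (auto simp: exponential_density_nonneg)
  also have "\<dots> = (LBINT t. of_real r * (indicator {0..} t *\<^sub>R exp (- (of_real t * (of_real r + \<Psi> \<theta>)))))"
  proof (intro Bochner_Integration.integral_cong refl)
    fix t :: real
    show "exponential_density r t *\<^sub>R exp (- complex_of_real (max 0 t) * \<Psi> \<theta>) = of_real r * (indicator {0..} t *\<^sub>R exp (- (of_real t * (of_real r + \<Psi> \<theta>))))"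
      by (auto simp: exponential_density_def scaleR_conv_of_real exp_of_real[symmetric] exp_add[symmetric] algebra_simps exp_minus exp_diff divide_inverse)
  qed
  also have "\<dots> = of_real r * (LBINT t. indicator {0..} t *\<^sub>R exp (- (of_real t * (of_real r + \<Psi> \<theta>))))"
    by (rule integral_mult_right_zero)
  also have "(LBINT t. indicator {0..} t *\<^sub>R exp (- (of_real t * (of_real r + \<Psi> \<theta>)))) = 1 / (of_real r + \<Psi> \<theta>)"
    using integral_exp_complex[of "of_real r + \<Psi> \<theta>"] r cos_angle_pos
    by (auto simp: has_bochner_integral_iff Re_exponent add_pos_nonneg)
  finally show ?thesis .
qed

lemma res_density_char:
  assumes r: "r > 0"
  shows "fourier_inv (char (clock_law r)) z = r * res_density r z"
    and "integrable lborel (char (clock_law r))"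
proof -
  have eq: "char (clock_law r) = (\<lambda>\<theta>. of_real r * (1 / (of_real r + \<Psi> \<theta>)))"
    by (intro ext char_clock r)
  show "fourier_inv (char (clock_law r)) z = r * res_density r z"
    unfolding eq fourier_inv_cmult res_density_def ..
  show "integrable lborel (char (clock_law r))"
    unfolding eq by (intro integrable_mult_right integrable_resolvent r)
qed

lemma res_density_nonneg: "r > 0 \<Longrightarrow> 0 \<le> res_density r z"
  using real_distribution.fourier_inv_char_nonneg[OF real_distribution_clock res_density_char(2), of r z] res_density_char(1)[of r z]
  by (simp add: zero_le_mult_iff)

lemma res_density_measurable [measurable]: "r > 0 \<Longrightarrow> res_density r \<in> borel_measurable borel"
  by (rule borel_measurable_continuous_onI[OF continuous_res_density])

text \<open>Up to the factor r, both sides are the expectation of \<open>f\<close> at z plus the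
  position at the exponential time, computed once by integrating over time and once through the
  density.\<close>

lemma resolvent_nn_integral:
  assumes r: "r > 0" and [measurable]: "f \<in> borel_measurable borel"
  shows "(\<integral>\<^sup>+h\<in>{0<..}. ennreal (exp (- r * h)) * (\<integral>\<^sup>+w. f (z + X h w) \<partial>M) \<partial>lborel)
    = (\<integral>\<^sup>+y. f y * ennreal (res_density r (y - z)) \<partial>lborel)"
proof -
  interpret E: prob_space "exp_clock r" by (rule prob_space_exp_clock[OF r])
  interpret P: pair_prob_space "exp_clock r" M ..
  note [measurable] = res_density_measurable[OF r]
  define I where "I = (\<integral>\<^sup>+h\<in>{0<..}. ennreal (exp (- r * h)) * (\<integral>\<^sup>+w. f (z + X h w) \<partial>M) \<partial>lborel)"
  have "(\<integral>\<^sup>+v. f (z + v) \<partial>clock_law r) = (\<integral>\<^sup>+p. f (z + X (max 0 (fst p)) (snd p)) \<partial>(exp_clock r \<Otimes>\<^sub>M M))"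
    unfolding clock_law_def by (subst nn_integral_distr) (auto simp: split_beta')
  also have "\<dots> = (\<integral>\<^sup>+t. (\<integral>\<^sup>+w. f (z + X (max 0 t) w) \<partial>M) \<partial>exp_clock r)"
    by (subst nn_integral_fst[symmetric]) auto
  also have "\<dots> = (\<integral>\<^sup>+t. ennreal (exponential_density r t) * (\<integral>\<^sup>+w. f (z + X (max 0 t) w) \<partial>M) \<partial>lborel)"
    unfolding exp_clock_def by (intro nn_integral_density) auto
  also have "\<dots> = (\<integral>\<^sup>+t. ennreal r * (ennreal (exp (- r * t)) * (\<integral>\<^sup>+w. f (z + X (max 0 t) w) \<partial>M) * indicator {0<..} t) \<partial>lborel)"
    using AE_lborel_singleton[of 0]
    by (intro nn_integral_cong_AE, eventually_elim)
       (use r in \<open>auto simp: exponential_density_def ennreal_mult mult_ac split: split_indicator\<close>)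
  also have "\<dots> = ennreal r * (\<integral>\<^sup>+t\<in>{0<..}. ennreal (exp (- r * t)) * (\<integral>\<^sup>+w. f (z + X (max 0 t) w) \<partial>M) \<partial>lborel)"
    by (rule nn_integral_cmult) measurable
  also have "(\<integral>\<^sup>+t\<in>{0<..}. ennreal (exp (- r * t)) * (\<integral>\<^sup>+w. f (z + X (max 0 t) w) \<partial>M) \<partial>lborel) = I"
    unfolding I_def by (intro nn_integral_cong) (auto split: split_indicator)
  finally have 1: "(\<integral>\<^sup>+v. f (z + v) \<partial>clock_law r) = ennreal r * I" .
  have "(\<integral>\<^sup>+v. f (z + v) \<partial>clock_law r) = (\<integral>\<^sup>+v. f (z + v) \<partial>density lborel (\<lambda>v. ennreal (r * res_density r v)))"
    using real_distribution.eq_density_fourier_inv[OF real_distribution_clock[OF r] res_density_char(2)[OF r]]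
    unfolding res_density_char(1)[OF r] by simp
  also have "\<dots> = (\<integral>\<^sup>+v. ennreal r * (f (z + v) * ennreal (res_density r v)) \<partial>lborel)"
    using r res_density_nonneg[OF r] by (subst nn_integral_density) (auto simp: ennreal_mult mult_ac)
  also have "\<dots> = ennreal r * (\<integral>\<^sup>+v. f (z + v) * ennreal (res_density r v) \<partial>lborel)"
    by (rule nn_integral_cmult) measurable
  also have "(\<integral>\<^sup>+v. f (z + v) * ennreal (res_density r v) \<partial>lborel) = (\<integral>\<^sup>+y. f y * ennreal (res_density r (y - z)) \<partial>lborel)"
    by (subst nn_integral_real_affine[where c=1 and t="- z" and f="\<lambda>v. f (z + v) * ennreal (res_density r v)"]) auto
  finally have "ennreal r * I = ennreal r * (\<integral>\<^sup>+y. f y * ennreal (res_density r (y - z)) \<partial>lborel)"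
    unfolding 1 .
  then show ?thesis using r unfolding I_def[symmetric] by (simp add: ennreal_mult_cancel_left)
qed

section \<open>Discounted integrals along the path\<close>

definition future :: "real \<Rightarrow> real \<Rightarrow> (real \<Rightarrow> real) \<Rightarrow> real \<Rightarrow> 'w \<Rightarrow> real" where
  "future y r f T w = (LBINT h. indicator {0<..} h * (exp (- r * h) * f (y + X (max 0 (T + h)) w)))"

definition resolvent :: "real \<Rightarrow> (real \<Rightarrow> real) \<Rightarrow> real \<Rightarrow> real" where
  "resolvent r f z = (LBINT y. f y * res_density r (y - z))"

context
  fixes f :: "real \<Rightarrow> real" and B r :: real
  assumes f_measurable [measurable]: "f \<in> borel_measurable borel"
    and f_nonneg: "\<And>v. 0 \<le> f v" and f_le: "\<And>v. f v \<le> B" and r: "r > 0"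
begin

lemma has_integral_exp_half_line: "has_bochner_integral lborel (\<lambda>t. indicator {0<..} t * exp (- r * t)) (1 / r)"
proof -
  have "has_bochner_integral lborel (\<lambda>t. indicator {0<..} t * (t powr (1 - 1) * exp (- r * t))) (Gamma 1 / r powr 1)"
    using r by (intro has_integral_Gamma_scaled) auto
  then show ?thesis
    by (subst (asm) has_bochner_integral_cong[OF refl _ refl]) (use r in \<open>auto split: split_indicator\<close>)
qed

lemma bound_nonneg: "0 \<le> B"
  using f_nonneg[of 0] f_le[of 0] by simp

lemma future_integrable:
  assumes w: "w \<in> space M"
  shows "integrable lborel (\<lambda>h. indicator {0<..} h * (exp (- r * h) * f (y + X (max 0 (T + h)) w)))"
proof (rule Bochner_Integration.integrable_bound)
  show "integrable lborel (\<lambda>t. B * (indicator {0<..} t * exp (- r * t)))"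
    using has_integral_exp_half_line by (intro integrable_mult_right) (auto simp: has_bochner_integral_iff)
  show "AE h in lborel. norm (indicator {0<..} h * (exp (- r * h) * f (y + X (max 0 (T + h)) w))) \<le> norm (B * (indicator {0<..} h * exp (- r * h)))"
    using f_nonneg f_le bound_nonneg by (auto intro!: AE_I2 simp: abs_mult mult.commute split: split_indicator)
  have [measurable]: "(\<lambda>h. w) \<in> measurable lborel M" using w by simp
  show "(\<lambda>h. indicator {0<..} h * (exp (- r * h) * f (y + X (max 0 (T + h)) w))) \<in> borel_measurable lborel"
    by measurable
qed

lemma future_nonneg: "0 \<le> future y r f T w"
  unfolding future_def using f_nonneg by (intro Bochner_Integration.integral_nonneg) (auto split: split_indicator)

lemma future_le:
  assumes w: "w \<in> space M" shows "future y r f T w \<le> B / r"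
proof -
  have "future y r f T w \<le> (LBINT t. B * (indicator {0<..} t * exp (- r * t)))"
    unfolding future_def
  proof (rule integral_mono[OF future_integrable[OF w]])
    show "integrable lborel (\<lambda>t. B * (indicator {0<..} t * exp (- r * t)))"
      using has_integral_exp_half_line by (intro integrable_mult_right) (auto simp: has_bochner_integral_iff)
  qed (use f_le in \<open>auto simp: mult.commute split: split_indicator\<close>)
  also have "\<dots> = B / r" using has_integral_exp_half_line by (simp add: has_bochner_integral_iff)
  finally show ?thesis .
qed

lemma future_measurable [measurable (raw)]:
  assumes [measurable]: "g \<in> borel_measurable M"
  shows "(\<lambda>w. future y r f (g w) w) \<in> borel_measurable M"
  unfolding future_def by measurable

lemma ennreal_future:
  assumes w: "w \<in> space M"
  shows "ennreal (future y r f T w) = (\<integral>\<^sup>+h\<in>{0<..}. ennreal (exp (- r * h)) * ennreal (f (y + X (max 0 (T + h)) w)) \<partial>lborel)"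
proof -
  have "ennreal (future y r f T w) = (\<integral>\<^sup>+h. ennreal (indicator {0<..} h * (exp (- r * h) * f (y + X (max 0 (T + h)) w))) \<partial>lborel)"
    unfolding future_def using f_nonneg by (intro nn_integral_eq_integral[symmetric] future_integrable[OF w]) auto
  then show ?thesis using f_nonneg by (simp add: ennreal_mult mult_ac ennreal_indicator)
qed

lemma resolvent_nn:
  shows "(\<integral>\<^sup>+h\<in>{0<..}. ennreal (exp (- r * h)) * (\<integral>\<^sup>+w. ennreal (f (z + X h w)) \<partial>M) \<partial>lborel) = ennreal (resolvent r f z)"
    and "integrable lborel (\<lambda>y. f y * res_density r (y - z))"
    and "0 \<le> resolvent r f z"
proof -
  note [measurable] = res_density_measurable[OF r]
  let ?I = "\<integral>\<^sup>+h\<in>{0<..}. ennreal (exp (- r * h)) * (\<integral>\<^sup>+w. ennreal (f (z + X h w)) \<partial>M) \<partial>lborel"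
  have eq: "?I = (\<integral>\<^sup>+y. ennreal (f y * res_density r (y - z)) \<partial>lborel)"
    using res_density_nonneg[OF r] f_nonneg
    by (subst resolvent_nn_integral[OF r]) (auto simp: ennreal_mult)
  have "?I \<le> (\<integral>\<^sup>+h. ennreal (B * (indicator {0<..} h * exp (- r * h))) \<partial>lborel)"
  proof (rule nn_integral_mono)
    fix h :: real
    have "(\<integral>\<^sup>+w. ennreal (f (z + X h w)) \<partial>M) \<le> (\<integral>\<^sup>+w. ennreal B \<partial>M)"
      using f_le by (intro nn_integral_mono ennreal_leI)
    also have "\<dots> = ennreal B" by (simp add: emeasure_space_1)
    finally show "ennreal (exp (- r * h)) * (\<integral>\<^sup>+w. ennreal (f (z + X h w)) \<partial>M) * indicator {0<..} h \<le> ennreal (B * (indicator {0<..} h * exp (- r * h)))"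
      using bound_nonneg by (auto simp: ennreal_mult mult.commute[of B] intro!: mult_left_mono split: split_indicator)
  qed
  also have "\<dots> < \<infinity>"
    using has_bochner_integral_mult_right[OF has_integral_exp_half_line, of B] bound_nonneg
    by (subst nn_integral_eq_integral) (auto simp: has_bochner_integral_iff)
  finally have "(\<integral>\<^sup>+y. ennreal (f y * res_density r (y - z)) \<partial>lborel) < \<infinity>" unfolding eq .
  then show int: "integrable lborel (\<lambda>y. f y * res_density r (y - z))"
    using res_density_nonneg[OF r] f_nonneg by (intro integrableI_nonneg) auto
  show "?I = ennreal (resolvent r f z)"
    unfolding eq resolvent_def using int res_density_nonneg[OF r] f_nonneg
    by (intro nn_integral_eq_integral) auto
  show "0 \<le> resolvent r f z"
    unfolding resolvent_def using res_density_nonneg[OF r] f_nonneg by (intro Bochner_Integration.integral_nonneg) auto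
qed

lemma resolvent_eq_expectation: "resolvent r f z = (\<integral>w. future z r f 0 w \<partial>M)"
proof -
  have "ennreal (resolvent r f z) = (\<integral>\<^sup>+h. (\<integral>\<^sup>+w. ennreal (exp (- r * h)) * ennreal (f (z + X (max 0 (0 + h)) w)) * indicator {0<..} h \<partial>M) \<partial>lborel)"
    unfolding resolvent_nn(1)[symmetric]
    by (intro nn_integral_cong) (auto simp: nn_integral_cmult split: split_indicator)
  also have "\<dots> = (\<integral>\<^sup>+w. (\<integral>\<^sup>+h. ennreal (exp (- r * h)) * ennreal (f (z + X (max 0 (0 + h)) w)) * indicator {0<..} h \<partial>lborel) \<partial>M)"
  proof -
    interpret pair_sigma_finite lborel M ..
    show ?thesis by (rule Fubini'[symmetric]) measurable
  qed
  also have "\<dots> = (\<integral>\<^sup>+w. ennreal (future z r f 0 w) \<partial>M)"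
    by (intro nn_integral_cong ennreal_future[symmetric])
  also have "\<dots> = ennreal (\<integral>w. future z r f 0 w \<partial>M)"
    using future_nonneg future_le
    by (intro nn_integral_eq_integral integrable_const_bound[where B="B / r"]) auto
  finally show ?thesis using resolvent_nn(3) future_nonneg by (simp add: Bochner_Integration.integral_nonneg)
qed

text \<open>\<open>markov_first_at\<close> at each lag h > 0, integrated over h with weight
  \<open>exp (- r * h)\<close>. Fubini is applied before and after, since the identity at a fixed
  lag holds only in expectation.\<close>

lemma markov_future:
  assumes d: "d > 0"
  shows "(\<integral>\<^sup>+w. indicator (first_at y d e k) w * ennreal (future y r f (real k * d) w) \<partial>M)
    = (\<integral>\<^sup>+w. indicator (first_at y d e k) w * ennreal (resolvent r f (y + X (real k * d) w)) \<partial>M)"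
proof -
  let ?e = "\<lambda>h. ennreal (exp (- r * h))"
  let ?F = "\<lambda>h w. ennreal (f (y + X (max 0 (real k * d + h)) w))"
  let ?P = "\<lambda>w h. \<integral>\<^sup>+w'. ennreal (f (y + X (real k * d) w + X (max 0 h) w')) \<partial>M"
  let ?I = "\<lambda>w. indicator (first_at y d e k) w :: ennreal"
  interpret pair_sigma_finite lborel M ..
  have pos: "max 0 (real k * d + h) = real k * d + h" if "h > 0" for h
    using d that by (simp add: add_nonneg_nonneg)
  have "(\<integral>\<^sup>+w. ?I w * ennreal (future y r f (real k * d) w) \<partial>M)
    = (\<integral>\<^sup>+w. (\<integral>\<^sup>+h. ?I w * (?e h * ?F h w * indicator {0<..} h) \<partial>lborel) \<partial>M)"
  proof (rule nn_integral_cong)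
    fix w assume w[measurable]: "w \<in> space M"
    have [measurable]: "(\<lambda>h. w) \<in> measurable lborel M" using w by simp
    show "?I w * ennreal (future y r f (real k * d) w)
       = (\<integral>\<^sup>+h. ?I w * (?e h * ?F h w * indicator {0<..} h) \<partial>lborel)"
      unfolding ennreal_future[OF w] by (rule nn_integral_cmult[symmetric]) measurable
  qed
  also have "\<dots> = (\<integral>\<^sup>+h. (\<integral>\<^sup>+w. ?I w * (?e h * ?F h w * indicator {0<..} h) \<partial>M) \<partial>lborel)"
    by (rule Fubini') measurable
  also have "\<dots> = (\<integral>\<^sup>+h. (\<integral>\<^sup>+w. ?I w * (?e h * ?P w h * indicator {0<..} h) \<partial>M) \<partial>lborel)"
  proof (rule nn_integral_cong)
    fix h :: real
    show "(\<integral>\<^sup>+w. ?I w * (?e h * ?F h w * indicator {0<..} h) \<partial>M)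
      = (\<integral>\<^sup>+w. ?I w * (?e h * ?P w h * indicator {0<..} h) \<partial>M)"
    proof (cases "h > 0")
      case True
      have "(\<integral>\<^sup>+w. ?I w * (?e h * ?F h w * indicator {0<..} h) \<partial>M)
         = (\<integral>\<^sup>+w. ?e h * (?I w * ennreal (f (y + X (real k * d + h) w))) \<partial>M)"
        unfolding pos[OF True] using True by (intro nn_integral_cong) (simp add: mult_ac)
      also have "\<dots> = ?e h * (\<integral>\<^sup>+w. ?I w * ennreal (f (y + X (real k * d + h) w)) \<partial>M)"
        by (rule nn_integral_cmult) measurable
      also have "\<dots> = ?e h * (\<integral>\<^sup>+w. ?I w * (\<integral>\<^sup>+w'. ennreal (f (y + X (real k * d) w + X h w')) \<partial>M) \<partial>M)"
        by (subst markov_first_at[OF d True, where f="\<lambda>v. ennreal (f v)"]) auto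
      also have "\<dots> = (\<integral>\<^sup>+w. ?e h * (?I w * (\<integral>\<^sup>+w'. ennreal (f (y + X (real k * d) w + X h w')) \<partial>M)) \<partial>M)"
        by (rule nn_integral_cmult[symmetric]) measurable
      also have "\<dots> = (\<integral>\<^sup>+w. ?I w * (?e h * ?P w h * indicator {0<..} h) \<partial>M)"
        using True by (intro nn_integral_cong) (simp add: mult_ac)
      finally show ?thesis .
    qed simp
  qed
  also have "\<dots> = (\<integral>\<^sup>+w. (\<integral>\<^sup>+h. ?I w * (?e h * ?P w h * indicator {0<..} h) \<partial>lborel) \<partial>M)"
    by (rule Fubini'[symmetric]) measurable
  also have "\<dots> = (\<integral>\<^sup>+w. ?I w * ennreal (resolvent r f (y + X (real k * d) w)) \<partial>M)"
  proof (rule nn_integral_cong)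
    fix w assume w: "w \<in> space M"
    have "(\<integral>\<^sup>+h. ?I w * (?e h * ?P w h * indicator {0<..} h) \<partial>lborel)
      = ?I w * (\<integral>\<^sup>+h. ?e h * ?P w h * indicator {0<..} h \<partial>lborel)"
      by (rule nn_integral_cmult) measurable
    also have "(\<integral>\<^sup>+h. ?e h * ?P w h * indicator {0<..} h \<partial>lborel)
      = ennreal (resolvent r f (y + X (real k * d) w))"
      unfolding resolvent_nn(1)[symmetric] by (intro nn_integral_cong) (auto split: split_indicator)
    finally show "(\<integral>\<^sup>+h. ?I w * (?e h * ?P w h * indicator {0<..} h) \<partial>lborel)
      = ?I w * ennreal (resolvent r f (y + X (real k * d) w))" .
  qed
  finally show ?thesis .
qed

end

end

section \<open>Strong Markov property at the approach time of zero\<close>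

text \<open>The value at time \<open>\<infinity>\<close> is \<open>0\<close>, in accordance with \<open>exp (- q * \<infinity>) = 0\<close>.\<close>
definition at_time :: "(real \<Rightarrow> real) \<Rightarrow> ereal \<Rightarrow> real" where
  "at_time \<phi> T = (if T = \<infinity> then 0 else \<phi> (real_of_ereal T))"

lemma at_time_simps [simp]: "at_time \<phi> \<infinity> = 0" "at_time \<phi> (ereal t) = \<phi> t"
  by (simp_all add: at_time_def)

text \<open>Decay at infinity makes \<open>at_time\<close> continuous on [0, \<infinity>]. Hitting
  times may thus be infinite, or tend to infinity, without special treatment.\<close>

lemma at_time_tendsto:
  fixes T :: "nat \<Rightarrow> ereal"
  assumes cont: "continuous_on {0..} \<phi>" and lim: "(\<phi> \<longlongrightarrow> 0) at_top"
    and T: "\<And>n. 0 \<le> T n" "T \<longlonglongrightarrow> L"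
  shows "(\<lambda>n. at_time \<phi> (T n)) \<longlonglongrightarrow> at_time \<phi> L"
proof -
  have L: "0 \<le> L" using T by (intro LIMSEQ_le_const[OF T(2)]) auto
  then consider l where "L = ereal l" "0 \<le> l" | "L = \<infinity>" by (cases L) auto
  then show ?thesis
  proof cases
    case 1
    have fin: "\<forall>\<^sub>F n in sequentially. T n < ereal (l + 1)"
      using T(2) 1 by (intro order_tendstoD(2)) auto
    have "(\<lambda>n. real_of_ereal (T n)) \<longlonglongrightarrow> l" using T(2) 1 by (intro lim_real_of_ereal) simp
    then have "(\<lambda>n. \<phi> (real_of_ereal (T n))) \<longlonglongrightarrow> \<phi> l"
      using 1 T(1) by (intro continuous_on_tendsto_compose[OF cont]) (auto intro!: always_eventually real_of_ereal_pos)
    moreover have "\<forall>\<^sub>F n in sequentially. \<phi> (real_of_ereal (T n)) = at_time \<phi> (T n)"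
      using fin by eventually_elim (auto simp: at_time_def)
    ultimately show ?thesis using 1 by (simp add: tendsto_cong)
  next
    case 2
    have "(\<lambda>n. at_time \<phi> (T n)) \<longlonglongrightarrow> 0"
    proof (rule tendstoI)
      fix e :: real assume "e > 0"
      then have "\<forall>\<^sub>F t in at_top. dist (\<phi> t) 0 < e" using lim by (rule tendstoD[rotated])
      then obtain K where K: "\<And>t. t \<ge> K \<Longrightarrow> \<bar>\<phi> t\<bar> < e" by (auto simp: eventually_at_top_linorder)
      have "\<forall>\<^sub>F n in sequentially. ereal K < T n" using T(2) 2 by (intro order_tendstoD(1)) auto
      then show "\<forall>\<^sub>F n in sequentially. dist (at_time \<phi> (T n)) 0 < e"
      proof eventually_elim
        case (elim n)
        then show ?case using K \<open>e > 0\<close> by (cases "T n") auto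
      qed
    qed
    then show ?thesis using 2 by simp
  qed
qed

lemma exp_decay_at_top: "q > 0 \<Longrightarrow> ((\<lambda>t::real. exp (- q * t)) \<longlongrightarrow> 0) at_top"
proof -
  assume "q > 0"
  then have "filterlim (\<lambda>t. q * t) at_top at_top"
    by (rule filterlim_tendsto_pos_mult_at_top[OF tendsto_const _ filterlim_ident])
  then show ?thesis
    unfolding mult_minus_left
    by (intro filterlim_compose[OF exp_at_bot] filterlim_uminus_at_bot_at_top[THEN filterlim_compose])
qed

lemma at_time_measurable [measurable (raw)]:
  assumes [measurable]: "T \<in> borel_measurable M" "(\<lambda>w. \<phi> w (real_of_ereal (T w))) \<in> borel_measurable M"
  shows "(\<lambda>w. at_time (\<phi> w) (T w)) \<in> borel_measurable M"
  unfolding at_time_def by measurable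

definition discount :: "real \<Rightarrow> ereal \<Rightarrow> real" where
  "discount q = at_time (\<lambda>t. exp (- q * t))"

lemma discount_bounds: "q > 0 \<Longrightarrow> 0 \<le> T \<Longrightarrow> 0 \<le> discount q T" "q > 0 \<Longrightarrow> 0 \<le> T \<Longrightarrow> discount q T \<le> 1"
  by (cases T; simp add: discount_def)+

lemma discount_tendsto:
  assumes "q > 0" "\<And>n. 0 \<le> T n" "T \<longlonglongrightarrow> L"
  shows "(\<lambda>n. discount q (T n)) \<longlonglongrightarrow> discount q L"
  unfolding discount_def using assms by (intro at_time_tendsto exp_decay_at_top continuous_intros) auto

section \<open>Entrance times of intervals around zero\<close>

context stable_motion
begin

definition grid_hit :: "real \<Rightarrow> real \<Rightarrow> real \<Rightarrow> 'w \<Rightarrow> ereal" where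
  "grid_hit y e d w = (INF k. if \<bar>y + X (real k * d) w\<bar> < e then ereal (real k * d) else \<infinity>)"

lemma grid_hit_measurable [measurable]: "grid_hit y e d \<in> borel_measurable M"
  unfolding grid_hit_def by measurable

lemma grid_hit_nonneg: "d \<ge> 0 \<Longrightarrow> 0 \<le> grid_hit y e d w"
  unfolding grid_hit_def by (intro INF_greatest) auto

lemma grid_hit_first:
  assumes d: "d > 0" and w: "w \<in> first_at y d e k"
  shows "grid_hit y e d w = ereal (real k * d)"
proof (rule antisym)
  show "grid_hit y e d w \<le> ereal (real k * d)"
    unfolding grid_hit_def using w by (intro INF_lower2[of k]) (auto simp: first_at_def)
  show "ereal (real k * d) \<le> grid_hit y e d w"
    unfolding grid_hit_def
  proof (rule INF_greatest)
    fix j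
    show "ereal (real k * d) \<le> (if \<bar>y + X (real j * d) w\<bar> < e then ereal (real j * d) else \<infinity>)"
      using w d by (cases "j < k") (auto simp: first_at_def)
  qed
qed

lemma grid_hit_infinite:
  assumes w: "w \<in> space M" "\<And>k. w \<notin> first_at y d e k"
  shows "grid_hit y e d w = \<infinity>"
proof -
  have "\<not> \<bar>y + X (real k * d) w\<bar> < e" for k
  proof
    assume a: "\<bar>y + X (real k * d) w\<bar> < e"
    let ?P = "\<lambda>k. \<bar>y + X (real k * d) w\<bar> < e"
    have "w \<in> first_at y d e (LEAST k. ?P k)"
      using w(1) LeastI[of ?P, OF a] not_less_Least[of _ ?P] by (auto simp: first_at_def)
    then show False using w(2) by blast
  qed
  then show ?thesis unfolding grid_hit_def by simp
qed

text \<open>The first-visit events are disjoint and exhaust the set where the grid is hit; off that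
  set the integrand vanishes.\<close>

lemma nn_integral_split_first_at:
  assumes d: "d > 0" and [measurable]: "Z \<in> borel_measurable M"
    and Z: "\<And>w. grid_hit y e d w = \<infinity> \<Longrightarrow> Z w = 0"
  shows "(\<integral>\<^sup>+w. Z w \<partial>M) = (\<Sum>k. \<integral>\<^sup>+w. indicator (first_at y d e k) w * Z w \<partial>M)"
proof -
  let ?I = "\<lambda>k w. indicator (first_at y d e k) w :: ennreal"
  have disj: "disjoint_family (first_at y d e)"
    unfolding disjoint_family_on_def
  proof (intro ballI impI)
    fix i j :: nat assume "i \<noteq> j"
    then show "first_at y d e i \<inter> first_at y d e j = {}"
      by (cases i j rule: linorder_cases) (auto simp: first_at_def)
  qed
  have "(\<integral>\<^sup>+w. Z w \<partial>M) = (\<integral>\<^sup>+w. (\<Sum>k. ?I k w * Z w) \<partial>M)"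
  proof (rule nn_integral_cong)
    fix w assume w: "w \<in> space M"
    show "Z w = (\<Sum>k. ?I k w * Z w)"
    proof (cases "\<exists>k. w \<in> first_at y d e k")
      case True
      then obtain k where "w \<in> first_at y d e k" by blast
      then show ?thesis using suminf_cmult_indicator[OF disj, of w k "\<lambda>_. Z w"] by (simp add: mult.commute)
    next
      case False
      then show ?thesis using Z[OF grid_hit_infinite[OF w]] by simp
    qed
  qed
  also have "\<dots> = (\<Sum>k. \<integral>\<^sup>+w. ?I k w * Z w \<partial>M)"
    by (rule nn_integral_suminf) measurable
  finally show ?thesis .
qed

text \<open>Entrance time of the open interval of radius \<open>1 / Suc m\<close>, read off from
  dyadic times only and hence measurable. That dyadic times suffice is the content of
  \<open>ball_hit_le\<close>.\<close>

definition ball_hit :: "real \<Rightarrow> nat \<Rightarrow> 'w \<Rightarrow> ereal" where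
  "ball_hit y m w = (INF n. grid_hit y (inverse (real (Suc m))) ((1/2) ^ n) w)"

text \<open>A priori this may be smaller than the hitting time, since a path could come arbitrarily
  close to zero before a jump without reaching it.\<close>

definition approach_time :: "real \<Rightarrow> 'w \<Rightarrow> ereal" where
  "approach_time y w = (SUP m. ball_hit y m w)"

lemma ball_hit_measurable [measurable]: "ball_hit y m \<in> borel_measurable M"
  unfolding ball_hit_def by measurable

lemma approach_time_measurable [measurable]: "approach_time y \<in> borel_measurable M"
  unfolding approach_time_def by measurable

lemma ball_hit_nonneg: "0 \<le> ball_hit y m w"
  unfolding ball_hit_def by (intro INF_greatest grid_hit_nonneg) simp

lemma grid_hit_decseq: "decseq (\<lambda>n. grid_hit y e ((1/2) ^ n) w)"
proof (rule decseq_SucI)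
  fix n
  show "grid_hit y e ((1/2) ^ Suc n) w \<le> grid_hit y e ((1/2) ^ n) w"
    unfolding grid_hit_def
  proof (rule INF_mono)
    fix k :: nat
    show "\<exists>j\<in>UNIV. (if \<bar>y + X (real j * (1/2) ^ Suc n) w\<bar> < e then ereal (real j * (1/2) ^ Suc n) else \<infinity>)
        \<le> (if \<bar>y + X (real k * (1/2) ^ n) w\<bar> < e then ereal (real k * (1/2) ^ n) else \<infinity>)"
      by (intro bexI[of _ "2 * k"]) auto
  qed
qed

lemma grid_hit_tendsto: "(\<lambda>n. grid_hit y (inverse (real (Suc m))) ((1/2) ^ n) w) \<longlonglongrightarrow> ball_hit y m w"
  unfolding ball_hit_def by (rule LIMSEQ_INF[OF grid_hit_decseq])

lemma ball_hit_incseq: "incseq (\<lambda>m. ball_hit y m w)"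
proof (rule incseq_SucI)
  fix m
  have le: "inverse (real (Suc (Suc m))) \<le> inverse (real (Suc m))" by (intro le_imp_inverse_le) auto
  show "ball_hit y m w \<le> ball_hit y (Suc m) w"
    unfolding ball_hit_def grid_hit_def by (intro INF_mono') (auto dest: less_le_trans[OF _ le] simp del: of_nat_Suc)
qed

lemma ball_hit_tendsto: "(\<lambda>m. ball_hit y m w) \<longlonglongrightarrow> approach_time y w"
  unfolding approach_time_def by (rule LIMSEQ_SUP[OF ball_hit_incseq])

lemma approach_time_nonneg: "0 \<le> approach_time y w"
  unfolding approach_time_def by (rule SUP_upper2[of 0]) (auto simp: ball_hit_nonneg)

text \<open>The interval is open and the path right continuous, so a path inside at time t is still
  inside at dyadic times shortly after t.\<close>

lemma ball_hit_le:
  assumes w: "w \<in> space M" and t: "t \<ge> 0" and near: "\<bar>y + X t w\<bar> < inverse (real (Suc m))"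
  shows "ball_hit y m w \<le> ereal t"
proof (rule ereal_le_epsilon2)
  fix e :: real assume e: "e > 0"
  have "((\<lambda>s. \<bar>y + X s w\<bar>) \<longlongrightarrow> \<bar>y + X t w\<bar>) (at_right t)"
    by (intro tendsto_intros X_right_continuous w t)
  then have "\<forall>\<^sub>F s in at_right t. \<bar>y + X s w\<bar> < inverse (real (Suc m))"
    using near by (rule order_tendstoD(2))
  then obtain b where b: "b > t" "\<And>s. t < s \<Longrightarrow> s < b \<Longrightarrow> \<bar>y + X s w\<bar> < inverse (real (Suc m))"
    unfolding eventually_at_right_field by auto
  define g where "g = min (b - t) e"
  have g: "g > 0" using b e by (simp add: g_def)
  obtain n where n: "(1/2::real) ^ n < g" using real_arch_pow_inv[OF g, of "1/2"] by auto
  \<comment> \<open>The first multiple of \<open>(1/2) ^ n\<close> strictly after t. It exceeds t by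
    at most the mesh, which is smaller than both \<open>b - t\<close> and \<open>e\<close>.\<close>
  define k where "k = nat (\<lfloor>t * 2 ^ n\<rfloor> + 1)"
  have "0 \<le> \<lfloor>t * 2 ^ n\<rfloor>" using t by simp
  then have "real k = of_int \<lfloor>t * 2 ^ n\<rfloor> + 1" by (simp add: k_def)
  then have k: "t * 2 ^ n < real k" "real k \<le> t * 2 ^ n + 1" by linarith+
  have k1: "t < real k * (1/2) ^ n" using k(1) by (simp add: power_one_over field_simps)
  have k2: "real k * (1/2) ^ n \<le> t + (1/2) ^ n" using k(2) by (simp add: power_one_over field_simps)
  have "ball_hit y m w \<le> grid_hit y (inverse (real (Suc m))) ((1/2) ^ n) w"
    unfolding ball_hit_def by (rule INF_lower) simp
  also have "\<dots> \<le> ereal (real k * (1/2) ^ n)"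
  proof -
    have "\<bar>y + X (real k * (1/2) ^ n) w\<bar> < inverse (real (Suc m))"
      using k1 k2 n by (intro b(2)) (auto simp: g_def)
    then show ?thesis unfolding grid_hit_def by (intro INF_lower2[of k]) auto
  qed
  also have "\<dots> \<le> ereal t + ereal e" using k2 n by (simp add: g_def)
  finally show "ball_hit y m w \<le> ereal t + ereal e" .
qed

text \<open>The two rates are independent of each other: q discounts up to T, r after T. With
  \<open>r = q\<close> the two discounts merge into a tail of the q-discounted path integral; with q
  fixed and r large, r times this approximates the discounted value of \<open>f\<close> at time
  T.\<close>

definition stopped_future :: "(real \<Rightarrow> real) \<Rightarrow> real \<Rightarrow> real \<Rightarrow> real \<Rightarrow> ereal \<Rightarrow> 'w \<Rightarrow> real" where
  "stopped_future f r q y T w = at_time (\<lambda>t. exp (- q * t) * future y r f t w) T"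

context
  fixes f :: "real \<Rightarrow> real" and B r q y :: real
  assumes f_measurable [measurable]: "f \<in> borel_measurable borel"
    and f_nonneg: "\<And>v. 0 \<le> f v" and f_le: "\<And>v. f v \<le> B" and r: "r > 0" and q: "q > 0"
begin

lemma stopped_future_measurable [measurable (raw)]:
  assumes [measurable]: "T \<in> borel_measurable M"
  shows "(\<lambda>w. stopped_future f r q y (T w) w) \<in> borel_measurable M"
proof -
  note [measurable (raw)] = future_measurable[OF f_measurable f_nonneg f_le r]
  show ?thesis unfolding stopped_future_def by measurable
qed

text \<open>In this form T enters only through an exponential factor and the lower limit of
  integration, which is the source of continuity in T.\<close>

lemma future_eq_tail:
  "future y r f T w = exp (r * T) * (LBINT t. indicator {T<..} t * (exp (- r * t) * f (y + X (max 0 t) w)))"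
proof -
  have "(LBINT t. indicator {T<..} t * (exp (- r * t) * f (y + X (max 0 t) w)))
     = (LBINT h. indicator {T<..} (T + 1 * h) * (exp (- r * (T + 1 * h)) * f (y + X (max 0 (T + 1 * h)) w)))"
    by (subst lborel_integral_real_affine[where c=1 and t=T]) auto
  also have "\<dots> = (LBINT h. exp (- r * T) * (indicator {0<..} h * (exp (- r * h) * f (y + X (max 0 (T + h)) w))))"
    by (intro Bochner_Integration.integral_cong) (auto simp: exp_add[symmetric] algebra_simps split: split_indicator)
  also have "\<dots> = exp (- r * T) * future y r f T w" unfolding future_def by simp
  finally show ?thesis by (simp add: exp_minus field_simps)
qed

text \<open>Moving the lower limit changes the integrand only between the two limits, so a jump of
  the path at T does no harm. This is why limits are taken for \<open>future\<close> and not for the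
  position.\<close>

lemma continuous_future:
  assumes w: "w \<in> space M"
  shows "continuous_on {0..} (\<lambda>t. future y r f t w)"
proof -
  let ?g = "\<lambda>t. exp (- r * t) * f (y + X (max 0 t) w)"
  have "continuous_on {0..} (\<lambda>T. \<integral>t. indicator {T<..} t * ?g t \<partial>lborel)"
    unfolding continuous_on_sequentially
  proof (intro allI ballI impI, elim conjE)
    fix a and s :: "nat \<Rightarrow> real" assume a: "a \<in> {0..}" and s: "\<forall>n. s n \<in> {0..}" "s \<longlonglongrightarrow> a"
    have [measurable]: "(\<lambda>h. w) \<in> measurable lborel M" using w by simp
    have "(\<lambda>n. \<integral>t. indicator {s n<..} t * ?g t \<partial>lborel)
        \<longlonglongrightarrow> (LBINT t. indicator {a<..} t * ?g t)"
    proof (rule integral_dominated_convergence[where w="\<lambda>h. indicator {0<..} h * (exp (- r * h) * f (y + X (max 0 (0 + h)) w))"])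
      show "integrable lborel (\<lambda>h. indicator {0<..} h * (exp (- r * h) * f (y + X (max 0 (0 + h)) w)))"
        by (rule future_integrable[OF f_measurable f_nonneg f_le r w])
      show "AE t in lborel. norm (indicator {s n<..} t * ?g t) \<le> indicator {0<..} t * (exp (- r * t) * f (y + X (max 0 (0 + t)) w))" for n
        using s(1) f_nonneg by (auto simp: abs_mult split: split_indicator intro!: AE_I2 dest: order_le_less_trans)
      show "AE t in lborel. (\<lambda>n. indicator {s n<..} t * ?g t) \<longlonglongrightarrow> indicator {a<..} t * ?g t"
        using AE_lborel_singleton[of a]
      proof eventually_elim
        case (elim t)
        then consider "a < t" | "t < a" by linarith
        then have "\<forall>\<^sub>F n in sequentially. (indicator {s n<..} t :: real) = indicator {a<..} t"
        proof cases
          case 1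
          show ?thesis using order_tendstoD(2)[OF s(2) 1] by eventually_elim (use 1 in simp)
        next
          case 2
          show ?thesis using order_tendstoD(1)[OF s(2) 2] by eventually_elim (use 2 in simp)
        qed
        then have "(\<lambda>n. indicator {s n<..} t :: real) \<longlonglongrightarrow> indicator {a<..} t" by (rule tendsto_eventually)
        then show ?case by (intro tendsto_intros)
      qed
    qed measurable
    then show "((\<lambda>T. \<integral>t. indicator {T<..} t * ?g t \<partial>lborel) \<circ> s)
        \<longlonglongrightarrow> (LBINT t. indicator {a<..} t * ?g t)"
      by (simp add: comp_def)
  qed
  then show ?thesis unfolding future_eq_tail by (intro continuous_intros)
qed

lemma stopped_future_bounds:
  assumes w: "w \<in> space M" and T: "0 \<le> T"
  shows "0 \<le> stopped_future f r q y T w" "stopped_future f r q y T w \<le> B / r"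
proof -
  note fut = future_nonneg[OF f_measurable f_nonneg f_le r] future_le[OF f_measurable f_nonneg f_le r w]
  have B: "0 \<le> B / r" using fut(1)[of y 0 w] fut(2)[of y 0] by linarith
  show "0 \<le> stopped_future f r q y T w" using fut by (auto simp: stopped_future_def at_time_def)
  show "stopped_future f r q y T w \<le> B / r"
  proof (cases T)
    case (real t)
    then have "exp (- q * t) * future y r f t w \<le> 1 * (B / r)" using T q fut B by (intro mult_mono) auto
    then show ?thesis using real by (simp add: stopped_future_def)
  qed (use B T in \<open>auto simp: stopped_future_def\<close>)
qed

lemma stopped_future_tendsto:
  assumes w: "w \<in> space M" and T: "\<And>n. 0 \<le> T n" "T \<longlonglongrightarrow> L"
  shows "(\<lambda>n. stopped_future f r q y (T n) w) \<longlonglongrightarrow> stopped_future f r q y L w"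
  unfolding stopped_future_def
proof (rule at_time_tendsto[OF _ _ T])
  show "continuous_on {0..} (\<lambda>t. exp (- q * t) * future y r f t w)"
    by (intro continuous_intros continuous_future w)
  note fut = future_nonneg[OF f_measurable f_nonneg f_le r] future_le[OF f_measurable f_nonneg f_le r w]
  show "((\<lambda>t. exp (- q * t) * future y r f t w) \<longlongrightarrow> 0) at_top"
  proof (rule tendsto_sandwich[OF _ _ tendsto_const])
    show "((\<lambda>t. exp (- q * t) * (B / r)) \<longlongrightarrow> 0) at_top"
      using tendsto_mult_right[OF exp_decay_at_top[OF q], of "B / r"] by simp
    show "\<forall>\<^sub>F t in at_top. exp (- q * t) * future y r f t w \<le> exp (- q * t) * (B / r)"
      using fut by (intro always_eventually allI mult_left_mono) auto
  qed (use fut in \<open>auto intro!: always_eventually\<close>)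
qed

text \<open>Decompose by the grid index of the first visit. There the Markov property replaces the
  future by the resolvent at the current position, which lies within e of zero, so replacing it by
  the resolvent at 0 costs at most C. Summation keeps this error because the total discount is at
  most 1.\<close>

lemma strong_markov_grid:
  assumes d: "d > 0" and C: "C \<ge> 0"
    and close: "\<And>z. \<bar>z\<bar> < e \<Longrightarrow> \<bar>resolvent r f z - resolvent r f 0\<bar> \<le> C"
  shows "\<bar>(\<integral>w. stopped_future f r q y (grid_hit y e d w) w \<partial>M) - resolvent r f 0 * (\<integral>w. discount q (grid_hit y e d w) \<partial>M)\<bar> \<le> C"
proof -
  let ?V = "\<lambda>k w. ennreal (resolvent r f (y + X (real k * d) w))"
  let ?e = "\<lambda>k. ennreal (exp (- q * (real k * d)))"
  let ?I = "\<lambda>k w. indicator (first_at y d e k) w :: ennreal"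
  let ?T = "grid_hit y e d"
  let ?U = "resolvent r f"
  have T: "0 \<le> ?T w" for w using d by (intro grid_hit_nonneg) simp
  note [measurable (raw)] = future_measurable[OF f_measurable f_nonneg f_le r]
  have [measurable]: "(\<lambda>w. discount q (?T w)) \<in> borel_measurable M" unfolding discount_def by measurable
  have U: "0 \<le> ?U z" for z by (rule resolvent_nn(3)[OF f_measurable f_nonneg f_le r])
  let ?Y = "\<lambda>w. ennreal (stopped_future f r q y (?T w) w)"
  let ?D = "\<lambda>w. ennreal (discount q (?T w))"
  let ?J = "\<lambda>k. \<integral>\<^sup>+w. ?I k w \<partial>M"
  let ?K = "\<lambda>k g. \<integral>\<^sup>+w. ?I k w * g w \<partial>M"
  have Yk: "?K k ?Y
      = ?e k * ?K k (?V k)" for k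
  proof -
    have "?K k ?Y
       = (\<integral>\<^sup>+w. ?e k * (?I k w * ennreal (future y r f (real k * d) w)) \<partial>M)"
      using future_nonneg[OF f_measurable f_nonneg f_le r]
      by (intro nn_integral_cong) (auto simp: stopped_future_def grid_hit_first[OF d] ennreal_mult split: split_indicator)
    also have "\<dots> = ?e k * (\<integral>\<^sup>+w. ?I k w * ennreal (future y r f (real k * d) w) \<partial>M)"
      by (rule nn_integral_cmult) measurable
    finally show ?thesis unfolding markov_future[OF f_measurable f_nonneg f_le r d] .
  qed
  have Dk: "?K k ?D = ?e k * ?J k" for k
    by (subst nn_integral_cmult[symmetric], measurable)
       (intro nn_integral_cong, auto simp: discount_def grid_hit_first[OF d] split: split_indicator)
  have near: "\<bar>y + X (real k * d) w\<bar> < e" if "w \<in> first_at y d e k" for k w using that by (simp add: first_at_def)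
  have le: "?K k ?Y \<le> ennreal (?U 0 + C) * ?K k ?D" for k
  proof -
    have "?K k (?V k)
        \<le> (\<integral>\<^sup>+w. ennreal (?U 0 + C) * ?I k w \<partial>M)"
    proof (rule nn_integral_mono)
      fix w 
      show "?I k w * ?V k w \<le> ennreal (?U 0 + C) * ?I k w"
        using close[of "y + X (real k * d) w"] near[of w k] by (auto intro!: ennreal_leI split: split_indicator)
    qed
    also have "\<dots> = ennreal (?U 0 + C) * ?J k" by (rule nn_integral_cmult) measurable
    finally show ?thesis unfolding Yk Dk by (subst mult.left_commute) (rule mult_left_mono, simp_all)
  qed
  \<comment> \<open>The lower estimate has the error term on the larger side because subtraction in
    \<open>ennreal\<close> is truncated.\<close>
  have ge: "ennreal (?U 0) * ?K k ?D
      \<le> ?K k ?Y + ennreal C * ?K k ?D" for k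
  proof -
    have "ennreal (?U 0) * ?J k = (\<integral>\<^sup>+w. ennreal (?U 0) * ?I k w \<partial>M)"
      by (rule nn_integral_cmult[symmetric]) measurable
    also have "\<dots> \<le> (\<integral>\<^sup>+w. ?I k w * ?V k w + ennreal C * ?I k w \<partial>M)"
    proof (rule nn_integral_mono)
      fix w 
      show "ennreal (?U 0) * ?I k w \<le> ?I k w * ?V k w + ennreal C * ?I k w"
        using close[of "y + X (real k * d) w"] near[of w k] C U
        by (auto simp: ennreal_plus[symmetric] simp del: ennreal_plus intro!: ennreal_leI split: split_indicator)
    qed
    also have "\<dots> = ?K k (?V k) + ennreal C * ?J k"
    proof -
      note [measurable] = res_density_measurable[OF r]
      have [measurable]: "resolvent r f \<in> borel_measurable borel" unfolding resolvent_def by measurable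
      have "(\<integral>\<^sup>+w. ennreal C * ?I k w \<partial>M) = ennreal C * ?J k"
        by (rule nn_integral_cmult) measurable
      then show ?thesis by (subst nn_integral_add) auto
    qed
    finally have *: "ennreal (?U 0) * ?J k
      \<le> ?K k (?V k) + ennreal C * ?J k" .
    have "?e k * (ennreal (?U 0) * ?J k)
      \<le> ?e k * (?K k (?V k) + ennreal C * ?J k)"
      using * by (rule mult_left_mono) simp
    then show ?thesis unfolding Yk Dk by (simp add: distrib_left mult.left_commute)
  qed
  have Ysum: "(\<integral>\<^sup>+w. ?Y w \<partial>M) = (\<Sum>k. ?K k ?Y)"
    by (rule nn_integral_split_first_at[OF d]) (auto simp: stopped_future_def[of f r q y \<infinity>])
  have Dsum: "(\<integral>\<^sup>+w. ?D w \<partial>M) = (\<Sum>k. ?K k ?D)"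
    by (rule nn_integral_split_first_at[OF d]) (auto simp: discount_def)
  have le': "(\<integral>\<^sup>+w. ?Y w \<partial>M) \<le> ennreal (?U 0 + C) * (\<integral>\<^sup>+w. ?D w \<partial>M)"
    unfolding Ysum Dsum ennreal_suminf_cmult[symmetric] by (intro suminf_le le) auto
  have ge': "ennreal (?U 0) * (\<integral>\<^sup>+w. ?D w \<partial>M) \<le> (\<integral>\<^sup>+w. ?Y w \<partial>M) + ennreal C * (\<integral>\<^sup>+w. ?D w \<partial>M)"
    unfolding Ysum Dsum ennreal_suminf_cmult[symmetric]
    by (subst suminf_add; (intro suminf_le ge)?) auto
  define Yr where "Yr = (\<integral>w. stopped_future f r q y (?T w) w \<partial>M)"
  define Dr where "Dr = (\<integral>w. discount q (?T w) \<partial>M)"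
  have Yr: "(\<integral>\<^sup>+w. ?Y w \<partial>M) = ennreal Yr" unfolding Yr_def
    using stopped_future_bounds[OF _ T] by (intro nn_integral_eq_integral integrable_const_bound[where B="B / r"]) auto
  have Dr: "(\<integral>\<^sup>+w. ?D w \<partial>M) = ennreal Dr" unfolding Dr_def
    using discount_bounds[OF q T] by (intro nn_integral_eq_integral integrable_const_bound[where B=1]) auto
  have Dr01: "0 \<le> Dr" "Dr \<le> 1"
  proof -
    show "0 \<le> Dr" unfolding Dr_def using discount_bounds[OF q T] by (intro Bochner_Integration.integral_nonneg) auto
    have "ennreal Dr \<le> (\<integral>\<^sup>+w. 1 \<partial>M)" unfolding Dr[symmetric] using discount_bounds[OF q T] by (intro nn_integral_mono) (auto simp: ennreal_le_1)
    then show "Dr \<le> 1" by (simp add: emeasure_space_1 ennreal_le_1)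
  qed
  have Yr0: "0 \<le> Yr" unfolding Yr_def using stopped_future_bounds[OF _ T] by (intro Bochner_Integration.integral_nonneg_AE) auto
  have "Yr \<le> (?U 0 + C) * Dr"
    using le' U[of 0] C Dr01 unfolding Yr Dr by (simp add: ennreal_mult[symmetric] del: ennreal_plus)
  moreover have "?U 0 * Dr \<le> Yr + C * Dr"
    using ge' U[of 0] C Dr01 Yr0 unfolding Yr Dr by (simp add: ennreal_mult[symmetric] ennreal_plus[symmetric] del: ennreal_plus)
  ultimately have "\<bar>Yr - ?U 0 * Dr\<bar> \<le> C * Dr" by (simp add: abs_le_iff algebra_simps)
  also have "\<dots> \<le> C" using Dr01 C by (simp add: mult_left_le)
  finally show ?thesis unfolding Yr_def Dr_def .
qed

lemma stopped_expectations_tendsto: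
  fixes T :: "nat \<Rightarrow> 'w \<Rightarrow> ereal"
  assumes [measurable]: "\<And>n. T n \<in> borel_measurable M" "L \<in> borel_measurable M"
    and T: "\<And>n w. 0 \<le> T n w" "\<And>w. (\<lambda>n. T n w) \<longlonglongrightarrow> L w"
  shows "(\<lambda>n. (\<integral>w. stopped_future f r q y (T n w) w \<partial>M) - c * (\<integral>w. discount q (T n w) \<partial>M))
    \<longlonglongrightarrow> (\<integral>w. stopped_future f r q y (L w) w \<partial>M) - c * (\<integral>w. discount q (L w) \<partial>M)"
proof (intro tendsto_intros)
  have [measurable (raw)]: "(\<lambda>w. discount q (S w)) \<in> borel_measurable M" if [measurable]: "S \<in> borel_measurable M" for S
    unfolding discount_def by measurable
  show "(\<lambda>n. \<integral>w. stopped_future f r q y (T n w) w \<partial>M) \<longlonglongrightarrow> (\<integral>w. stopped_future f r q y (L w) w \<partial>M)"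
  proof (rule integral_dominated_convergence[where w="\<lambda>_. B / r"])
    show "AE w in M. (\<lambda>n. stopped_future f r q y (T n w) w) \<longlonglongrightarrow> stopped_future f r q y (L w) w"
      by (intro AE_I2 stopped_future_tendsto T)
    show "AE w in M. norm (stopped_future f r q y (T n w) w) \<le> B / r" for n
      using stopped_future_bounds[OF _ T(1)] by (intro AE_I2) auto
  qed auto
  show "(\<lambda>n. \<integral>w. discount q (T n w) \<partial>M) \<longlonglongrightarrow> (\<integral>w. discount q (L w) \<partial>M)"
  proof (rule integral_dominated_convergence[where w="\<lambda>_. 1"])
    show "AE w in M. (\<lambda>n. discount q (T n w)) \<longlonglongrightarrow> discount q (L w)"
      by (intro AE_I2 discount_tendsto T q)
    show "AE w in M. norm (discount q (T n w)) \<le> 1" for n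
      using discount_bounds[OF q T(1)] by (intro AE_I2) auto
  qed auto
qed

lemma strong_markov_ball:
  assumes C: "C \<ge> 0"
    and close: "\<And>z. \<bar>z\<bar> < inverse (real (Suc m)) \<Longrightarrow> \<bar>resolvent r f z - resolvent r f 0\<bar> \<le> C"
  shows "\<bar>(\<integral>w. stopped_future f r q y (ball_hit y m w) w \<partial>M) - resolvent r f 0 * (\<integral>w. discount q (ball_hit y m w) \<partial>M)\<bar> \<le> C"
proof -
  let ?E = "\<lambda>S. \<bar>(\<integral>w. stopped_future f r q y (S w) w \<partial>M) - resolvent r f 0 * (\<integral>w. discount q (S w) \<partial>M)\<bar>"
  let ?g = "\<lambda>n. grid_hit y (inverse (real (Suc m))) ((1/2) ^ n)"
  show ?thesis
  proof (rule tendsto_upperbound)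
    show "(\<lambda>n. ?E (?g n)) \<longlonglongrightarrow> ?E (ball_hit y m)"
      by (intro tendsto_rabs stopped_expectations_tendsto grid_hit_tendsto grid_hit_nonneg) auto
    show "\<forall>\<^sub>F n in sequentially. ?E (?g n) \<le> C"
      by (intro always_eventually allI strong_markov_grid C close) auto
  qed simp
qed

text \<open>The resolvent density is bounded and continuous, so a multiple of the integrable
  \<open>f\<close> dominates its translates.\<close>

lemma resolvent_close_at_0:
  assumes int: "integrable lborel f" and e: "e > 0"
  shows "\<exists>d>0. \<forall>z. \<bar>z\<bar> < d \<longrightarrow> \<bar>resolvent r f z - resolvent r f 0\<bar> < e"
proof -
  obtain K where K: "\<And>v. \<bar>res_density r v\<bar> \<le> K"
    using fourier_inv_bound[OF integrable_resolvent[OF r]] unfolding res_density_def by blast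
  note [measurable] = res_density_measurable[OF r]
  have "isCont (resolvent r f) 0"
    unfolding continuous_at_sequentially
  proof (intro allI impI)
    fix s :: "nat \<Rightarrow> real" assume s: "s \<longlonglongrightarrow> 0"
    have "(\<lambda>n. \<integral>v. f v * res_density r (v - s n) \<partial>lborel) \<longlonglongrightarrow> (LBINT v. f v * res_density r (v - 0))"
    proof (rule integral_dominated_convergence[where w="\<lambda>v. K * f v"])
      show "integrable lborel (\<lambda>v. K * f v)" using int by simp
      show "AE v in lborel. norm (f v * res_density r (v - s n)) \<le> K * f v" for n
        using K f_nonneg by (auto simp: abs_mult mult.commute[of K] intro!: AE_I2 mult_left_mono)
      show "AE v in lborel. (\<lambda>n. f v * res_density r (v - s n)) \<longlonglongrightarrow> f v * res_density r (v - 0)"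
        by (intro AE_I2 tendsto_intros s continuous_on_tendsto_compose[OF continuous_res_density[OF r]]) auto
    qed auto
    then show "(resolvent r f \<circ> s) \<longlonglongrightarrow> resolvent r f 0" by (simp add: comp_def resolvent_def)
  qed
  then show ?thesis using e unfolding continuous_at_eps_delta by (auto simp: dist_real_def)
qed

text \<open>The positions at the entrance times lie in shrinking intervals, so by continuity of the
  resolvent at 0 the error is eventually below any given C.\<close>

lemma strong_markov_approach:
  assumes int: "integrable lborel f"
  shows "(\<integral>w. stopped_future f r q y (approach_time y w) w \<partial>M) = resolvent r f 0 * (\<integral>w. discount q (approach_time y w) \<partial>M)"
proof -
  let ?E = "\<lambda>S. \<bar>(\<integral>w. stopped_future f r q y (S w) w \<partial>M) - resolvent r f 0 * (\<integral>w. discount q (S w) \<partial>M)\<bar>"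
  let ?D = "?E (approach_time y)"
  have "?D \<le> 0 + C" if C: "C > 0" for C
  proof (rule tendsto_upperbound)
    show "(\<lambda>m. ?E (ball_hit y m)) \<longlonglongrightarrow> ?D"
      by (intro tendsto_rabs stopped_expectations_tendsto ball_hit_tendsto ball_hit_nonneg) auto
    obtain d where d: "d > 0" "\<And>z. \<bar>z\<bar> < d \<Longrightarrow> \<bar>resolvent r f z - resolvent r f 0\<bar> < C"
      using resolvent_close_at_0[OF int C] by blast
    have "\<forall>\<^sub>F m in sequentially. inverse (real (Suc m)) < d"
      using LIMSEQ_inverse_real_of_nat d(1) by (rule order_tendstoD(2))
    then show "\<forall>\<^sub>F m in sequentially. ?E (ball_hit y m) \<le> 0 + C"
    proof eventually_elim
      case (elim m)
      have "\<bar>resolvent r f z - resolvent r f 0\<bar> \<le> C" if "\<bar>z\<bar> < inverse (real (Suc m))" for z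
        using d(2)[of z] that elim by simp
      then have "?E (ball_hit y m) \<le> C"
        by (rule strong_markov_ball[OF less_imp_le[OF C]])
      then show ?case by simp
    qed
  qed simp
  then have "?D \<le> 0" by (rule field_le_epsilon)
  then show ?thesis by simp
qed

end

end

section \<open>The killed potential\<close>

text \<open>The set \<open>B\<close> may fail to be measurable, but it differs from \<open>A\<close>
  only inside a null set, all of whose subsets the completion measures. It is meant for events
  defined through \<open>hit_zero\<close>.\<close>

lemma emeasure_completion_eq_AE:
  assumes A: "A \<in> sets M" and B: "B \<subseteq> space M" and ae: "AE x in M. x \<in> A \<longleftrightarrow> x \<in> B"
  shows "emeasure (completion M) B = emeasure M A"
proof -
  obtain N where N: "N \<in> null_sets M" "\<And>x. x \<in> space M - N \<Longrightarrow> x \<in> A \<longleftrightarrow> x \<in> B"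
    using AE_E3[OF ae] by blast
  have "B = (A - N) \<union> (B \<inter> N)"
    using N(2) B sets.sets_into_space[OF A] by auto
  moreover have "A - N \<in> sets (completion M)" using A N(1) by auto
  moreover have "B \<inter> N \<in> sets (completion M)"
    by (intro null_setsD2 null_sets_completion_subset[OF _ null_sets_completionI[OF N(1)]]) auto
  ultimately have sB: "B \<in> sets (completion M)" by (metis sets.Un)
  have "emeasure (completion M) B = emeasure (completion M) A"
    using sB A AE_completion[OF ae] by (intro emeasure_eq_AE) (auto elim: eventually_mono)
  also have "\<dots> = emeasure M A"
    using A by (simp add: emeasure_completion main_part_sets)
  finally show ?thesis .
qed

section \<open>Laplace transform of the approach time\<close>

context stable_motion
begin

text \<open>For a narrow interval around zero the resolvent is nearly its length times the density.
  This extracts pointwise values of \<open>res_density\<close> from the strong Markov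
  identity.\<close>

lemma resolvent_indicator_approx:
  assumes r: "r > 0" and d: "d > 0" and close: "\<And>y. \<bar>y\<bar> \<le> d \<Longrightarrow> \<bar>res_density r (y - z) - v\<bar> \<le> \<eta>"
  shows "\<bar>resolvent r (indicator {-d..d}) z - 2 * d * v\<bar> \<le> 2 * d * \<eta>"
proof -
  have cont: "continuous_on {-d..d} (\<lambda>y. res_density r (y - z))"
    by (intro continuous_on_compose2[OF continuous_res_density[OF r]] continuous_intros) auto
  have i1: "integrable lborel (\<lambda>y. indicator {-d..d} y *\<^sub>R res_density r (y - z))"
    using borel_integrable_atLeastAtMost'[OF cont] by (simp add: set_integrable_def)
  have i2: "integrable lborel (\<lambda>y. indicator {-d..d} y *\<^sub>R c)" for c :: real
    by (simp only: integrable_scaleR_left lborel_integrable_indicator_Icc)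
  have c: "(LBINT y. indicator {-d..d} y *\<^sub>R c) = 2 * d * c" for c :: real
    using d by simp
  have "resolvent r (indicator {-d..d}) z - 2 * d * v = (LBINT y. indicator {-d..d} y *\<^sub>R res_density r (y - z)) - (LBINT y. indicator {-d..d} y *\<^sub>R v)"
    unfolding c by (simp add: resolvent_def)
  also have "\<dots> = (LBINT y. indicator {-d..d} y *\<^sub>R res_density r (y - z) - indicator {-d..d} y *\<^sub>R v)"
    by (rule Bochner_Integration.integral_diff[OF i1 i2, symmetric])
  finally have eq: "resolvent r (indicator {-d..d}) z - 2 * d * v = (LBINT y. indicator {-d..d} y *\<^sub>R res_density r (y - z) - indicator {-d..d} y *\<^sub>R v)" .
  have "\<bar>resolvent r (indicator {-d..d}) z - 2 * d * v\<bar> \<le> (LBINT y. indicator {-d..d} y *\<^sub>R \<eta>)"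
    unfolding eq
  proof (rule order_trans[OF integral_abs_bound], rule integral_mono)
    show "integrable lborel (\<lambda>y. \<bar>indicator {-d..d} y *\<^sub>R res_density r (y - z) - indicator {-d..d} y *\<^sub>R v\<bar>)"
      by (intro integrable_abs Bochner_Integration.integrable_diff i1 i2)
    show "\<bar>indicator {-d..d} y *\<^sub>R res_density r (y - z) - indicator {-d..d} y *\<^sub>R v\<bar> \<le> indicator {-d..d} y *\<^sub>R \<eta>" for y
      using close[of y] by (auto split: split_indicator)
  qed (rule i2)
  then show ?thesis unfolding c .
qed

lemma not_near_before_ball_hit:
  assumes w: "w \<in> space M" and t: "0 \<le> t" "ereal t < ball_hit y m w"
  shows "inverse (real (Suc m)) \<le> \<bar>y + X t w\<bar>"
  using ball_hit_le[OF w t(1), of y m] t(2) by (meson leD not_le)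

text \<open>Before it enters the larger interval the path avoids [-d, d], so starting the integral
  at the entrance time instead of 0 loses nothing. Both rates are q, so the two discounts
  combine.\<close>

lemma stopped_future_ball:
  assumes w: "w \<in> space M" and d: "0 < d" "d < inverse (real (Suc m))" and q: "q > 0"
  shows "stopped_future (indicator {-d..d}) q q y (ball_hit y m w) w = future y q (indicator {-d..d}) 0 w"
proof -
  let ?g = "\<lambda>t. exp (- q * t) * indicator {-d..d} (y + X (max 0 t) w) :: real"
  let ?f = "indicator {-d..d} :: real \<Rightarrow> real"
  have f: "?f \<in> borel_measurable borel" "\<And>v. 0 \<le> ?f v" "\<And>v. ?f v \<le> 1" by (auto split: split_indicator)
  note tail = future_eq_tail[OF f q q]
  have far: "?f (y + X t w) = 0" if "0 \<le> t" "ereal t < ball_hit y m w" for t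
    using not_near_before_ball_hit[OF w that] d by (auto simp: abs_le_iff split: split_indicator)
  consider "ball_hit y m w = \<infinity>" | T where "ball_hit y m w = ereal T" "0 \<le> T"
    using ball_hit_nonneg[of y m w] by (cases "ball_hit y m w") auto
  then show ?thesis
  proof cases
    case 1
    have "future y q ?f 0 w = (\<integral>h. 0 \<partial>(lborel :: real measure))"
      unfolding future_def using far 1 by (intro Bochner_Integration.integral_cong) (auto simp: indicator_def)
    then show ?thesis using 1 by (simp add: stopped_future_def)
  next
    case 2
    have [measurable]: "(\<lambda>h. w) \<in> measurable lborel M" using w by simp
    have "(LBINT t. indicator {T<..} t * ?g t)
        = (LBINT t. indicator {0<..} t * ?g t)"
    proof (rule integral_cong_AE)
      show "AE t in lborel. indicator {T<..} t * ?g t = indicator {0<..} t * ?g t"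
        using AE_lborel_singleton[of T]
      proof eventually_elim
        case (elim t)
        consider "t \<le> 0" | "0 < t" "t < T" | "T < t" using elim by linarith
        then show ?case
          using 2 far[of t] by cases auto
      qed
    qed measurable
    then show ?thesis using 2 by (simp add: stopped_future_def tail exp_minus)
  qed
qed

text \<open>The strong Markov identity for \<open>indicator {-d..d} / (2 * d)\<close>, as \<open>d\<close> tends to zero.\<close>
lemma laplace_approach_time:
  assumes q: "q > 0"
  shows "(\<integral>w. discount q (approach_time x w) \<partial>M) = res_density q (- x) / res_density q 0"
proof -
  let ?u = "res_density q"
  let ?D = "\<lambda>m. \<integral>w. discount q (ball_hit x m w) \<partial>M"
  have [measurable (raw)]: "(\<lambda>w. discount q (S w)) \<in> borel_measurable M" if [measurable]: "S \<in> borel_measurable M" for S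
    unfolding discount_def by measurable
  have "?D \<longlonglongrightarrow> (\<integral>w. discount q (approach_time x w) \<partial>M)"
  proof (rule integral_dominated_convergence[where w="\<lambda>_. 1"])
    show "AE w in M. (\<lambda>n. discount q (ball_hit x n w)) \<longlonglongrightarrow> discount q (approach_time x w)"
      by (intro AE_I2 discount_tendsto ball_hit_tendsto ball_hit_nonneg q)
    show "AE w in M. norm (discount q (ball_hit x n w)) \<le> 1" for n
      using discount_bounds[OF q ball_hit_nonneg] by (intro AE_I2) auto
  qed auto
  then have lim1: "(\<lambda>m. ?u 0 * ?D m) \<longlonglongrightarrow> ?u 0 * (\<integral>w. discount q (approach_time x w) \<partial>M)"
    by (intro tendsto_intros)
  have D: "0 \<le> ?D m" "?D m \<le> 1" for m
  proof -
    note b = discount_bounds[OF q ball_hit_nonneg]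
    show "0 \<le> ?D m" using b by (intro Bochner_Integration.integral_nonneg) auto
    have "?D m \<le> (\<integral>w. 1 \<partial>M)" using b by (intro integral_mono integrable_const_bound[where B=1]) auto
    then show "?D m \<le> 1" by (simp add: prob_space)
  qed
  have lim2: "(\<lambda>m. ?u 0 * ?D m) \<longlonglongrightarrow> ?u (- x)"
  proof (rule tendstoI)
    fix \<epsilon> :: real assume "\<epsilon> > 0"
    define \<eta> where "\<eta> = \<epsilon> / 8"
    have \<eta>: "\<eta> > 0" using \<open>\<epsilon> > 0\<close> by (simp add: \<eta>_def)
    have "isCont (?u) v" for v
      using continuous_res_density[OF q] by (simp add: continuous_on_eq_continuous_at)
    then have cont: "\<exists>d>0. \<forall>w. dist w v < d \<longrightarrow> dist (?u w) (?u v) < \<eta>" for v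
      using \<eta> unfolding continuous_at_eps_delta by auto
    obtain d0 where d0: "d0 > 0" "\<And>w. \<bar>w\<bar> < d0 \<Longrightarrow> \<bar>?u w - ?u 0\<bar> < \<eta>"
      using cont[of 0] by (auto simp: dist_real_def)
    obtain d1 where d1: "d1 > 0" "\<And>w. \<bar>w + x\<bar> < d1 \<Longrightarrow> \<bar>?u w - ?u (- x)\<bar> < \<eta>"
      using cont[of "- x"] by (auto simp: dist_real_def)
    have "\<forall>\<^sub>F m in sequentially. inverse (real (Suc m)) < min (d0 / 2) d1"
      using LIMSEQ_inverse_real_of_nat d0(1) d1(1) by (intro order_tendstoD(2)) auto
    then show "\<forall>\<^sub>F m in sequentially. dist (?u 0 * ?D m) (?u (- x)) < \<epsilon>"
    proof eventually_elim
      case (elim m)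
      \<comment> \<open>Half the radius: [-d, d] has to lie strictly inside the interval for
        \<open>stopped_future_ball\<close>, and d still tends to zero with the radius.\<close>
      define d where "d = inverse (real (Suc m)) / 2"
      have d: "0 < d" "d < inverse (real (Suc m))" "2 * d < d0 / 2" "2 * d < d1" using elim by (auto simp: d_def)
      let ?f = "indicator {-d..d} :: real \<Rightarrow> real"
      have f: "?f \<in> borel_measurable borel" "\<And>v. 0 \<le> ?f v" "\<And>v. ?f v \<le> 1" by (auto split: split_indicator)
      let ?U = "resolvent q ?f"
      have Uz: "\<bar>?U z - 2 * d * ?u 0\<bar> \<le> 2 * d * \<eta>" if "\<bar>z\<bar> < inverse (real (Suc m))" for z
      proof (rule resolvent_indicator_approx[OF q d(1)])
        fix y assume "\<bar>y\<bar> \<le> d"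
        then have "\<bar>y - z\<bar> < d0" using that d by (simp add: d_def)
        then show "\<bar>?u (y - z) - ?u 0\<bar> \<le> \<eta>" using d0(2) by (simp add: less_imp_le)
      qed
      have U0: "\<bar>?U 0 - 2 * d * ?u 0\<bar> \<le> 2 * d * \<eta>" by (rule Uz) simp
      have Ux: "\<bar>?U x - 2 * d * ?u (- x)\<bar> \<le> 2 * d * \<eta>"
      proof (rule resolvent_indicator_approx[OF q d(1)])
        fix y assume "\<bar>y\<bar> \<le> d"
        then have "\<bar>(y - x) + x\<bar> < d1" using d by simp
        then show "\<bar>?u (y - x) - ?u (- x)\<bar> \<le> \<eta>" using d1(2) by (simp add: less_imp_le)
      qed
      \<comment> \<open>Both \<open>?U z\<close> and \<open>?U 0\<close> are within
        \<open>2 * d * \<eta>\<close> of \<open>2 * d * ?u 0\<close>, whence 4.\<close>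
      have "\<bar>(\<integral>w. stopped_future ?f q q x (ball_hit x m w) w \<partial>M) - ?U 0 * ?D m\<bar> \<le> 4 * d * \<eta>"
      proof (rule strong_markov_ball[OF f q q])
        show "0 \<le> 4 * d * \<eta>" using d \<eta> by simp
        show "\<bar>?U z - ?U 0\<bar> \<le> 4 * d * \<eta>" if "\<bar>z\<bar> < inverse (real (Suc m))" for z
          using Uz[OF that] U0 by linarith
      qed
      also have "(\<integral>w. stopped_future ?f q q x (ball_hit x m w) w \<partial>M) = ?U x"
        unfolding resolvent_eq_expectation[OF f q]
        by (intro Bochner_Integration.integral_cong stopped_future_ball d q) auto
      finally have S: "\<bar>?U x - ?U 0 * ?D m\<bar> \<le> 4 * d * \<eta>" .
      have "\<bar>?U 0 * ?D m - 2 * d * ?u 0 * ?D m\<bar> = \<bar>?U 0 - 2 * d * ?u 0\<bar> * ?D m"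
        using D[of m] by (simp add: left_diff_distrib[symmetric] abs_mult)
      also have "\<dots> \<le> (2 * d * \<eta>) * 1" using D[of m] U0 d \<eta> by (intro mult_mono) auto
      finally have "\<bar>?U 0 * ?D m - 2 * d * ?u 0 * ?D m\<bar> \<le> 2 * d * \<eta>" by simp
      \<comment> \<open>The errors 4, 2 and 2 times \<open>d * \<eta>\<close> add up. After division
        by \<open>2 * d\<close> this leaves \<open>4 * \<eta>\<close>, half of \<epsilon>, however
        small d is.\<close>
      then have "\<bar>2 * d * ?u 0 * ?D m - 2 * d * ?u (- x)\<bar> \<le> 2 * d * (4 * \<eta>)"
        using S Ux by linarith
      also have "2 * d * ?u 0 * ?D m - 2 * d * ?u (- x) = 2 * d * (?u 0 * ?D m - ?u (- x))"
        by (simp add: algebra_simps)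
      finally have "\<bar>?u 0 * ?D m - ?u (- x)\<bar> \<le> 4 * \<eta>" using d(1) by (simp add: abs_mult)
      then show ?case using \<open>\<epsilon> > 0\<close> by (simp add: dist_real_def \<eta>_def)
    qed
  qed
  show ?thesis
    using LIMSEQ_unique[OF lim1 lim2] res_density_0_pos_bound(1)[OF q] by (simp add: field_simps)
qed

section \<open>The approach time is the hitting time\<close>

lemma scaled_future_tendsto:
  assumes w: "w \<in> space M" and T: "0 \<le> T" and cont: "continuous_on UNIV f"
    and f: "\<And>v. 0 \<le> f v" "\<And>v. f v \<le> B"
  shows "(\<lambda>n. real (Suc n) * future y (real (Suc n)) f T w) \<longlonglongrightarrow> f (y + X T w)"
proof -
  have [measurable]: "f \<in> borel_measurable borel" by (rule borel_measurable_continuous_onI[OF cont])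
  have [measurable]: "(\<lambda>h. w) \<in> measurable lborel M" using w by simp
  \<comment> \<open>The integrand after the substitution \<open>v = Suc n * h\<close>: the weight
    becomes the fixed density \<open>exp (- v)\<close>, while the time \<open>T + v / Suc n\<close>
    decreases to T, where right continuity applies.\<close>
  let ?s = "\<lambda>n v. indicator {0<..} v * (exp (- 1 * v) * f (y + X (max 0 (T + v / real (Suc n))) w))"
  \<comment> \<open>The lemma carries the hypotheses of its context on \<open>f\<close> and
    \<open>B\<close>; zero satisfies them.\<close>
  have e: "has_bochner_integral lborel (\<lambda>t. indicator {0<..} t * exp (- 1 * t)) (1 / 1 :: real)"
    by (rule has_integral_exp_half_line[where f="\<lambda>_. 0" and B=0]) auto
  have eq: "real (Suc n) * future y (real (Suc n)) f T w = (LBINT v. ?s n v)" for n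
  proof -
    have "(LBINT v. ?s n v) = \<bar>real (Suc n)\<bar> *\<^sub>R (LBINT h. ?s n (0 + real (Suc n) * h))"
      by (rule lborel_integral_real_affine) simp
    also have "(LBINT h. ?s n (0 + real (Suc n) * h)) = future y (real (Suc n)) f T w"
      unfolding future_def
      by (intro Bochner_Integration.integral_cong) (auto simp: zero_less_mult_iff simp del: of_nat_Suc split: split_indicator)
    finally show ?thesis by simp
  qed
  have "(\<lambda>n. \<integral>v. ?s n v \<partial>lborel) \<longlonglongrightarrow> (LBINT v. f (y + X T w) * (indicator {0<..} v * exp (- 1 * v)))"
  proof (rule integral_dominated_convergence[where w="\<lambda>v. B * (indicator {0<..} v * exp (- 1 * v))"])
    show "integrable lborel (\<lambda>v. B * (indicator {0<..} v * exp (- 1 * v)))"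
      using e by (intro integrable_mult_right) (auto simp: has_bochner_integral_iff)
    show "AE v in lborel. norm (?s n v) \<le> B * (indicator {0<..} v * exp (- 1 * v))" for n
      using f by (auto intro!: AE_I2 simp: abs_mult mult.commute[of B] split: split_indicator)
    show "AE v in lborel. (\<lambda>n. ?s n v) \<longlonglongrightarrow> f (y + X T w) * (indicator {0<..} v * exp (- 1 * v))"
    proof (rule AE_I2)
      fix v :: real
      show "(\<lambda>n. ?s n v) \<longlonglongrightarrow> f (y + X T w) * (indicator {0<..} v * exp (- 1 * v))"
      proof (cases "v > 0")
        case True
        have "(\<lambda>n. T + v * inverse (real (Suc n))) \<longlonglongrightarrow> T + v * 0"
          by (intro tendsto_intros LIMSEQ_inverse_real_of_nat)
        then have "filterlim (\<lambda>n. T + v / real (Suc n)) (at_right T) sequentially"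
          using True by (auto simp: filterlim_at divide_inverse intro!: always_eventually)
        then have "(\<lambda>n. X (T + v / real (Suc n)) w) \<longlonglongrightarrow> X T w"
          by (rule filterlim_compose[OF X_right_continuous[OF w T]])
        moreover have "max 0 (T + v / real (Suc n)) = T + v / real (Suc n)" for n using T True by simp
        ultimately have "(\<lambda>n. f (y + X (max 0 (T + v / real (Suc n))) w)) \<longlonglongrightarrow> f (y + X T w)"
          by (intro continuous_on_tendsto_compose[OF cont] tendsto_intros) auto
        then have "(\<lambda>n. exp (- 1 * v) * f (y + X (max 0 (T + v / real (Suc n))) w)) \<longlonglongrightarrow> exp (- 1 * v) * f (y + X T w)"
          by (intro tendsto_intros)
        then show ?thesis using True by (simp add: mult.commute)
      qed simp
    qed
  qed measurable
  then show ?thesis using e unfolding eq by (simp add: has_bochner_integral_iff)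
qed

text \<open>Quasi-left-continuity at the approach time: let \<open>r\<close> tend to infinity in the strong Markov identity,
for a function \<open>f\<close> that vanishes only at zero.\<close>
lemma approach_time_hits:
  "AE w in M. approach_time x w = \<infinity> \<or> x + X (real_of_ereal (approach_time x w)) w = 0"
proof -
  \<comment> \<open>Besides vanishing only at zero, this function is continuous, bounded by 1 and
    integrable, as the strong Markov identity and the limit of \<open>scaled_future_tendsto\<close>
    require.\<close>
  define f :: "real \<Rightarrow> real" where "f v = \<bar>v\<bar> * exp (- \<bar>v\<bar>)" for v
  have cont: "continuous_on UNIV f" unfolding f_def by (intro continuous_intros)
  have f: "f \<in> borel_measurable borel" "\<And>v. 0 \<le> f v" "\<And>v. f v \<le> 1"
  proof -
    show "f \<in> borel_measurable borel" by (rule borel_measurable_continuous_onI[OF cont])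
    show "0 \<le> f v" for v by (simp add: f_def)
    show "f v \<le> 1" for v
    proof -
      have "\<bar>v\<bar> \<le> exp \<bar>v\<bar>" using exp_ge_add_one_self[of "\<bar>v\<bar>"] by linarith
      then show ?thesis by (simp add: f_def exp_minus field_simps)
    qed
  qed
  note [measurable] = f(1)
  have int: "integrable lborel f"
  proof -
    have "has_bochner_integral lborel (\<lambda>t. indicator {0<..} t * (t powr (2 - 1) * exp (- 1 * t))) (Gamma 2 / 1 powr 2 :: real)"
      by (rule has_integral_Gamma_scaled) auto
    then have "integrable lborel (\<lambda>t. indicator {0<..} t *\<^sub>R f t)"
      unfolding has_bochner_integral_iff by (elim conjE, subst (asm) Bochner_Integration.integrable_cong[OF refl])
        (auto simp: f_def split: split_indicator)
    then show ?thesis by (rule integrable_even_extension(1)) (use \<open>integrable lborel (\<lambda>t. indicator {0<..} t *\<^sub>R f t)\<close> in \<open>auto simp: f_def\<close>)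
  qed
  let ?T = "approach_time x"
  let ?R = "\<lambda>n. real (Suc n)"
  let ?Z = "\<lambda>w. at_time (\<lambda>t. exp (- 1 * t) * f (x + X (max 0 t) w)) (?T w)"
  have R: "?R n > 0" for n by simp
  have [measurable]: "?Z \<in> borel_measurable M" by measurable
  have Sm[measurable]: "(\<lambda>w. stopped_future f (?R n) 1 x (?T w) w) \<in> borel_measurable M" for n
    by (rule stopped_future_measurable[OF f R zero_less_one]) measurable
  have lim1: "(\<lambda>n. \<integral>w. ?R n * stopped_future f (?R n) 1 x (?T w) w \<partial>M) \<longlonglongrightarrow> (\<integral>w. ?Z w \<partial>M)"
  proof (rule integral_dominated_convergence[where w="\<lambda>_. 1"])
    show "AE w in M. norm (?R n * stopped_future f (?R n) 1 x (?T w) w) \<le> 1" for n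
    proof (rule AE_I2)
      fix w assume w: "w \<in> space M"
      note b = stopped_future_bounds[OF f R[of n] zero_less_one w approach_time_nonneg[of x w], of x]
      have "?R n * stopped_future f (?R n) 1 x (?T w) w \<le> 1"
        using b(2) R[of n] by (simp add: pos_le_divide_eq mult.commute del: of_nat_Suc)
      then show "norm (?R n * stopped_future f (?R n) 1 x (?T w) w) \<le> 1" using b(1) by (simp add: abs_mult)
    qed
    show "AE w in M. (\<lambda>n. ?R n * stopped_future f (?R n) 1 x (?T w) w) \<longlonglongrightarrow> ?Z w"
    proof (rule AE_I2)
      fix w assume w: "w \<in> space M"
      consider "?T w = \<infinity>" | t where "?T w = ereal t" "0 \<le> t"
        using approach_time_nonneg[of x w] by (cases "?T w") auto
      then show "(\<lambda>n. ?R n * stopped_future f (?R n) 1 x (?T w) w) \<longlonglongrightarrow> ?Z w"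
      proof cases
        case 2
        have "(\<lambda>n. exp (- 1 * t) * (?R n * future x (?R n) f t w)) \<longlonglongrightarrow> exp (- 1 * t) * f (x + X t w)"
          by (intro tendsto_mult tendsto_const scaled_future_tendsto[where B=1] w 2 cont f)
        then show ?thesis using 2 by (simp add: stopped_future_def mult.left_commute)
      qed (simp add: stopped_future_def)
    qed
    show "(\<lambda>w. ?R n * stopped_future f (?R n) 1 x (?T w) w) \<in> borel_measurable M" for n
      by (intro borel_measurable_times borel_measurable_const Sm)
  qed auto
  \<comment> \<open>For the process started at zero, the scaled resolvent tends to
    \<open>f 0 = 0\<close>. The right side of the strong Markov identity therefore vanishes in the
    limit, and with it the expectation of the nonnegative \<open>?Z\<close>.\<close>
  have lim2: "(\<lambda>n. ?R n * resolvent (?R n) f 0) \<longlonglongrightarrow> 0"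
  proof -
    have "(\<lambda>n. \<integral>w. ?R n * future 0 (?R n) f 0 w \<partial>M) \<longlonglongrightarrow> (\<integral>w. 0 \<partial>M)"
    proof (rule integral_dominated_convergence[where w="\<lambda>_. 1"])
      show "AE w in M. (\<lambda>n. ?R n * future 0 (?R n) f 0 w) \<longlonglongrightarrow> 0"
      proof (rule AE_I2)
        fix w assume w: "w \<in> space M"
        have "f (0 + X 0 w) = 0" using w by (simp add: X_0 f_def)
        then show "(\<lambda>n. ?R n * future 0 (?R n) f 0 w) \<longlonglongrightarrow> 0"
          using scaled_future_tendsto[OF w order_refl cont f(2,3), of 0] by simp
      qed
      show "AE w in M. norm (?R n * future 0 (?R n) f 0 w) \<le> 1" for n
      proof (rule AE_I2)
        fix w assume w: "w \<in> space M"
        have "?R n * future 0 (?R n) f 0 w \<le> 1"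
          using future_le[OF f R[of n] w, of 0 0] R[of n] by (simp add: pos_le_divide_eq mult.commute del: of_nat_Suc)
        then show "norm (?R n * future 0 (?R n) f 0 w) \<le> 1"
          using future_nonneg[OF f R[of n], of 0 0 w] by (simp add: abs_mult)
      qed
      show "(\<lambda>w. ?R n * future 0 (?R n) f 0 w) \<in> borel_measurable M" for n
        by (intro borel_measurable_times borel_measurable_const future_measurable[OF f R]) 
    qed auto
    then show ?thesis by (simp add: resolvent_eq_expectation[OF f R] del: of_nat_Suc)
  qed
  have "(\<lambda>n. \<integral>w. ?R n * stopped_future f (?R n) 1 x (?T w) w \<partial>M) = (\<lambda>n. ?R n * resolvent (?R n) f 0 * (\<integral>w. discount 1 (?T w) \<partial>M))"
    using strong_markov_approach[OF f R zero_less_one int] by (simp add: mult.assoc)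
  moreover have "(\<lambda>n. ?R n * resolvent (?R n) f 0 * (\<integral>w. discount 1 (?T w) \<partial>M)) \<longlonglongrightarrow> 0 * (\<integral>w. discount 1 (?T w) \<partial>M)"
    by (intro tendsto_mult tendsto_const lim2)
  ultimately have "(\<integral>w. ?Z w \<partial>M) = 0" using LIMSEQ_unique[OF lim1] by simp
  moreover have Z0: "0 \<le> ?Z w" for w using f(2) by (simp add: at_time_def)
  moreover have "integrable M ?Z"
  proof (rule integrable_const_bound[where B=1])
    show "AE w in M. norm (?Z w) \<le> 1"
    proof (rule AE_I2)
      fix w
      show "norm (?Z w) \<le> 1"
      proof (cases "?T w")
        case (real t)
        then have "exp (- 1 * t) * f (x + X (max 0 t) w) \<le> 1 * 1"
          using approach_time_nonneg[of x w] f by (intro mult_mono) auto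
        then show ?thesis using real f(2) by (simp add: abs_mult)
      qed (use approach_time_nonneg[of x w] in auto)
    qed
  qed measurable
  ultimately have "AE w in M. ?Z w = 0" by (subst (asm) integral_nonneg_eq_0_iff_AE) auto
  then show ?thesis
  proof (rule eventually_mono)
    fix w assume Z: "?Z w = 0"
    show "?T w = \<infinity> \<or> x + X (real_of_ereal (?T w)) w = 0"
    proof (cases "?T w")
      case (real t)
      then have "0 \<le> t" using approach_time_nonneg[of x w] by simp
      then show ?thesis using Z real by (simp add: f_def)
    qed (use approach_time_nonneg[of x w] in auto)
  qed
qed

text \<open>A path at zero is inside every interval, so the approach time never exceeds the hitting
  time. Conversely, the path is almost surely at zero at a finite approach time.\<close>

lemma hit_zero_eq_approach_time:
  assumes x: "x \<noteq> 0"
  shows "AE w in M. hit_zero X x w = approach_time x w"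
proof -
  have "AE w in M. w \<in> space M" by simp
  with approach_time_hits[of x] show ?thesis
  proof eventually_elim
    case (elim w)
    show ?case
    proof (rule antisym)
      show "approach_time x w \<le> hit_zero X x w"
        unfolding hit_zero_def approach_time_def
      proof (intro INF_greatest SUP_least)
        fix t m assume "t \<in> {t. t > 0 \<and> x + X t w = 0}"
        then show "ball_hit x m w \<le> ereal t" using elim(2) by (intro ball_hit_le) auto
      qed
      show "hit_zero X x w \<le> approach_time x w"
      proof (cases "approach_time x w")
        case (real t)
        then have t: "0 \<le> t" "x + X t w = 0" using elim(1) approach_time_nonneg[of x w] by auto
        \<comment> \<open>\<open>hit_zero\<close> counts only strictly positive times; a start away
          from zero excludes time 0.\<close>
        then have "t \<noteq> 0" using x X_0[OF elim(2)] by auto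
        then show ?thesis unfolding hit_zero_def real using t by (intro INF_lower) auto
      qed (use approach_time_nonneg[of x w] in auto)
    qed
  qed
qed

section \<open>Killed path integrals and the occupation measure\<close>

definition killed_future :: "real \<Rightarrow> real \<Rightarrow> (real \<Rightarrow> real) \<Rightarrow> 'w \<Rightarrow> real" where
  "killed_future x q f w = (LBINT t. indicator {0<..} t * (of_bool (ereal t < approach_time x w) * (exp (- q * t) * f (x + X (max 0 t) w))))"

text \<open>The integral up to the approach time is the whole integral minus its tail, and the tail
  is \<open>stopped_future\<close> with both rates equal to q.\<close>

lemma killed_future:
  assumes f: "f \<in> borel_measurable borel" "\<And>v. 0 \<le> f v" "\<And>v. f v \<le> B" and q: "q > 0" and w: "w \<in> space M"
  shows "killed_future x q f w = future x q f 0 w - stopped_future f q q x (approach_time x w) w"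
    and "integrable lborel (\<lambda>t. indicator {0<..} t * (of_bool (ereal t < approach_time x w) * (exp (- q * t) * f (x + X (max 0 t) w))))"
    and "0 \<le> killed_future x q f w"
proof -
  let ?a = "approach_time x w"
  let ?g = "\<lambda>t. exp (- q * t) * f (x + X (max 0 t) w)"
  note [measurable] = f(1)
  have [measurable]: "(\<lambda>h. w) \<in> measurable lborel M" using w by simp
  have int: "integrable lborel (\<lambda>t. indicator {0<..} t * ?g t)"
    using future_integrable[OF f q w, of x 0] by simp
  show ik: "integrable lborel (\<lambda>t. indicator {0<..} t * (of_bool (ereal t < ?a) * ?g t))"
    by (rule Bochner_Integration.integrable_bound[OF int]) (auto intro!: AE_I2 split: split_indicator)
  show "0 \<le> killed_future x q f w"
    unfolding killed_future_def using f(2) by (intro Bochner_Integration.integral_nonneg) auto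
  consider "?a = \<infinity>" | T where "?a = ereal T" "0 \<le> T"
    using approach_time_nonneg[of x w] by (cases "?a") auto
  then show "killed_future x q f w = future x q f 0 w - stopped_future f q q x (?a) w"
  proof cases
    case 1
    then show ?thesis by (simp add: killed_future_def future_def stopped_future_def)
  next
    case 2
    have stopped: "stopped_future f q q x (?a) w = (LBINT t. indicator {T<..} t * ?g t)"
      using 2 by (simp add: stopped_future_def future_eq_tail[OF f q q] exp_minus)
    have iT: "integrable lborel (\<lambda>t. indicator {T<..} t * ?g t)"
      by (rule Bochner_Integration.integrable_bound[OF int]) (use 2 in \<open>auto intro!: AE_I2 split: split_indicator\<close>)
    have "future x q f 0 w - stopped_future f q q x (?a) w
       = (LBINT t. indicator {0<..} t * ?g t - indicator {T<..} t * ?g t)"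
      unfolding stopped by (subst Bochner_Integration.integral_diff[OF int iT]) (simp add: future_def)
    also have "\<dots> = killed_future x q f w"
      unfolding killed_future_def
    proof (rule integral_cong_AE)
      show "AE t in lborel. indicator {0<..} t * ?g t - indicator {T<..} t * ?g t
         = indicator {0<..} t * (of_bool (ereal t < ?a) * ?g t)"
        using AE_lborel_singleton[of T] by eventually_elim (use 2 in \<open>auto split: split_indicator\<close>)
    qed measurable
    finally show ?thesis ..
  qed
qed

text \<open>In expectation, the whole integral is the resolvent at x. The tail is the resolvent at 0
  times the Laplace transform of the approach time, which is
  \<open>res_density q (- x) / res_density q 0\<close>.\<close>

lemma expectation_killed_future:
  assumes q: "q > 0"
  shows "(\<integral>\<^sup>+w. ennreal (killed_future x q (indicator {a<..<b}) w) \<partial>M) = ennreal (LBINT y:{a<..<b}. killed_res_density q x y)"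
    and "0 \<le> (LBINT y:{a<..<b}. killed_res_density q x y)"
proof -
  let ?f = "indicator {a<..<b} :: real \<Rightarrow> real"
  let ?T = "approach_time x"
  have f: "?f \<in> borel_measurable borel" "\<And>v. 0 \<le> ?f v" "\<And>v. ?f v \<le> 1" by (auto split: split_indicator)
  have "emeasure lborel {a<..<b} \<le> emeasure lborel {a..b}" by (rule emeasure_mono) auto
  then have int: "integrable lborel ?f"
    by (intro integrable_real_indicator) (auto simp: emeasure_lborel_Icc_eq elim: order_le_less_trans)
  have m1[measurable]: "(\<lambda>w. future x q ?f 0 w) \<in> borel_measurable M"
    by (rule future_measurable[OF f q]) simp
  have m2[measurable]: "(\<lambda>w. stopped_future ?f q q x (?T w) w) \<in> borel_measurable M"
    by (rule stopped_future_measurable[OF f q q]) simp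
  have i1: "integrable M (\<lambda>w. future x q ?f 0 w)"
    using future_nonneg[OF f q] future_le[OF f q] by (intro integrable_const_bound[where B="1 / q"]) auto
  have i2: "integrable M (\<lambda>w. stopped_future ?f q q x (?T w) w)"
    using stopped_future_bounds[OF f q q _ approach_time_nonneg] by (intro integrable_const_bound[where B="1 / q"]) auto
  have cong: "killed_future x q ?f w = future x q ?f 0 w - stopped_future ?f q q x (?T w) w" if "w \<in> space M" for w
    by (rule killed_future(1)[OF f q that])
  have ik: "integrable M (killed_future x q ?f)"
    by (subst Bochner_Integration.integrable_cong[OF refl cong]) (auto intro: i1 i2)
  have "(\<integral>w. killed_future x q ?f w \<partial>M) = (\<integral>w. future x q ?f 0 w - stopped_future ?f q q x (?T w) w \<partial>M)"
    by (intro Bochner_Integration.integral_cong refl cong)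
  also have "\<dots> = resolvent q ?f x - resolvent q ?f 0 * (res_density q (- x) / res_density q 0)"
    using i1 i2 unfolding resolvent_eq_expectation[OF f q, of x] laplace_approach_time[OF q, symmetric] strong_markov_approach[OF f q q int, symmetric]
    by simp
  also have "\<dots> = (LBINT y. ?f y * res_density q (y - x) - ?f y * res_density q (y - 0) * (res_density q (- x) / res_density q 0))"
    using resolvent_nn(2)[OF f q, of x] resolvent_nn(2)[OF f q, of 0] unfolding resolvent_def
    by (subst Bochner_Integration.integral_diff) auto
  also have "\<dots> = (LBINT y:{a<..<b}. killed_res_density q x y)"
    unfolding set_lebesgue_integral_def killed_res_density_def
    by (intro Bochner_Integration.integral_cong) (auto split: split_indicator)
  finally have eq: "(\<integral>w. killed_future x q ?f w \<partial>M) = (LBINT y:{a<..<b}. killed_res_density q x y)" .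
  show "(\<integral>\<^sup>+w. ennreal (killed_future x q ?f w) \<partial>M) = ennreal (LBINT y:{a<..<b}. killed_res_density q x y)"
    unfolding eq[symmetric] using killed_future(3)[OF f q] by (intro nn_integral_eq_integral ik AE_I2) auto
  show "0 \<le> (LBINT y:{a<..<b}. killed_res_density q x y)"
    unfolding eq[symmetric] using killed_future(3)[OF f q] by (intro Bochner_Integration.integral_nonneg_AE AE_I2) auto
qed

text \<open>Expected time spent in a set before the approach time. As an image of a product measure
  with density it is a measure by construction, so it is determined by its values on intervals;
  \<open>killed_potential\<close> is only a set function computed through the completion.\<close>

definition occupation :: "real \<Rightarrow> real measure" where
  "occupation x = distr (density (lborel \<Otimes>\<^sub>M M) (indicator {p \<in> space (lborel \<Otimes>\<^sub>M M). 0 < fst p \<and> ereal (fst p) < approach_time x (snd p)}))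
     borel (\<lambda>p. x + X (max 0 (fst p)) (snd p))"

lemma sets_occupation [simp]: "sets (occupation x) = sets borel"
  by (simp add: occupation_def)

lemma emeasure_occupation_pair:
  assumes [measurable]: "A \<in> sets borel"
  shows "emeasure (occupation x) A
    = (\<integral>\<^sup>+p. of_bool (0 < fst p \<and> ereal (fst p) < approach_time x (snd p)) * indicator A (x + X (max 0 (fst p)) (snd p)) \<partial>(lborel \<Otimes>\<^sub>M M))"
proof -
  have "emeasure (occupation x) A = (\<integral>\<^sup>+v. indicator A v \<partial>occupation x)" by simp
  also have "\<dots> = (\<integral>\<^sup>+p. of_bool (0 < fst p \<and> ereal (fst p) < approach_time x (snd p)) * indicator A (x + X (max 0 (fst p)) (snd p)) \<partial>(lborel \<Otimes>\<^sub>M M))"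
    unfolding occupation_def
    by (subst nn_integral_distr, measurable, subst nn_integral_density, measurable)
       (intro nn_integral_cong, auto simp: indicator_def)
  finally show ?thesis .
qed

lemma emeasure_occupation:
  assumes [measurable]: "A \<in> sets borel"
  shows "emeasure (occupation x) A = (\<integral>\<^sup>+t\<in>{0<..}. emeasure M {w \<in> space M. ereal t < approach_time x w \<and> x + X t w \<in> A} \<partial>lborel)"
proof -
  let ?S = "\<lambda>t. {w \<in> space M. ereal t < approach_time x w \<and> x + X t w \<in> A}"
  have "emeasure (occupation x) A = (\<integral>\<^sup>+t. (\<integral>\<^sup>+w. of_bool (0 < t \<and> ereal t < approach_time x w) * indicator A (x + X (max 0 t) w) \<partial>M) \<partial>lborel)"
    unfolding emeasure_occupation_pair[OF assms] by (subst nn_integral_fst[symmetric]) auto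
  also have "\<dots> = (\<integral>\<^sup>+t\<in>{0<..}. emeasure M (?S t) \<partial>lborel)"
  proof (rule nn_integral_cong)
    fix t :: real
    show "(\<integral>\<^sup>+w. of_bool (0 < t \<and> ereal t < approach_time x w) * indicator A (x + X (max 0 t) w) \<partial>M)
       = emeasure M (?S t) * indicator {0<..} t"
    proof (cases "0 < t")
      case True
      then have "(\<integral>\<^sup>+w. of_bool (0 < t \<and> ereal t < approach_time x w) * indicator A (x + X (max 0 t) w) \<partial>M)
        = (\<integral>\<^sup>+w. indicator (?S t) w \<partial>M)"
        by (intro nn_integral_cong) (auto simp: indicator_def)
      also have "\<dots> = emeasure M (?S t)"
        by (rule nn_integral_indicator) measurable
      finally show ?thesis using True by simp
    qed simp
  qed
  finally show ?thesis .
qed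

text \<open>Let q decrease to 0 in the expected killed integral of the interval. The path side
  increases to the occupation measure by monotone convergence, and the analytic side converges to
  the integral of the killed density.\<close>

lemma emeasure_occupation_interval:
  assumes ab: "a < b"
  shows "emeasure (occupation x) {a<..<b} = ennreal (LBINT y:{a<..<b}. killed_density \<alpha> \<rho> x y)"
    and "0 \<le> (LBINT y:{a<..<b}. killed_density \<alpha> \<rho> x y)"
proof -
  let ?f = "indicator {a<..<b} :: real \<Rightarrow> real"
  have f: "?f \<in> borel_measurable borel" "\<And>v. 0 \<le> ?f v" "\<And>v. ?f v \<le> 1" by (auto split: split_indicator)
  interpret P: pair_sigma_finite lborel M ..
  define q where "q n = inverse (real (Suc n))" for n
  have q: "q n > 0" "q n \<le> 1" "q (Suc n) \<le> q n" for n
    by (auto simp: q_def intro!: le_imp_inverse_le) (auto simp: field_simps)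
  have q0: "q \<longlonglongrightarrow> 0" unfolding q_def by (rule LIMSEQ_inverse_real_of_nat)
  let ?g = "\<lambda>n p. ennreal (indicator {0<..} (fst p) * (of_bool (ereal (fst p) < approach_time x (snd p)) * (exp (- q n * fst p) * ?f (x + X (max 0 (fst p)) (snd p)))))"
  have meas: "?g n \<in> borel_measurable (lborel \<Otimes>\<^sub>M M)" for n by measurable
  have "(\<lambda>n. \<integral>\<^sup>+p. ?g n p \<partial>(lborel \<Otimes>\<^sub>M M)) \<longlonglongrightarrow> emeasure (occupation x) {a<..<b}"
    unfolding emeasure_occupation_pair[of "{a<..<b}", simplified]
  proof (rule nn_integral_LIMSEQ[OF _ meas])
    \<comment> \<open>Discounting becomes weaker as \<open>q n\<close> decreases.\<close>
    show "incseq ?g"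
    proof (rule incseq_SucI, rule le_funI)
      fix n p
      show "?g n p \<le> ?g (Suc n) p"
        using q(3)[of n] by (auto intro!: ennreal_leI mult_right_mono split: split_indicator)
    qed
    fix p :: "real \<times> 'w"
    have "(\<lambda>n. exp (- q n * fst p)) \<longlonglongrightarrow> exp (- 0 * fst p)" by (intro tendsto_intros q0)
    then have "(\<lambda>n. ?g n p) \<longlonglongrightarrow> ennreal (indicator {0<..} (fst p) * (of_bool (ereal (fst p) < approach_time x (snd p)) * (exp (- 0 * fst p) * ?f (x + X (max 0 (fst p)) (snd p)))))"
      by (intro tendsto_ennrealI tendsto_mult tendsto_const)
    also have "ennreal (indicator {0<..} (fst p) * (of_bool (ereal (fst p) < approach_time x (snd p)) * (exp (- 0 * fst p) * ?f (x + X (max 0 (fst p)) (snd p)))))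
       = of_bool (0 < fst p \<and> ereal (fst p) < approach_time x (snd p)) * indicator {a<..<b} (x + X (max 0 (fst p)) (snd p))"
      by (auto simp: indicator_def)
    finally show "(\<lambda>n. ?g n p) \<longlonglongrightarrow> of_bool (0 < fst p \<and> ereal (fst p) < approach_time x (snd p)) * indicator {a<..<b} (x + X (max 0 (fst p)) (snd p))" .
  qed
  moreover have "(\<integral>\<^sup>+p. ?g n p \<partial>(lborel \<Otimes>\<^sub>M M)) = ennreal (LBINT y:{a<..<b}. killed_res_density (q n) x y)" for n
  proof -
    have "(\<integral>\<^sup>+p. ?g n p \<partial>(lborel \<Otimes>\<^sub>M M)) = (\<integral>\<^sup>+w. (\<integral>\<^sup>+t. ?g n (t, w) \<partial>lborel) \<partial>M)"
      using P.nn_integral_snd[OF meas[of n]] by simp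
    also have "\<dots> = (\<integral>\<^sup>+w. ennreal (killed_future x (q n) ?f w) \<partial>M)"
    proof (rule nn_integral_cong)
      fix w assume w: "w \<in> space M"
      show "(\<integral>\<^sup>+t. ?g n (t, w) \<partial>lborel) = ennreal (killed_future x (q n) ?f w)"
        unfolding killed_future_def fst_conv snd_conv
        by (intro nn_integral_eq_integral killed_future(2)[OF f q(1) w]) auto
    qed
    finally show ?thesis unfolding expectation_killed_future(1)[OF q(1)] .
  qed
  moreover have lim: "(\<lambda>n. LBINT y:{a<..<b}. killed_res_density (q n) x y) \<longlonglongrightarrow> (LBINT y:{a<..<b}. killed_density \<alpha> \<rho> x y)"
    by (rule killed_res_density_integral_tendsto[OF q(1,2) q0 ab])
  ultimately show "emeasure (occupation x) {a<..<b} = ennreal (LBINT y:{a<..<b}. killed_density \<alpha> \<rho> x y)"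
    using LIMSEQ_unique[OF _ tendsto_ennrealI[OF lim]] by simp
  show "0 \<le> (LBINT y:{a<..<b}. killed_density \<alpha> \<rho> x y)"
    using lim expectation_killed_future(2)[OF q(1)] by (intro LIMSEQ_le_const[OF lim]) auto
qed

text \<open>The integrals over intervals are masses of the occupation measure. The sign matters
  because \<open>ennreal\<close> truncates negative values, so only a nonnegative function agrees
  with the density that it induces.\<close>

lemma killed_density_nonneg: "0 \<le> killed_density \<alpha> \<rho> x y"
proof (rule continuous_nonneg_if_integrals_nonneg[OF continuous_killed_density])
  note [measurable] = borel_measurable_continuous_onI[OF continuous_killed_density]
  fix a b :: real assume ab: "a < b"
  have "(LBINT y:{a<..<b}. killed_density \<alpha> \<rho> x y) = (LBINT y:{a..b}. killed_density \<alpha> \<rho> x y)"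
    unfolding set_lebesgue_integral_def
    using AE_lborel_singleton[of a] AE_lborel_singleton[of b]
    by (intro integral_cong_AE) (auto split: split_indicator)
  then show "0 \<le> (LBINT y:{a..b}. killed_density \<alpha> \<rho> x y)"
    using emeasure_occupation_interval(2)[OF ab, of x] by simp
qed

lemma occupation_eq_density: "occupation x = density lborel (\<lambda>y. ennreal (killed_density \<alpha> \<rho> x y))"
proof (rule borel_measure_eqI_open_intervals)
  note [measurable] = borel_measurable_continuous_onI[OF continuous_killed_density]
  fix a b :: real assume ab: "a < b"
  have "integrable lborel (\<lambda>y. indicator {a<..<b} y *\<^sub>R killed_density \<alpha> \<rho> x y)"
  proof -
    have "set_integrable lborel {a..b} (killed_density \<alpha> \<rho> x)"
      by (intro borel_integrable_atLeastAtMost' continuous_on_subset[OF continuous_killed_density]) auto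
    then have "set_integrable lborel {a<..<b} (killed_density \<alpha> \<rho> x)"
      by (rule set_integrable_subset) auto
    then show ?thesis by (simp add: set_integrable_def)
  qed
  then have "ennreal (LBINT y:{a<..<b}. killed_density \<alpha> \<rho> x y) = (\<integral>\<^sup>+y. ennreal (indicator {a<..<b} y *\<^sub>R killed_density \<alpha> \<rho> x y) \<partial>lborel)"
    unfolding set_lebesgue_integral_def using killed_density_nonneg
    by (intro nn_integral_eq_integral[symmetric]) auto
  also have "\<dots> = emeasure (density lborel (\<lambda>y. ennreal (killed_density \<alpha> \<rho> x y))) {a<..<b}"
    by (subst emeasure_density) (auto intro!: nn_integral_cong split: split_indicator)
  finally show "emeasure (occupation x) {a<..<b} = emeasure (density lborel (\<lambda>y. ennreal (killed_density \<alpha> \<rho> x y))) {a<..<b}"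
    unfolding emeasure_occupation_interval(1)[OF ab] .
  show "emeasure (occupation x) {a<..<b} \<noteq> \<infinity>" unfolding emeasure_occupation_interval(1)[OF ab] by simp
qed auto

text \<open>For each t the events defined by the hitting time and by the approach time differ by a
  null set, which the completion absorbs. The single time 0 has Lebesgue measure zero.\<close>

lemma killed_potential_eq_occupation:
  assumes x: "x \<noteq> 0" and [measurable]: "A \<in> sets borel"
  shows "killed_potential M X x A = emeasure (occupation x) A"
proof -
  let ?S = "\<lambda>t. {w \<in> space M. ereal t < approach_time x w \<and> x + X t w \<in> A}"
  have "emeasure (completion M) {w \<in> space M. ereal t < hit_zero X x w \<and> x + X t w \<in> A}
      = emeasure M (?S t)" for t
  proof (rule emeasure_completion_eq_AE)
    show "AE w in M. (w \<in> (?S t))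
       = (w \<in> {w \<in> space M. ereal t < hit_zero X x w \<and> x + X t w \<in> A})"
      using hit_zero_eq_approach_time[OF x] by eventually_elim auto
  qed auto
  then have "killed_potential M X x A = (\<integral>\<^sup>+t\<in>{0..}. emeasure M (?S t) \<partial>lborel)"
    unfolding killed_potential_def by simp
  also have "\<dots> = (\<integral>\<^sup>+t\<in>{0<..}. emeasure M (?S t) \<partial>lborel)"
    using AE_lborel_singleton[of 0] by (intro nn_integral_cong_AE, eventually_elim) (auto split: split_indicator)
  finally show ?thesis unfolding emeasure_occupation[OF assms(2)] .
qed

end

theorem theorem4p3:
  fixes M :: "'w measure" and X :: "real \<Rightarrow> 'w \<Rightarrow> real" and \<alpha> \<rho> x :: real
  assumes "stable_process M X \<alpha> \<rho>"
    and "1 < \<alpha>" "\<alpha> < 2"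
    and "0 < \<alpha> * \<rho>" "\<alpha> * \<rho> < 1"
    and "0 < \<alpha> * (1 - \<rho>)" "\<alpha> * (1 - \<rho>) < 1"
    and "x \<noteq> 0"
  shows "\<forall>A\<in>sets borel.
           killed_potential M X x A
             = (\<integral>\<^sup>+ y\<in>A. ennreal (killed_density \<alpha> \<rho> x y) \<partial>lborel)"
proof
  interpret prob_space M using assms(1) by (simp add: stable_process_def)
  interpret stable_motion M \<alpha> \<rho> X
    by standard (use assms in auto)
  fix A :: "real set" assume A: "A \<in> sets borel"
  show "killed_potential M X x A = (\<integral>\<^sup>+ y\<in>A. ennreal (killed_density \<alpha> \<rho> x y) \<partial>lborel)"
    unfolding killed_potential_eq_occupation[OF assms(8) A] occupation_eq_density
    using A borel_measurable_continuous_onI[OF continuous_killed_density] by (subst emeasure_density) auto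
qed

end
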